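(* Let $R$ be an indecomposable commutative ring and let $(\Sigma,i,q)$ be a discrete $R$-twist over an ample Hausdorff groupoid $G$. Let $(A,B)=(A_R(G;\Sigma),A_R(G^{(0)};q^{-1}(G^{(0)})))$. If $G$ is effective, then $(A,B)$ is an algebraic Cartan pair, and if $G$ is principal, then $(A,B)$ is an algebraic diagonal pair.
   Context: **Rings and groupoids.** A commutative ring $R$ with identity is indecomposable if its only idempotents are $0$ and $1$. $R^\times$ is its group of units, with the discrete topology. Groupoids are locally compact topological groupoids with Hausdorff unit space $G^{(0)}$ and range/source maps $r,s$. A bisection is a subset $D$ contained in an open set $O$ such that $r|_O,s|_O$ are homeomorphisms onto open subsets of $G^{(0)}$. $G$ is étale if $r$ is a local homeomorphism, and ample if it is étale with a basis of compact open bisections. With $\operatorname{Iso}(G)=\{\gamma\in G:r(\gamma)=s(\gamma)\}$, $G$ is principal if $\operatorname{Iso}(G)=G^{(0)}$ and effective if the topological interior of $\operatorname{Iso}(G)$ equals $G^{(0)}$. **Twists.** A discrete $R$-twist $(\Sigma,i,q)$ over an étale groupoid $G$ is a sequence $G^{(0)}\times R^\times\xrightarrow{i}\Sigma\xrightarrow{q}G$, where $G^{(0)}\times R^\times$ is the trivial group bundle, $\Sigma$ is a topological groupoid with $\Sigma^{(0)}=i(G^{(0)}\times\{1\})$ (identified with $G^{(0)}$), and $i,q$ are continuous groupoid homomorphisms restricting to homeomorphisms of unit spaces, such that: (DT1) $i(\{x\}\times R^\times)=q^{-1}(x)$ for $x\in G^{(0)}$, $i$ injective, $q$ surjective; (DT2)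 each $\alpha\in G$ has an open bisection $B_\alpha\ni\alpha$ and a continuous $P_\alpha\colon B_\alpha\to\Sigma$ with $q\circ P_\alpha=\mathrm{id}$ and $(\beta,t)\mapsto i(r(\beta),t)P_\alpha(\beta)$ a homeomorphism $B_\alpha\times R^\times\to q^{-1}(B_\alpha)$; (DT3) $i(r(\sigma),t)\sigma=\sigma i(s(\sigma),t)$. Write $t\cdot\sigma=i(r(\sigma),t)\sigma$. **Twisted Steinberg algebra.** $\operatorname{supp}(f)=\{f\neq0\}$, $\operatorname{supp}_G(f)=q(\operatorname{supp}(f))$. $A_R(G;\Sigma)$ is the set of locally constant $f\colon\Sigma\to R$ with $f(t\cdot\sigma)=t^{-1}f(\sigma)$ for $t\in R^\times$ and $q(\operatorname{supp}(f))$ compact; it is an $R$-algebra under pointwise operations and $(f*g)(\sigma)=\sum_{\alpha\in r^{-1}(r(\sigma))\cap\operatorname{supp}_G(f)}f(S(\alpha))g(S(\alpha)^{-1}\sigma)$, with $S\colon\operatorname{supp}_G(f)\to\operatorname{supp}(f)$ any section for $q$. $A_R(G^{(0)};q^{-1}(G^{(0)}))$ is the commutative subalgebra of those $f$ supported in $q^{-1}(G^{(0)})$. **Normalisers and pairs.** $I(B)$ is the set of idempotents of $B$, called a set of local units for $A$ if every finite $\{a_1,\dots,a_n\}\subseteq A$ admits $e\in I(B)$ with $ea_i=a_i=a_ie$ for all $i$. $N(B)=\{n\in A:\exists k\in A,\ knk=k,\ nkn=n,\ kBn\cup nBk\subseteq B\}$; $k$ is unique, denoted $n^\dagger$. A normaliser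 $n\in N(B)$ is free if $n\in B$ or $(n^\dagger n)(nn^\dagger)=0$. A conditional expectation $P\colon A\to B$ is an $R$-linear map with $P|_B=\mathrm{id}_B$ and $P(bab')=bP(a)b'$; it is faithful if for each $a\neq0$ in $A$ there is $n\in N(B)$ with $P(na)\neq0$. Let $B\subseteq A$ be a commutative subalgebra such that: $te=0$ with $t\in R$, $e\in I(B)\setminus\{0\}$ implies $t=0$; $I(B)$ is a set of local units for $A$; $B=\operatorname{span}_RI(B)$; $A=\operatorname{span}_RN(B)$; and there is a faithful conditional expectation $A\to B$. Then $(A,B)$ is an algebraic diagonal pair if $A$ is spanned by the free normalisers of $B$, and an algebraic Cartan pair if $B$ is a maximal commutative subalgebra of $A$. *)

theory Defs
  imports "HOL-Analysis.Analysis"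
begin

section \<open>Topological groupoids\<close>

text \<open>The underlying set is the \<^const>\<open>topspace\<close> of the topology; units are elements of the
  groupoid.\<close>

record 'g groupoid_data =
  gtop :: "'g topology"
  rng :: "'g \<Rightarrow> 'g"
  src :: "'g \<Rightarrow> 'g"
  gmult :: "'g \<Rightarrow> 'g \<Rightarrow> 'g"
  ginv :: "'g \<Rightarrow> 'g"

abbreviation elems :: "'g groupoid_data \<Rightarrow> 'g set" where
  "elems G \<equiv> topspace (gtop G)"

definition units :: "'g groupoid_data \<Rightarrow> 'g set" where
  "units G = rng G ` elems G"

abbreviation units_top :: "'g groupoid_data \<Rightarrow> 'g topology" where
  "units_top G \<equiv> subtopology (gtop G) (units G)"

definition composable :: "'g groupoid_data \<Rightarrow> ('g \<times> 'g) set" where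
  "composable G = {(a, b). a \<in> elems G \<and> b \<in> elems G \<and> src G a = rng G b}"

locale groupoid =
  fixes G :: "'g groupoid_data"
  assumes rng_closed: "a \<in> elems G \<Longrightarrow> rng G a \<in> elems G"
    and src_closed: "a \<in> elems G \<Longrightarrow> src G a \<in> elems G"
    and rng_rng: "a \<in> elems G \<Longrightarrow> rng G (rng G a) = rng G a"
    and src_rng: "a \<in> elems G \<Longrightarrow> src G (rng G a) = rng G a"
    and rng_src: "a \<in> elems G \<Longrightarrow> rng G (src G a) = src G a"
    and src_src: "a \<in> elems G \<Longrightarrow> src G (src G a) = src G a"
    and mult_closed: "(a, b) \<in> composable G \<Longrightarrow> gmult G a b \<in> elems G"
    and rng_mult: "(a, b) \<in> composable G \<Longrightarrow> rng G (gmult G a b) = rng G a"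
    and src_mult: "(a, b) \<in> composable G \<Longrightarrow> src G (gmult G a b) = src G b"
    and mult_assoc: "(a, b) \<in> composable G \<Longrightarrow> (b, c) \<in> composable G \<Longrightarrow>
      gmult G (gmult G a b) c = gmult G a (gmult G b c)"
    and rng_mult_left: "a \<in> elems G \<Longrightarrow> gmult G (rng G a) a = a"
    and src_mult_right: "a \<in> elems G \<Longrightarrow> gmult G a (src G a) = a"
    and inv_closed: "a \<in> elems G \<Longrightarrow> ginv G a \<in> elems G"
    and rng_inv: "a \<in> elems G \<Longrightarrow> rng G (ginv G a) = src G a"
    and src_inv: "a \<in> elems G \<Longrightarrow> src G (ginv G a) = rng G a"
    and mult_inv: "a \<in> elems G \<Longrightarrow> gmult G a (ginv G a) = rng G a"
    and inv_mult: "a \<in> elems G \<Longrightarrow> gmult G (ginv G a) a = src G a"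

locale topological_groupoid = groupoid +
  assumes continuous_mult:
      "continuous_map (subtopology (prod_topology (gtop G) (gtop G)) (composable G)) (gtop G)
         (\<lambda>(a, b). gmult G a b)"
    and continuous_inv: "continuous_map (gtop G) (gtop G) (ginv G)"

definition homeo_onto_open_units :: "'g groupoid_data \<Rightarrow> ('g \<Rightarrow> 'g) \<Rightarrow> 'g set \<Rightarrow> bool" where
  "homeo_onto_open_units G h U \<longleftrightarrow>
     openin (units_top G) (h ` U) \<and>
     homeomorphic_map (subtopology (gtop G) U) (subtopology (units_top G) (h ` U)) h"

definition bisection :: "'g groupoid_data \<Rightarrow> 'g set \<Rightarrow> bool" where
  "bisection G D \<longleftrightarrow> (\<exists>U. openin (gtop G) U \<and> D \<subseteq> U \<and>
     homeo_onto_open_units G (rng G) U \<and> homeo_onto_open_units G (src G) U)"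

locale etale_groupoid = topological_groupoid +
  assumes locally_compact: "locally_compact_space (gtop G)"
    and Hausdorff_units: "Hausdorff_space (units_top G)"
    and rng_local_homeo:
      "a \<in> elems G \<Longrightarrow> \<exists>U. openin (gtop G) U \<and> a \<in> U \<and> homeo_onto_open_units G (rng G) U"

locale ample_groupoid = etale_groupoid +
  assumes compact_open_bisection_base:
    "openin (gtop G) =
       arbitrary union_of (\<lambda>D. openin (gtop G) D \<and> compactin (gtop G) D \<and> bisection G D)"

definition Iso :: "'g groupoid_data \<Rightarrow> 'g set" where
  "Iso G = {a \<in> elems G. rng G a = src G a}"

definition principal_groupoid :: "'g groupoid_data \<Rightarrow> bool" where
  "principal_groupoid G \<longleftrightarrow> Iso G = units G"

definition effective_groupoid :: "'g groupoid_data \<Rightarrow> bool" where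
  "effective_groupoid G \<longleftrightarrow> gtop G interior_of Iso G = units G"

definition groupoid_hom ::
  "'g groupoid_data \<Rightarrow> 'h groupoid_data \<Rightarrow> ('g \<Rightarrow> 'h) \<Rightarrow> bool" where
  "groupoid_hom G H h \<longleftrightarrow>
     h ` elems G \<subseteq> elems H \<and>
     (\<forall>(a, b) \<in> composable G. (h a, h b) \<in> composable H \<and>
        h (gmult G a b) = gmult H (h a) (h b))"

section \<open>Discrete twists\<close>

text \<open>Coefficient rings have the sort \<open>{comm_ring, comm_monoid_mult}\<close>, which is
  \<^class>\<open>comm_ring_1\<close> without \<open>0 \<noteq> 1\<close>; the zero ring is thus not excluded.\<close>

definition indecomposable_ring :: "'r::{comm_ring,comm_monoid_mult} itself \<Rightarrow> bool" where
  "indecomposable_ring _ \<longleftrightarrow> (\<forall>e::'r. e * e = e \<longrightarrow> e = 0 \<or> e = 1)"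

definition ring_units :: "'r::{comm_ring,comm_monoid_mult} set" where
  "ring_units = {t. \<exists>u. t * u = 1}"

definition unit_inv :: "'r::{comm_ring,comm_monoid_mult} \<Rightarrow> 'r" where
  "unit_inv t = (THE u. t * u = 1)"

definition trivial_bundle ::
  "'g groupoid_data \<Rightarrow> ('g \<times> 'r::{comm_ring,comm_monoid_mult}) groupoid_data" where
  "trivial_bundle G =
     \<lparr>gtop = prod_topology (units_top G) (discrete_topology ring_units),
      rng = (\<lambda>(x, t). (x, 1)),
      src = (\<lambda>(x, t). (x, 1)),
      gmult = (\<lambda>(x, t) (y, u). (x, t * u)),
      ginv = (\<lambda>(x, t). (x, unit_inv t))\<rparr>"

text \<open>The unit space of the twist is identified with that of \<open>G\<close> by means of \<open>q\<close>, whose restriction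
  to units is inverse to \<open>x \<mapsto> i (x, 1)\<close>; so \<open>r(\<sigma>)\<close>, read in the unit space of \<open>G\<close>,
  is \<open>q (rng Sig \<sigma>)\<close>.\<close>

definition twist_act ::
  "'s groupoid_data \<Rightarrow> ('g \<times> 'r \<Rightarrow> 's) \<Rightarrow> ('s \<Rightarrow> 'g) \<Rightarrow> 'r \<Rightarrow> 's \<Rightarrow> 's" where
  "twist_act Sig i q t \<sigma> = gmult Sig (i (q (rng Sig \<sigma>), t)) \<sigma>"

definition twist_preimage :: "'s groupoid_data \<Rightarrow> ('s \<Rightarrow> 'g) \<Rightarrow> 'g set \<Rightarrow> 's set" where
  "twist_preimage Sig q D = {\<sigma> \<in> elems Sig. q \<sigma> \<in> D}"

locale discrete_twist =
  base: etale_groupoid G + total: topological_groupoid Sig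
  for G :: "'g groupoid_data" and Sig :: "'s groupoid_data" +
  fixes i :: "'g \<times> 'r::{comm_ring,comm_monoid_mult} \<Rightarrow> 's"
    and q :: "'s \<Rightarrow> 'g"
  assumes units_twist: "units Sig = i ` (units G \<times> {1})"
    and continuous_i: "continuous_map (gtop (trivial_bundle G)) (gtop Sig) i"
    and continuous_q: "continuous_map (gtop Sig) (gtop G) q"
    and hom_i: "groupoid_hom (trivial_bundle G) Sig i"
    and hom_q: "groupoid_hom Sig G q"
    and homeo_i: "homeomorphic_map (units_top (trivial_bundle G)) (units_top Sig) i"
    and homeo_q: "homeomorphic_map (units_top Sig) (units_top G) q"
    and DT1_fibre: "x \<in> units G \<Longrightarrow> i ` ({x} \<times> ring_units) = twist_preimage Sig q {x}"
    and DT1_inj: "inj_on i (units G \<times> ring_units)"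
    and DT1_surj: "q ` elems Sig = elems G"
    and DT2: "a \<in> elems G \<Longrightarrow> \<exists>D P. openin (gtop G) D \<and> bisection G D \<and> a \<in> D \<and>
      continuous_map (subtopology (gtop G) D) (gtop Sig) P \<and>
      (\<forall>b\<in>D. q (P b) = b) \<and>
      homeomorphic_map
        (prod_topology (subtopology (gtop G) D) (discrete_topology ring_units))
        (subtopology (gtop Sig) (twist_preimage Sig q D))
        (\<lambda>(b, t). gmult Sig (i (rng G b, t)) (P b))"
    and DT3: "\<sigma> \<in> elems Sig \<Longrightarrow> t \<in> ring_units \<Longrightarrow>
      gmult Sig (i (q (rng Sig \<sigma>), t)) \<sigma> = gmult Sig \<sigma> (i (q (src Sig \<sigma>), t))"

section \<open>Algebraic Cartan and diagonal pairs\<close>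

text \<open>Algebras need not have an identity.\<close>

record ('r, 'a) algebra_data =
  acarrier :: "'a set"
  azero :: 'a
  aadd :: "'a \<Rightarrow> 'a \<Rightarrow> 'a"
  asmult :: "'r \<Rightarrow> 'a \<Rightarrow> 'a"
  amult :: "'a \<Rightarrow> 'a \<Rightarrow> 'a"

locale nonunital_algebra =
  fixes A :: "('r::{comm_ring,comm_monoid_mult}, 'a) algebra_data"
  assumes zero_closed: "azero A \<in> acarrier A"
    and add_closed: "\<lbrakk>x \<in> acarrier A; y \<in> acarrier A\<rbrakk> \<Longrightarrow> aadd A x y \<in> acarrier A"
    and smult_closed: "x \<in> acarrier A \<Longrightarrow> asmult A t x \<in> acarrier A"
    and mult_closed: "\<lbrakk>x \<in> acarrier A; y \<in> acarrier A\<rbrakk> \<Longrightarrow> amult A x y \<in> acarrier A"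
    and add_assoc: "\<lbrakk>x \<in> acarrier A; y \<in> acarrier A; z \<in> acarrier A\<rbrakk> \<Longrightarrow>
      aadd A (aadd A x y) z = aadd A x (aadd A y z)"
    and add_commute: "\<lbrakk>x \<in> acarrier A; y \<in> acarrier A\<rbrakk> \<Longrightarrow> aadd A x y = aadd A y x"
    and add_zero: "x \<in> acarrier A \<Longrightarrow> aadd A x (azero A) = x"
    and add_inverse: "x \<in> acarrier A \<Longrightarrow> \<exists>y\<in>acarrier A. aadd A x y = azero A"
    and smult_one: "x \<in> acarrier A \<Longrightarrow> asmult A 1 x = x"
    and smult_smult: "x \<in> acarrier A \<Longrightarrow> asmult A (t * u) x = asmult A t (asmult A u x)"
    and smult_add_left: "x \<in> acarrier A \<Longrightarrow>
      asmult A (t + u) x = aadd A (asmult A t x) (asmult A u x)"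
    and smult_add_right: "\<lbrakk>x \<in> acarrier A; y \<in> acarrier A\<rbrakk> \<Longrightarrow>
      asmult A t (aadd A x y) = aadd A (asmult A t x) (asmult A t y)"
    and mult_assoc: "\<lbrakk>x \<in> acarrier A; y \<in> acarrier A; z \<in> acarrier A\<rbrakk> \<Longrightarrow>
      amult A (amult A x y) z = amult A x (amult A y z)"
    and distrib_left: "\<lbrakk>x \<in> acarrier A; y \<in> acarrier A; z \<in> acarrier A\<rbrakk> \<Longrightarrow>
      amult A x (aadd A y z) = aadd A (amult A x y) (amult A x z)"
    and distrib_right: "\<lbrakk>x \<in> acarrier A; y \<in> acarrier A; z \<in> acarrier A\<rbrakk> \<Longrightarrow>
      amult A (aadd A x y) z = aadd A (amult A x z) (amult A y z)"
    and smult_mult_left: "\<lbrakk>x \<in> acarrier A; y \<in> acarrier A\<rbrakk> \<Longrightarrow>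
      amult A (asmult A t x) y = asmult A t (amult A x y)"
    and smult_mult_right: "\<lbrakk>x \<in> acarrier A; y \<in> acarrier A\<rbrakk> \<Longrightarrow>
      amult A x (asmult A t y) = asmult A t (amult A x y)"

definition subalgebra :: "('r, 'a) algebra_data \<Rightarrow> 'a set \<Rightarrow> bool" where
  "subalgebra A B \<longleftrightarrow> B \<subseteq> acarrier A \<and> azero A \<in> B \<and>
     (\<forall>x\<in>B. \<forall>y\<in>B. aadd A x y \<in> B \<and> amult A x y \<in> B) \<and>
     (\<forall>t. \<forall>x\<in>B. asmult A t x \<in> B)"

definition commutative_subalgebra :: "('r, 'a) algebra_data \<Rightarrow> 'a set \<Rightarrow> bool" where
  "commutative_subalgebra A B \<longleftrightarrow> subalgebra A B \<and>
     (\<forall>x\<in>B. \<forall>y\<in>B. amult A x y = amult A y x)"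

inductive_set lin_span :: "('r, 'a) algebra_data \<Rightarrow> 'a set \<Rightarrow> 'a set"
  for A :: "('r, 'a) algebra_data" and X :: "'a set" where
  span_zero: "azero A \<in> lin_span A X"
| span_step: "x \<in> X \<Longrightarrow> y \<in> lin_span A X \<Longrightarrow> aadd A (asmult A t x) y \<in> lin_span A X"

definition idempotents :: "('r, 'a) algebra_data \<Rightarrow> 'a set \<Rightarrow> 'a set" where
  "idempotents A B = {e \<in> B. amult A e e = e}"

definition local_units :: "('r, 'a) algebra_data \<Rightarrow> 'a set \<Rightarrow> bool" where
  "local_units A E \<longleftrightarrow> (\<forall>F. finite F \<and> F \<subseteq> acarrier A \<longrightarrow>
     (\<exists>e\<in>E. \<forall>a\<in>F. amult A e a = a \<and> amult A a e = a))"

definition normaliser_inverse ::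
  "('r, 'a) algebra_data \<Rightarrow> 'a set \<Rightarrow> 'a \<Rightarrow> 'a \<Rightarrow> bool" where
  "normaliser_inverse A B n k \<longleftrightarrow> k \<in> acarrier A \<and>
     amult A (amult A k n) k = k \<and> amult A (amult A n k) n = n \<and>
     (\<forall>b\<in>B. amult A (amult A k b) n \<in> B \<and> amult A (amult A n b) k \<in> B)"

definition normalisers :: "('r, 'a) algebra_data \<Rightarrow> 'a set \<Rightarrow> 'a set" where
  "normalisers A B = {n \<in> acarrier A. \<exists>k. normaliser_inverse A B n k}"

definition dagger :: "('r, 'a) algebra_data \<Rightarrow> 'a set \<Rightarrow> 'a \<Rightarrow> 'a" where
  "dagger A B n = (THE k. normaliser_inverse A B n k)"

definition free_normalisers :: "('r, 'a) algebra_data \<Rightarrow> 'a set \<Rightarrow> 'a set" where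
  "free_normalisers A B = {n \<in> normalisers A B. n \<in> B \<or>
     amult A (amult A (dagger A B n) n) (amult A n (dagger A B n)) = azero A}"

definition conditional_expectation ::
  "('r, 'a) algebra_data \<Rightarrow> 'a set \<Rightarrow> ('a \<Rightarrow> 'a) \<Rightarrow> bool" where
  "conditional_expectation A B P \<longleftrightarrow>
     P ` acarrier A \<subseteq> B \<and>
     (\<forall>x\<in>acarrier A. \<forall>y\<in>acarrier A. P (aadd A x y) = aadd A (P x) (P y)) \<and>
     (\<forall>t. \<forall>x\<in>acarrier A. P (asmult A t x) = asmult A t (P x)) \<and>
     (\<forall>b\<in>B. P b = b) \<and>
     (\<forall>b\<in>B. \<forall>a\<in>acarrier A. \<forall>b'\<in>B.
        P (amult A (amult A b a) b') = amult A (amult A b (P a)) b')"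

definition faithful_expectation ::
  "('r, 'a) algebra_data \<Rightarrow> 'a set \<Rightarrow> ('a \<Rightarrow> 'a) \<Rightarrow> bool" where
  "faithful_expectation A B P \<longleftrightarrow>
     (\<forall>a\<in>acarrier A. a \<noteq> azero A \<longrightarrow> (\<exists>n\<in>normalisers A B. P (amult A n a) \<noteq> azero A))"

definition quasi_cartan_conditions ::
  "('r::{comm_ring,comm_monoid_mult}, 'a) algebra_data \<Rightarrow> 'a set \<Rightarrow> bool" where
  "quasi_cartan_conditions A B \<longleftrightarrow>
     nonunital_algebra A \<and> commutative_subalgebra A B \<and>
     (\<forall>t. \<forall>e\<in>idempotents A B - {azero A}. asmult A t e = azero A \<longrightarrow> t = 0) \<and>
     local_units A (idempotents A B) \<and>
     B = lin_span A (idempotents A B) \<and>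
     acarrier A = lin_span A (normalisers A B) \<and>
     (\<exists>P. conditional_expectation A B P \<and> faithful_expectation A B P)"

definition algebraic_diagonal_pair ::
  "('r::{comm_ring,comm_monoid_mult}, 'a) algebra_data \<Rightarrow> 'a set \<Rightarrow> bool" where
  "algebraic_diagonal_pair A B \<longleftrightarrow>
     quasi_cartan_conditions A B \<and> acarrier A = lin_span A (free_normalisers A B)"

definition algebraic_cartan_pair ::
  "('r::{comm_ring,comm_monoid_mult}, 'a) algebra_data \<Rightarrow> 'a set \<Rightarrow> bool" where
  "algebraic_cartan_pair A B \<longleftrightarrow>
     quasi_cartan_conditions A B \<and>
     (\<forall>C. commutative_subalgebra A C \<and> B \<subseteq> C \<longrightarrow> C = B)"

section \<open>Twisted Steinberg algebras\<close>

definition supp :: "'s groupoid_data \<Rightarrow> ('s \<Rightarrow> 'r::zero) \<Rightarrow> 's set" where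
  "supp Sig f = {\<sigma> \<in> elems Sig. f \<sigma> \<noteq> 0}"

definition locally_constant :: "'s topology \<Rightarrow> ('s \<Rightarrow> 'r) \<Rightarrow> bool" where
  "locally_constant T f \<longleftrightarrow>
     (\<forall>\<sigma>\<in>topspace T. \<exists>U. openin T U \<and> \<sigma> \<in> U \<and> (\<forall>\<tau>\<in>U. f \<tau> = f \<sigma>))"

text \<open>A function on the twist is represented by its extension by \<open>0\<close> to the whole type.\<close>

definition steinberg_functions ::
  "'g groupoid_data \<Rightarrow> 's groupoid_data \<Rightarrow> ('g \<times> 'r \<Rightarrow> 's) \<Rightarrow> ('s \<Rightarrow> 'g) \<Rightarrow>
   ('s \<Rightarrow> 'r::{comm_ring,comm_monoid_mult}) set" where
  "steinberg_functions G Sig i q = {f.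
     (\<forall>\<sigma>. \<sigma> \<notin> elems Sig \<longrightarrow> f \<sigma> = 0) \<and>
     locally_constant (gtop Sig) f \<and>
     (\<forall>t\<in>ring_units. \<forall>\<sigma>\<in>elems Sig. f (twist_act Sig i q t \<sigma>) = unit_inv t * f \<sigma>) \<and>
     compactin (gtop G) (q ` supp Sig f)}"

text \<open>The section of \<open>q\<close> over the support of \<open>f\<close> is \<open>inv_into (supp Sig f) q\<close>. For \<open>f\<close> in the
  algebra the index set is finite, being the intersection of a compact set with a closed discrete
  one, so \<^const>\<open>sum\<close> has its intended value; it does not depend on the section, because the
  factors \<open>t\<inverse>\<close> and \<open>t\<close> that arise from another choice cancel.\<close>

definition convolution ::
  "'g groupoid_data \<Rightarrow> 's groupoid_data \<Rightarrow> ('s \<Rightarrow> 'g) \<Rightarrow>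
   ('s \<Rightarrow> 'r::{comm_ring,comm_monoid_mult}) \<Rightarrow> ('s \<Rightarrow> 'r) \<Rightarrow> 's \<Rightarrow> 'r" where
  "convolution G Sig q f g \<sigma> =
     (if \<sigma> \<in> elems Sig then
        let S = inv_into (supp Sig f) q in
        \<Sum>\<alpha> \<in> {\<alpha> \<in> elems G. rng G \<alpha> = q (rng Sig \<sigma>)} \<inter> q ` supp Sig f.
          f (S \<alpha>) * g (gmult Sig (ginv Sig (S \<alpha>)) \<sigma>)
      else 0)"

definition twisted_steinberg_algebra ::
  "'g groupoid_data \<Rightarrow> 's groupoid_data \<Rightarrow> ('g \<times> 'r \<Rightarrow> 's) \<Rightarrow> ('s \<Rightarrow> 'g) \<Rightarrow>
   ('r::{comm_ring,comm_monoid_mult}, 's \<Rightarrow> 'r) algebra_data" where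
  "twisted_steinberg_algebra G Sig i q =
     \<lparr>acarrier = steinberg_functions G Sig i q,
      azero = (\<lambda>_. 0),
      aadd = (\<lambda>f g \<sigma>. f \<sigma> + g \<sigma>),
      asmult = (\<lambda>t f \<sigma>. t * f \<sigma>),
      amult = convolution G Sig q\<rparr>"

definition steinberg_unit_subalgebra ::
  "'g groupoid_data \<Rightarrow> 's groupoid_data \<Rightarrow> ('g \<times> 'r \<Rightarrow> 's) \<Rightarrow> ('s \<Rightarrow> 'g) \<Rightarrow>
   ('s \<Rightarrow> 'r::{comm_ring,comm_monoid_mult}) set" where
  "steinberg_unit_subalgebra G Sig i q =
     {f \<in> steinberg_functions G Sig i q. supp Sig f \<subseteq> twist_preimage Sig q (units G)}"

end

theory Submission
  imports Defs
begin

text \<open>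
  Write \<open>A\<close> for the algebra of the twist and \<open>B\<close> for the functions supported over the unit
  space. Everything is reduced to \<^emph>\<open>monomials\<close>: functions \<open>n\<close> in \<open>A\<close> whose nonzero values are units
  of \<open>R\<close> and whose support lies over a set on which range and source are injective. A local section
  of \<open>q\<close> yields a monomial near any given point (\<open>ex_monomial\<close>). Close to a point of \<open>\<Sigma>\<close>, both a given
  \<open>f\<close> in \<open>A\<close> and a monomial are constant, so by equivariance \<open>f\<close> is a scalar multiple of a monomial over
  a small open set (\<open>local_monomial_form\<close>); as supports are compact, the monomials span \<open>A\<close>.

  Convolving with a monomial on the left leaves a single term,
  \<open>(n \<star> g) \<sigma> = n \<tau> * g (\<tau>\<inverse> \<sigma>)\<close>, where \<open>\<tau>\<close> is any element of the support of \<open>n\<close> with the same range as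
  \<open>\<sigma>\<close> (\<open>monomial_conv\<close>). From this formula one reads off that \<open>n \<star> g\<close> is locally constant and that
  \<open>(n \<star> g) \<star> h = n \<star> (g \<star> h)\<close>; by linearity the same holds for every element of \<open>A\<close>, which is therefore
  an algebra. The function \<open>n\<^sup>\<dagger>(\<sigma>) = n(\<sigma>\<inverse>)\<inverse>\<close> is again a monomial, and the formula shows that it
  makes \<open>n\<close> a normaliser of \<open>B\<close>; so \<open>A\<close> is spanned by normalisers.

  Over the unit space the twist is trivial: an element of \<open>B\<close> is determined by its values on the
  units of \<open>\<Sigma>\<close>, and there convolution is pointwise multiplication. Hence \<open>B\<close> is commutative, it is
  spanned by the indicator functions of compact open sets of units, these form local units for \<open>A\<close>,
  and every idempotent of \<open>B\<close> takes only the values \<open>0\<close> and \<open>1\<close> on units because \<open>R\<close> is indecomposable.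
  As \<open>G\<close> is Hausdorff, its unit space is clopen, so restriction to it is a conditional expectation;
  it is faithful because multiplying by a monomial carries a nonzero value of \<open>f\<close> to a unit.

  If \<open>f\<close> commutes with the indicator functions in \<open>B\<close>, then range and source agree on its support.
  This support is open, so for effective \<open>G\<close> it consists of units, that is, \<open>f\<close> lies in \<open>B\<close>.
  If \<open>G\<close> is principal, then range and source differ at every point outside the unit space, and
  near such a point one finds monomials whose range and source are disjoint; these satisfy
  \<open>n \<star> n = 0\<close>, so they are free. Near a unit the monomials lie in \<open>B\<close>. So \<open>A\<close> is spanned by free
  normalisers.

  Over the zero ring there are no nonzero functions and all conditions hold trivially; this case is
  separated because monomials with prescribed support exist only when \<open>1 \<noteq> 0\<close>.
\<close>

section \<open>Units of the coefficient ring\<close>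

lemma unit_inv_eqI:
  fixes t u :: "'r::{comm_ring,comm_monoid_mult}"
  assumes "t * u = 1"
  shows "unit_inv t = u"
  unfolding unit_inv_def
proof (rule the_equality)
  show "t * u = 1" by fact
next
  fix v assume "t * v = 1"
  have "v = v * (t * u)" using assms by simp
  also have "\<dots> = (t * v) * u" by (simp add: ac_simps)
  also have "\<dots> = u" using \<open>t * v = 1\<close> by simp
  finally show "v = u" .
qed

lemma unit_inv_right [simp]: "t \<in> ring_units \<Longrightarrow> t * unit_inv t = 1"
  unfolding ring_units_def using unit_inv_eqI by blast

lemma unit_inv_left [simp]: "t \<in> ring_units \<Longrightarrow> unit_inv t * t = 1"
  by (simp add: mult.commute)

lemma unit_inv_closed [simp]: "t \<in> ring_units \<Longrightarrow> unit_inv t \<in> ring_units"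
  unfolding ring_units_def using unit_inv_left[unfolded ring_units_def] by blast

lemma one_ring_units [simp]: "1 \<in> ring_units"
  unfolding ring_units_def by (auto intro: exI[of _ 1])

lemma unit_inv_one [simp]: "unit_inv 1 = 1"
  by (rule unit_inv_eqI) simp

lemma ring_units_times:
  fixes t u :: "'r::{comm_ring,comm_monoid_mult}"
  assumes "t \<in> ring_units" "u \<in> ring_units"
  shows "t * u \<in> ring_units" "unit_inv (t * u) = unit_inv t * unit_inv u"
proof -
  have "(t * u) * (unit_inv t * unit_inv u) = (t * unit_inv t) * (u * unit_inv u)"
    by (simp only: ac_simps)
  also have "\<dots> = 1" using assms by simp
  finally have *: "(t * u) * (unit_inv t * unit_inv u) = 1" .
  show "t * u \<in> ring_units" using * unfolding ring_units_def by blast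
  show "unit_inv (t * u) = unit_inv t * unit_inv u" using * by (rule unit_inv_eqI)
qed

lemma unit_inv_unit_inv [simp]: "t \<in> ring_units \<Longrightarrow> unit_inv (unit_inv t) = t"
  by (rule unit_inv_eqI) simp

lemma unit_inv_cancel:
  fixes a :: "'r::{comm_ring,comm_monoid_mult}"
  assumes "t \<in> ring_units"
  shows "unit_inv t * (t * a) = a" "t * (unit_inv t * a) = a"
  using assms by (simp_all flip: mult.assoc)

lemma ring_units_mult_eq_0 [simp]:
  fixes a :: "'r::{comm_ring,comm_monoid_mult}"
  assumes "t \<in> ring_units"
  shows "t * a = 0 \<longleftrightarrow> a = 0" "a * t = 0 \<longleftrightarrow> a = 0"
proof -
  show "t * a = 0 \<longleftrightarrow> a = 0"
    using unit_inv_cancel(1)[OF assms, of a] by auto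
  then show "a * t = 0 \<longleftrightarrow> a = 0" by (simp add: mult.commute)
qed

section \<open>Groupoid identities\<close>

context groupoid
begin

declare rng_closed [simp] src_closed [simp] rng_rng [simp] src_rng [simp] rng_src [simp]
  src_src [simp] rng_mult_left [simp] src_mult_right [simp] inv_closed [simp] rng_inv [simp]
  src_inv [simp] mult_inv [simp] inv_mult [simp]

lemma in_composable:
  "(a, b) \<in> composable G \<longleftrightarrow> a \<in> elems G \<and> b \<in> elems G \<and> src G a = rng G b"
  by (simp add: composable_def)

lemma gmult_simps [simp]:
  assumes "a \<in> elems G" "b \<in> elems G" "src G a = rng G b"
  shows "gmult G a b \<in> elems G" "rng G (gmult G a b) = rng G a" "src G (gmult G a b) = src G b"
  using mult_closed rng_mult src_mult assms by (simp_all add: in_composable)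

lemma gmult_assoc:
  assumes "a \<in> elems G" "b \<in> elems G" "c \<in> elems G" "src G a = rng G b" "src G b = rng G c"
  shows "gmult G (gmult G a b) c = gmult G a (gmult G b c)"
  using mult_assoc assms by (simp add: in_composable)

lemma gmult_cancel [simp]:
  assumes "a \<in> elems G" "b \<in> elems G"
  shows "rng G a = rng G b \<Longrightarrow> gmult G a (gmult G (ginv G a) b) = b"
    and "src G a = rng G b \<Longrightarrow> gmult G (ginv G a) (gmult G a b) = b"
    and "src G b = rng G a \<Longrightarrow> gmult G (gmult G b a) (ginv G a) = b"
    and "src G b = src G a \<Longrightarrow> gmult G (gmult G b (ginv G a)) a = b"
proof -
  show "gmult G a (gmult G (ginv G a) b) = b" if "rng G a = rng G b"
    using assms that by (simp flip: gmult_assoc)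
  show "gmult G (ginv G a) (gmult G a b) = b" if "src G a = rng G b"
    using assms that by (simp flip: gmult_assoc)
  show "gmult G (gmult G b a) (ginv G a) = b" if "src G b = rng G a"
    using assms by (simp add: gmult_assoc that flip: that)
  show "gmult G (gmult G b (ginv G a)) a = b" if "src G b = src G a"
    using assms by (simp add: gmult_assoc that flip: that)
qed

lemma inv_unique:
  assumes "a \<in> elems G" "b \<in> elems G" "src G a = rng G b" "gmult G a b = rng G a"
  shows "ginv G a = b"
  using gmult_cancel(2)[of a b] src_mult_right[of "ginv G a"] assms by simp

lemma inv_inv [simp]: "a \<in> elems G \<Longrightarrow> ginv G (ginv G a) = a"
  by (rule inv_unique) simp_all

lemma inv_gmult:
  assumes "a \<in> elems G" "b \<in> elems G" "src G a = rng G b"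
  shows "ginv G (gmult G a b) = gmult G (ginv G b) (ginv G a)"
  by (rule inv_unique) (use assms in \<open>simp_all add: gmult_assoc\<close>)

lemma units_elems: "x \<in> units G \<Longrightarrow> x \<in> elems G"
  by (auto simp: units_def)

lemma unitsI: "x \<in> elems G \<Longrightarrow> rng G x = x \<Longrightarrow> x \<in> units G"
  unfolding units_def by (metis imageI)

lemma units_iff_rng: "x \<in> units G \<longleftrightarrow> x \<in> elems G \<and> rng G x = x"
  unfolding units_def by (metis (no_types, lifting) image_iff rng_closed rng_rng)

lemma units_simps [simp]:
  assumes "x \<in> units G"
  shows "x \<in> elems G" "rng G x = x" "src G x = x" "ginv G x = x"
proof -
  show 1: "x \<in> elems G" and 2: "rng G x = x" using assms by (auto simp: units_iff_rng)
  show 3: "src G x = x" using src_rng[OF 1] 2 by simp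
  show "ginv G x = x" by (rule inv_unique) (use 1 2 3 rng_mult_left[OF 1] in simp_all)
qed

lemma rng_units [simp]: "a \<in> elems G \<Longrightarrow> rng G a \<in> units G"
  unfolding units_def by (rule imageI)

lemma src_units [simp]: "a \<in> elems G \<Longrightarrow> src G a \<in> units G"
  using rng_units[OF src_closed, of a] by simp

lemma gmult_inv_eq_unitD:
  assumes "a \<in> elems G" "b \<in> elems G" "rng G a = rng G b" "gmult G (ginv G a) b \<in> units G"
  shows "a = b"
proof -
  have "gmult G (ginv G a) b = rng G (gmult G (ginv G a) b)" using assms by simp
  also have "\<dots> = src G a" using assms(1-3) by simp
  finally have "gmult G a (src G a) = b" using gmult_cancel(1)[of a b] assms by simp
  then show ?thesis using assms(1) by simp
qed

lemma unit_if_left_absorbed: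
  assumes "a \<in> elems G" "b \<in> elems G" "src G a = rng G b" "gmult G a b = b"
  shows "a = rng G b"
  using gmult_cancel(3)[of b a] assms by simp

lemma unit_if_right_absorbed:
  assumes "a \<in> elems G" "b \<in> elems G" "src G a = rng G b" "gmult G a b = a"
  shows "b = src G a"
  using gmult_cancel(2)[of a b] assms by simp

end

text \<open>Homomorphisms are only required to respect products. Since \<open>h (r a)\<close> fixes \<open>h a\<close> under left
  multiplication, cancellation forces it to be the range of \<open>h a\<close>; sources and inverses are similar.\<close>

lemma groupoid_hom_structure:
  assumes "groupoid G" "groupoid H" and hom: "groupoid_hom G H h" and a: "a \<in> elems G"
  shows "h a \<in> elems H" "h (rng G a) = rng H (h a)" "h (src G a) = src H (h a)"
    "h (ginv G a) = ginv H (h a)"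
proof -
  interpret G: groupoid G by fact
  interpret H: groupoid H by fact
  have el: "\<And>b. b \<in> elems G \<Longrightarrow> h b \<in> elems H"
    using hom by (auto simp: groupoid_hom_def)
  have mult: "src H (h b) = rng H (h c) \<and> h (gmult G b c) = gmult H (h b) (h c)"
    if "b \<in> elems G" "c \<in> elems G" "src G b = rng G c" for b c
    using hom that unfolding groupoid_hom_def by (force simp: G.in_composable H.in_composable)
  show "h a \<in> elems H" using el a by simp
  show rng: "h (rng G a) = rng H (h a)"
    using mult[of "rng G a" a] a H.unit_if_left_absorbed[of "h (rng G a)" "h a"] by (simp add: el)
  show src: "h (src G a) = src H (h a)"
    using mult[of a "src G a"] a H.unit_if_right_absorbed[of "h a" "h (src G a)"] by (simp add: el)
  show "h (ginv G a) = ginv H (h a)"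
    using mult[of a "ginv G a"] a rng H.inv_unique[of "h a" "h (ginv G a)"] by (simp add: el)
qed

section \<open>Topological, etale and ample groupoids\<close>

context topological_groupoid
begin

text \<open>Multiplication is continuous on the space of composable pairs; for pointwise products of
  continuous maps that subspace need not be mentioned.\<close>

lemma continuous_gmult:
  assumes "continuous_map X (gtop G) f" "continuous_map X (gtop G) g"
    and "\<And>x. x \<in> topspace X \<Longrightarrow> src G (f x) = rng G (g x)"
  shows "continuous_map X (gtop G) (\<lambda>x. gmult G (f x) (g x))"
proof -
  have "continuous_map X (subtopology (prod_topology (gtop G) (gtop G)) (composable G))
          (\<lambda>x. (f x, g x))"
    using assms continuous_map_funspace[OF assms(1)] continuous_map_funspace[OF assms(2)]
    by (auto simp: continuous_map_in_subtopology continuous_map_pairwise o_def in_composable)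
  from continuous_map_compose[OF this continuous_mult] show ?thesis by (simp add: o_def)
qed

lemma continuous_rng: "continuous_map (gtop G) (gtop G) (rng G)"
proof (rule continuous_map_eq)
  show "continuous_map (gtop G) (gtop G) (\<lambda>a. gmult G a (ginv G a))"
    by (intro continuous_gmult continuous_map_id[unfolded id_def] continuous_inv) auto
qed auto

lemma continuous_src: "continuous_map (gtop G) (gtop G) (src G)"
proof (rule continuous_map_eq)
  show "continuous_map (gtop G) (gtop G) (\<lambda>a. gmult G (ginv G a) a)"
    by (intro continuous_gmult continuous_map_id[unfolded id_def] continuous_inv) auto
qed auto

lemma openin_ginv_image:
  assumes "openin (gtop G) V"
  shows "openin (gtop G) (ginv G ` V)"
proof -
  have "ginv G ` V = {a \<in> elems G. ginv G a \<in> V}"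
  proof (intro equalityI subsetI)
    fix a assume "a \<in> {a \<in> elems G. ginv G a \<in> V}"
    then show "a \<in> ginv G ` V" by (intro image_eqI[of _ _ "ginv G a"]) auto
  qed (use openin_subset[OF assms] in auto)
  then show ?thesis using openin_continuous_map_preimage[OF continuous_inv assms] by simp
qed

text \<open>Continuity of \<open>(a, b) \<mapsto> a\<inverse> b\<close> at a pair with a common range. A term of a convolution depends on
  its arguments through this map.\<close>

lemma division_nbhd:
  assumes "openin (gtop G) O'" "a \<in> elems G" "b \<in> elems G" "rng G a = rng G b"
    and "gmult G (ginv G a) b \<in> O'"
  obtains V W where "openin (gtop G) V" "openin (gtop G) W" "a \<in> V" "b \<in> W"
    "\<And>c d. c \<in> V \<Longrightarrow> d \<in> W \<Longrightarrow> rng G c = rng G d \<Longrightarrow> gmult G (ginv G c) d \<in> O'"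
proof -
  let ?T = "prod_topology (gtop G) (gtop G)"
  let ?C = "{p. rng G (fst p) = rng G (snd p)}"
  let ?S = "subtopology ?T ?C"
  have fst: "continuous_map ?S (gtop G) fst" and snd: "continuous_map ?S (gtop G) snd"
    by (simp_all add: continuous_map_from_subtopology continuous_map_fst continuous_map_snd)
  have "continuous_map ?S (gtop G) (\<lambda>p. gmult G (ginv G (fst p)) (snd p))"
    using continuous_map_compose[OF fst continuous_inv] snd
    by (intro continuous_gmult) (auto simp: o_def)
  from openin_continuous_map_preimage[OF this assms(1)] obtain T where T: "openin ?T T"
    "{p \<in> topspace ?S. gmult G (ginv G (fst p)) (snd p) \<in> O'} = T \<inter> ?C"
    unfolding openin_subtopology by blast
  have "(a, b) \<in> T \<inter> ?C" using assms unfolding T(2)[symmetric] by (simp add: topspace_subtopology)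
  then obtain V W where VW: "openin (gtop G) V" "openin (gtop G) W" "a \<in> V" "b \<in> W" "V \<times> W \<subseteq> T"
    using T(1)[unfolded openin_prod_topology_alt, rule_format, of a b] by auto
  have "gmult G (ginv G c) d \<in> O'" if "c \<in> V" "d \<in> W" "rng G c = rng G d" for c d
  proof -
    have "(c, d) \<in> T \<inter> ?C" using that VW(5) by auto
    then show ?thesis unfolding T(2)[symmetric] by simp
  qed
  with VW show ?thesis using that by blast
qed

end

context etale_groupoid
begin

text \<open>If range is injective on an open set \<open>U\<close> containing both \<open>a\<close> and \<open>r(a)\<close>, then
  \<open>r(r(a)) = r(a)\<close> forces \<open>a = r(a)\<close>. So all elements close to a unit are units.\<close>

lemma openin_units: "openin (gtop G) (units G)"
proof (subst openin_subopen, intro ballI)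
  fix x assume x: "x \<in> units G"
  obtain U where U: "openin (gtop G) U" "x \<in> U" "homeo_onto_open_units G (rng G) U"
    using rng_local_homeo x by (meson units_elems)
  have inj: "inj_on (rng G) U"
    using U(3) openin_subset[OF U(1)] homeomorphic_imp_injective_map
    unfolding homeo_onto_open_units_def by (fastforce simp: Int_absorb1)
  let ?V = "U \<inter> {a \<in> elems G. rng G a \<in> U}"
  have "openin (gtop G) ?V"
    using U(1) openin_continuous_map_preimage[OF continuous_rng U(1)] by blast
  moreover have "?V \<subseteq> units G"
  proof
    fix a assume "a \<in> ?V"
    then show "a \<in> units G" using inj_onD[OF inj, of "rng G a" a] by (auto intro: unitsI)
  qed
  ultimately show "\<exists>T. openin (gtop G) T \<and> x \<in> T \<and> T \<subseteq> units G"
    using x U(2) by (intro exI[of _ ?V]) auto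
qed

lemma openin_rng_image:
  assumes V: "openin (gtop G) V"
  shows "openin (gtop G) (rng G ` V)"
proof (subst openin_subopen, intro ballI)
  fix x assume "x \<in> rng G ` V"
  then obtain a where a: "a \<in> V" "x = rng G a" by blast
  obtain U where U: "openin (gtop G) U" "a \<in> U" "homeo_onto_open_units G (rng G) U"
    using rng_local_homeo a openin_subset[OF V] by (meson subsetD)
  have "openin (subtopology (gtop G) U) (V \<inter> U)" using V by (rule openin_subtopology_Int)
  then have "openin (subtopology (units_top G) (rng G ` U)) (rng G ` (V \<inter> U))"
    using U(3) homeomorphic_map_openness_eq homeomorphic_imp_open_map
    unfolding homeo_onto_open_units_def open_map_def by blast
  then have "openin (units_top G) (rng G ` (V \<inter> U))"
    using U(3) openin_trans_full unfolding homeo_onto_open_units_def by blast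
  then have "openin (gtop G) (rng G ` (V \<inter> U))"
    using openin_trans_full openin_units by blast
  then show "\<exists>T. openin (gtop G) T \<and> x \<in> T \<and> T \<subseteq> rng G ` V"
    using a U(2) by blast
qed

lemma openin_src_image:
  assumes V: "openin (gtop G) V"
  shows "openin (gtop G) (src G ` V)"
proof -
  have "src G ` V = rng G ` ginv G ` V"
    unfolding image_image using openin_subset[OF V] by (intro image_cong) auto
  then show ?thesis using openin_rng_image[OF openin_ginv_image[OF V]] by simp
qed

text \<open>The units are the fixed points of the range map. Hausdorffness of the unit space alone would not
  suffice here.\<close>

lemma closedin_units:
  assumes "Hausdorff_space (gtop G)"
  shows "closedin (gtop G) (units G)"
proof -
  have "units G = {a \<in> elems G. rng G a = id a}"
    by (rule set_eqI) (simp only: mem_Collect_eq id_apply units_iff_rng)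
  then show ?thesis
    using closedin_continuous_maps_eq[OF assms continuous_rng continuous_map_id]
    by (simp only:)
qed

text \<open>A compact set is covered by finitely many open sets on which range is injective, and each of them
  meets a range fibre at most once. This is why convolution sums are finite.\<close>

lemma finite_rng_fibre_compactin:
  assumes K: "compactin (gtop G) K"
  shows "finite {a \<in> K. rng G a = x}"
proof -
  have "\<exists>U. openin (gtop G) U \<and> a \<in> U \<and> inj_on (rng G) U"
    if a: "a \<in> K" for a
  proof -
    obtain U where U: "openin (gtop G) U" "a \<in> U" "homeo_onto_open_units G (rng G) U"
      using rng_local_homeo[of a] a compactin_subset_topspace[OF K] by auto
    then have "inj_on (rng G) U"
      using openin_subset[OF U(1)] homeomorphic_imp_injective_map
      unfolding homeo_onto_open_units_def by (fastforce simp: Int_absorb1)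
    with U show ?thesis by blast
  qed
  then have "K \<subseteq> \<Union>{U. openin (gtop G) U \<and> inj_on (rng G) U}" by blast
  then obtain F where F: "finite F" "F \<subseteq> {U. openin (gtop G) U \<and> inj_on (rng G) U}" "K \<subseteq> \<Union>F"
    using compactinD[OF K, of "{U. openin (gtop G) U \<and> inj_on (rng G) U}"] by auto
  have "finite {a \<in> U. rng G a = x}" if "U \<in> F" for U
  proof (rule finite_imageD)
    show "inj_on (rng G) {a \<in> U. rng G a = x}" using F(2) that by (auto intro: inj_on_subset)
    show "finite (rng G ` {a \<in> U. rng G a = x})"
      by (rule finite_subset[of _ "{x}"]) auto
  qed
  then have "finite (\<Union>U\<in>F. {a \<in> U. rng G a = x})" using F(1) by blast
  then show ?thesis by (rule rev_finite_subset) (use F(3) in auto)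
qed

end

lemma (in ample_groupoid) compact_open_bisection_nbhd:
  assumes "openin (gtop G) U" "a \<in> U"
  obtains D where "openin (gtop G) D" "compactin (gtop G) D" "bisection G D" "a \<in> D" "D \<subseteq> U"
proof -
  have "(arbitrary union_of (\<lambda>D. openin (gtop G) D \<and> compactin (gtop G) D \<and> bisection G D)) U"
    using assms(1) compact_open_bisection_base by (metis (no_types, lifting))
  then show ?thesis using assms(2) that unfolding union_of_def by blast
qed

lemma bisection_inj_on:
  assumes "bisection G D"
  shows "inj_on (rng G) D" "inj_on (src G) D"
proof -
  obtain U where U: "openin (gtop G) U" "D \<subseteq> U"
    "homeo_onto_open_units G (rng G) U" "homeo_onto_open_units G (src G) U"
    using assms unfolding bisection_def by blast
  have "inj_on h U" if "homeo_onto_open_units G h U" for h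
    using that openin_subset[OF U(1)] homeomorphic_imp_injective_map
    unfolding homeo_onto_open_units_def by (fastforce simp: Int_absorb1)
  with U show "inj_on (rng G) D" "inj_on (src G) D" by (meson inj_on_subset)+
qed

section \<open>Locally constant functions\<close>

lemma locally_constant_compose:
  assumes "locally_constant T f" "continuous_map S T h"
  shows "locally_constant S (\<lambda>x. f (h x))"
  unfolding locally_constant_def
proof
  fix x assume x: "x \<in> topspace S"
  then have "h x \<in> topspace T" using assms(2) continuous_map_funspace by blast
  then obtain U where U: "openin T U" "h x \<in> U" "\<forall>y\<in>U. f y = f (h x)"
    using assms(1) unfolding locally_constant_def by blast
  show "\<exists>U. openin S U \<and> x \<in> U \<and> (\<forall>y\<in>U. f (h y) = f (h x))"
    using x U openin_continuous_map_preimage[OF assms(2) U(1)]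
    by (intro exI[of _ "{x \<in> topspace S. h x \<in> U}"]) blast
qed

lemma locally_constant_combine:
  assumes "locally_constant T f" "locally_constant T g"
  shows "locally_constant T (\<lambda>x. h (f x) (g x))"
  unfolding locally_constant_def
proof
  fix x assume x: "x \<in> topspace T"
  obtain U V where U: "openin T U" "x \<in> U" "\<forall>y\<in>U. f y = f x"
    and V: "openin T V" "x \<in> V" "\<forall>y\<in>V. g y = g x"
    using assms x unfolding locally_constant_def by meson
  have "\<forall>y\<in>U \<inter> V. h (f y) (g y) = h (f x) (g x)" using U(3) V(3) by (metis IntD1 IntD2)
  with U(1,2) V(1,2) show "\<exists>U. openin T U \<and> x \<in> U \<and> (\<forall>y\<in>U. h (f y) (g y) = h (f x) (g x))"
    by (intro exI[of _ "U \<inter> V"]) blast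
qed

lemma locally_constant_const [simp]: "locally_constant T (\<lambda>x. c)"
  unfolding locally_constant_def by blast

lemma locally_constant_mem_clopen:
  assumes "openin T W" "closedin T W"
  shows "locally_constant T (\<lambda>x. x \<in> W)"
  unfolding locally_constant_def
proof
  fix x assume "x \<in> topspace T"
  moreover have "openin T (topspace T - W)" using assms(2) by blast
  ultimately show "\<exists>U. openin T U \<and> x \<in> U \<and> (\<forall>y\<in>U. (y \<in> W) = (x \<in> W))"
    using assms(1) by (cases "x \<in> W") (auto intro: exI[of _ W] exI[of _ "topspace T - W"])
qed

lemma openin_locally_constant_preimage:
  assumes "locally_constant T f"
  shows "openin T {x \<in> topspace T. f x \<in> Y}"
proof (subst openin_subopen, intro ballI)
  fix x assume "x \<in> {x \<in> topspace T. f x \<in> Y}"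
  then obtain U where U: "openin T U" "x \<in> U" "\<And>y. y \<in> U \<Longrightarrow> f y = f x" and "f x \<in> Y"
    using assms unfolding locally_constant_def by (metis (no_types, lifting) mem_Collect_eq)
  have "U \<subseteq> {x \<in> topspace T. f x \<in> Y}"
  proof
    fix y assume "y \<in> U"
    then show "y \<in> {x \<in> topspace T. f x \<in> Y}"
      using U(3)[of y] \<open>f x \<in> Y\<close> openin_subset[OF U(1)] by auto
  qed
  with U(1,2) show "\<exists>U. openin T U \<and> x \<in> U \<and> U \<subseteq> {x \<in> topspace T. f x \<in> Y}" by blast
qed

lemma locally_constant_eq:
  assumes f: "locally_constant T f" and eq: "\<And>x. x \<in> topspace T \<Longrightarrow> g x = f x"
  shows "locally_constant T g"
  unfolding locally_constant_def
proof
  fix x assume x: "x \<in> topspace T"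
  have "\<exists>U. openin T U \<and> x \<in> U \<and> (\<forall>y\<in>U. f y = f x)"
    using f x unfolding locally_constant_def by (rule bspec)
  then obtain U where U: "openin T U" "x \<in> U" "\<forall>y\<in>U. f y = f x" by blast
  have "\<forall>y\<in>U. g y = g x"
  proof
    fix y assume y: "y \<in> U"
    then have "g y = f y" using eq openin_subset[OF U(1)] by blast
    also have "\<dots> = f x" using y by (rule bspec[OF U(3)])
    also have "\<dots> = g x" using eq[OF x] by simp
    finally show "g y = g x" .
  qed
  with U(1,2) show "\<exists>U. openin T U \<and> x \<in> U \<and> (\<forall>y\<in>U. g y = g x)" by blast
qed

section \<open>Spans and normalisers in abstract algebras\<close>

lemma lin_span_mono: "X \<subseteq> Y \<Longrightarrow> f \<in> lin_span A X \<Longrightarrow> f \<in> lin_span A Y"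
  by (rotate_tac, induction rule: lin_span.induct) (auto intro: lin_span.intros)

text \<open>A local unit \<open>e\<close> for \<open>n\<close> gives \<open>k n = k e n\<close>, which lies in \<open>B\<close>; likewise for \<open>n k\<close>, \<open>l n\<close> and \<open>n l\<close>.
  As these elements commute, \<open>k\<close> and \<open>l\<close> are both equal to \<open>k n l\<close>.\<close>

lemma normaliser_inverse_unique:
  assumes "nonunital_algebra A" and comm: "commutative_subalgebra A B"
    and lu: "local_units A (idempotents A B)" and n: "n \<in> acarrier A"
    and k: "normaliser_inverse A B n k" and l: "normaliser_inverse A B n l"
  shows "k = l"
proof -
  interpret nonunital_algebra A by fact
  obtain e where e: "e \<in> B" "amult A e n = n" "amult A n e = n"
    using lu n unfolding local_units_def idempotents_def
    by (metis (no_types, lifting) empty_subsetI finite.emptyI finite.insertI insert_subset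
        insertI1 mem_Collect_eq)
  have BA: "B \<subseteq> acarrier A" using comm by (simp add: commutative_subalgebra_def subalgebra_def)
  have prods: "amult A m n \<in> B \<and> amult A n m \<in> B" if m: "normaliser_inverse A B n m" for m
  proof -
    have mA: "m \<in> acarrier A" and "amult A (amult A m e) n \<in> B" "amult A (amult A n e) m \<in> B"
      using m e by (auto simp: normaliser_inverse_def)
    then show ?thesis using mult_assoc[of m e n] e BA n by auto
  qed
  have kA: "k \<in> acarrier A" "amult A (amult A k n) k = k" "amult A (amult A n k) n = n"
    and lA: "l \<in> acarrier A" "amult A (amult A l n) l = l" "amult A (amult A n l) n = n"
    using k l by (auto simp: normaliser_inverse_def)
  have cl: "amult A k n \<in> acarrier A" "amult A n k \<in> acarrier A"
    "amult A l n \<in> acarrier A" "amult A n l \<in> acarrier A"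
    using kA lA n mult_closed by auto
  have c: "amult A x y = amult A y x" if "x \<in> B" "y \<in> B" for x y
    using comm that by (simp add: commutative_subalgebra_def)
  \<comment> \<open>\<open>k = k (n k) = k (n l) (n k) = k (n k) (n l) = k (n l)\<close>\<close>
  have "k = amult A k (amult A n k)" using kA n mult_assoc by simp
  also have "\<dots> = amult A k (amult A (amult A (amult A n l) n) k)" using lA by simp
  also have "amult A (amult A (amult A n l) n) k = amult A (amult A n l) (amult A n k)"
    using cl kA n mult_assoc by simp
  also have "\<dots> = amult A (amult A n k) (amult A n l)"
    using c prods[OF k] prods[OF l] by blast
  also have "amult A k (amult A (amult A n k) (amult A n l)) = amult A (amult A k (amult A n k)) (amult A n l)"
    using cl kA mult_assoc by simp
  also have "\<dots> = amult A k (amult A n l)" using kA n mult_assoc by simp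
  finally have 1: "k = amult A k (amult A n l)" .
  \<comment> \<open>\<open>l = (l n) l = (l n) (k n) l = (k n) (l n) l = (k n) l\<close>\<close>
  have "l = amult A (amult A l n) l" using lA by simp
  also have "\<dots> = amult A (amult A l (amult A (amult A n k) n)) l" using kA by simp
  also have "amult A l (amult A (amult A n k) n) = amult A (amult A l n) (amult A k n)"
    using cl kA lA n mult_assoc by simp
  also have "\<dots> = amult A (amult A k n) (amult A l n)"
    using c prods[OF k] prods[OF l] by blast
  also have "amult A (amult A (amult A k n) (amult A l n)) l = amult A (amult A k n) (amult A (amult A l n) l)"
    using cl lA mult_assoc by simp
  also have "\<dots> = amult A k (amult A n l)" using lA kA n mult_assoc by simp
  finally show ?thesis using 1 by simp
qed

section \<open>Twists over ample Hausdorff groupoids\<close>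

text \<open>The assumption \<open>1 \<noteq> 0\<close> ensures that every compact open bisection on which \<open>q\<close> has a continuous
  section is the support of some function.\<close>

locale ample_twist = base: ample_groupoid G + discrete_twist G Sig i q
  for G :: "'g groupoid_data" and Sig :: "'s groupoid_data"
    and i :: "'g \<times> 'r::{comm_ring,comm_monoid_mult} \<Rightarrow> 's" and q +
  assumes Hausdorff: "Hausdorff_space (gtop G)"
    and nontrivial: "(1::'r) \<noteq> 0"
begin

abbreviation "A \<equiv> steinberg_functions G Sig i q"
abbreviation "act \<equiv> twist_act Sig i q"
abbreviation conv (infixl \<open>\<star>\<close> 70) where "conv \<equiv> convolution G Sig q"
abbreviation gsupp :: "('s \<Rightarrow> 'r) \<Rightarrow> 'g set" where "gsupp f \<equiv> q ` supp Sig f"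

lemma q_simps [simp]:
  assumes "\<sigma> \<in> elems Sig"
  shows "q \<sigma> \<in> elems G" "q (rng Sig \<sigma>) = rng G (q \<sigma>)" "q (src Sig \<sigma>) = src G (q \<sigma>)"
    "q (ginv Sig \<sigma>) = ginv G (q \<sigma>)"
  using groupoid_hom_structure[OF total.groupoid_axioms base.groupoid_axioms hom_q assms]
  by blast+

lemma q_gmult [simp]:
  assumes "\<sigma> \<in> elems Sig" "\<tau> \<in> elems Sig" "src Sig \<sigma> = rng Sig \<tau>"
  shows "q (gmult Sig \<sigma> \<tau>) = gmult G (q \<sigma>) (q \<tau>)"
  using hom_q assms unfolding groupoid_hom_def by (auto simp: total.in_composable)

lemma q_units_inj:
  assumes "x \<in> units Sig" "y \<in> units Sig" "q x = q y"
  shows "x = y"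
proof -
  have "topspace (units_top Sig) = units Sig" using total.units_elems by (auto simp: topspace_subtopology)
  then have "inj_on q (units Sig)" using homeomorphic_imp_injective_map[OF homeo_q] by simp
  then show ?thesis using assms by (simp add: inj_on_def)
qed

text \<open>A unit of the twist is determined by its image in \<open>G\<close>, so composability can be tested in \<open>G\<close>.\<close>

lemma q_unit_iff:
  assumes "\<sigma> \<in> elems Sig" "\<tau> \<in> elems Sig"
  shows "rng Sig \<sigma> = rng Sig \<tau> \<longleftrightarrow> rng G (q \<sigma>) = rng G (q \<tau>)"
    "src Sig \<sigma> = src Sig \<tau> \<longleftrightarrow> src G (q \<sigma>) = src G (q \<tau>)"
    "src Sig \<sigma> = rng Sig \<tau> \<longleftrightarrow> src G (q \<sigma>) = rng G (q \<tau>)"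
  using assms q_units_inj q_simps total.rng_units total.src_units by metis+

lemma i_simps [simp]:
  assumes "x \<in> units G" "t \<in> ring_units"
  shows "i (x, t) \<in> elems Sig" "q (i (x, t)) = x" "rng Sig (i (x, t)) = i (x, 1)"
    "src Sig (i (x, t)) = i (x, 1)"
proof -
  have *: "i (x, t) \<in> elems Sig \<and> q (i (x, t)) = x" if "t \<in> ring_units" for t
    using DT1_fibre[OF assms(1)] that by (auto simp: twist_preimage_def)
  then show 1: "i (x, t) \<in> elems Sig" and 2: "q (i (x, t)) = x" using assms by auto
  have u: "i (x, 1) \<in> units Sig" using units_twist assms by blast
  have "q (i (x, 1)) = x" using *[OF one_ring_units] by simp
  then show "rng Sig (i (x, t)) = i (x, 1)" "src Sig (i (x, t)) = i (x, 1)"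
    using 1 2 assms u by (auto intro!: q_units_inj)
qed

lemma i_one_units [simp]: "x \<in> units G \<Longrightarrow> i (x, 1) \<in> units Sig"
  using units_twist by blast

lemma i_gmult:
  assumes "x \<in> units G" "t \<in> ring_units" "u \<in> ring_units"
  shows "gmult Sig (i (x, t)) (i (x, u)) = i (x, t * u)"
proof -
  have "((x, t), (x, u)) \<in> composable (trivial_bundle G)"
    using assms base.units_elems
    by (auto simp: composable_def trivial_bundle_def topspace_subtopology)
  then have "i (gmult (trivial_bundle G) (x, t) (x, u)) = gmult Sig (i (x, t)) (i (x, u))"
    using hom_i unfolding groupoid_hom_def by blast
  then show ?thesis by (simp add: trivial_bundle_def)
qed

lemma i_rng_one [simp]:
  assumes "\<sigma> \<in> elems Sig"
  shows "i (rng G (q \<sigma>), 1) = rng Sig \<sigma>" "i (src G (q \<sigma>), 1) = src Sig \<sigma>"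
  using assms by (auto intro!: q_units_inj)

lemma act_eq: "\<sigma> \<in> elems Sig \<Longrightarrow> act t \<sigma> = gmult Sig (i (rng G (q \<sigma>), t)) \<sigma>"
  by (simp add: twist_act_def)

lemma act_eq_right:
  "\<sigma> \<in> elems Sig \<Longrightarrow> t \<in> ring_units \<Longrightarrow> act t \<sigma> = gmult Sig \<sigma> (i (src G (q \<sigma>), t))"
  using DT3 by (simp add: twist_act_def)

lemma act_simps [simp]:
  assumes "\<sigma> \<in> elems Sig" "t \<in> ring_units"
  shows "act t \<sigma> \<in> elems Sig" "rng Sig (act t \<sigma>) = rng Sig \<sigma>" "src Sig (act t \<sigma>) = src Sig \<sigma>"
    "q (act t \<sigma>) = q \<sigma>"
  using assms by (simp_all add: act_eq)

lemma act_one [simp]: "\<sigma> \<in> elems Sig \<Longrightarrow> act 1 \<sigma> = \<sigma>"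
  by (simp add: act_eq)

lemma act_act:
  assumes "\<sigma> \<in> elems Sig" "t \<in> ring_units" "u \<in> ring_units"
  shows "act t (act u \<sigma>) = act (t * u) \<sigma>"
proof -
  have "act t (act u \<sigma>) = gmult Sig (i (rng G (q \<sigma>), t)) (gmult Sig (i (rng G (q \<sigma>), u)) \<sigma>)"
    using assms by (simp add: act_eq[of "act u \<sigma>"]) (simp add: act_eq)
  also have "\<dots> = gmult Sig (gmult Sig (i (rng G (q \<sigma>), t)) (i (rng G (q \<sigma>), u))) \<sigma>"
    using assms by (subst total.gmult_assoc) simp_all
  also have "\<dots> = act (t * u) \<sigma>"
    using assms by (simp add: i_gmult act_eq)
  finally show ?thesis .
qed

lemma gmult_act:
  assumes "\<sigma> \<in> elems Sig" "\<tau> \<in> elems Sig" "src Sig \<sigma> = rng Sig \<tau>" "t \<in> ring_units"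
  shows "gmult Sig (act t \<sigma>) \<tau> = act t (gmult Sig \<sigma> \<tau>)"
    "gmult Sig \<sigma> (act t \<tau>) = act t (gmult Sig \<sigma> \<tau>)"
proof -
  have eq: "src G (q \<sigma>) = rng G (q \<tau>)" using assms by (simp flip: q_unit_iff)
  show 1: "gmult Sig (act t \<sigma>) \<tau> = act t (gmult Sig \<sigma> \<tau>)"
    using assms eq by (simp add: act_eq) (subst total.gmult_assoc; simp)
  have "gmult Sig \<sigma> (act t \<tau>) = gmult Sig (gmult Sig \<sigma> (i (rng G (q \<tau>), t))) \<tau>"
    using assms by (simp add: act_eq) (subst total.gmult_assoc; simp)
  then show "gmult Sig \<sigma> (act t \<tau>) = act t (gmult Sig \<sigma> \<tau>)"
    using assms eq by (simp flip: 1 add: act_eq_right)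
qed

lemma inv_act:
  assumes "\<sigma> \<in> elems Sig" "t \<in> ring_units"
  shows "ginv Sig (act t \<sigma>) = act (unit_inv t) (ginv Sig \<sigma>)"
  by (rule total.inv_unique) (use assms in \<open>simp_all add: gmult_act act_act\<close>)

text \<open>The quotient \<open>\<sigma> \<tau>\<inverse>\<close> lies over a unit, so it is in the image of \<open>i\<close> by (DT1).\<close>

lemma fibre_transitive:
  assumes "\<sigma> \<in> elems Sig" "\<tau> \<in> elems Sig" "q \<sigma> = q \<tau>"
  obtains t where "t \<in> ring_units" "\<sigma> = act t \<tau>"
proof -
  have s: "src Sig \<sigma> = src Sig \<tau>" using assms by (simp add: q_unit_iff)
  define \<rho> where "\<rho> = gmult Sig \<sigma> (ginv Sig \<tau>)"
  have "\<rho> \<in> twist_preimage Sig q {rng G (q \<tau>)}"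
    using assms s by (simp add: twist_preimage_def \<rho>_def)
  then obtain t where t: "t \<in> ring_units" "\<rho> = i (rng G (q \<tau>), t)"
    using DT1_fibre[of "rng G (q \<tau>)"] assms by auto
  have "\<sigma> = gmult Sig \<rho> \<tau>" using assms s by (simp add: \<rho>_def)
  with t that show ?thesis using assms by (simp add: act_eq)
qed

lemma openin_q_preimage:
  "openin (gtop G) W \<Longrightarrow> openin (gtop Sig) {\<sigma> \<in> elems Sig. q \<sigma> \<in> W}"
  using openin_continuous_map_preimage[OF continuous_q] .

text \<open>Where \<open>q\<close> has a local section, (DT2) makes the twist a product with the discrete group
  \<open>R\<^sup>\<times>\<close>, and \<open>q\<close> becomes the first projection.\<close>

lemma openin_q_image:
  assumes V: "openin (gtop Sig) V"
  shows "openin (gtop G) (q ` V)"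
proof (subst openin_subopen, intro ballI)
  fix a assume "a \<in> q ` V"
  then obtain \<sigma> where \<sigma>: "\<sigma> \<in> V" "a = q \<sigma>" by blast
  have \<sigma>e: "\<sigma> \<in> elems Sig" using \<sigma> openin_subset[OF V] by blast
  then obtain D P where D: "openin (gtop G) D" "a \<in> D" "continuous_map (subtopology (gtop G) D) (gtop Sig) P"
    "\<forall>b\<in>D. q (P b) = b"
    and h: "homeomorphic_map
        (prod_topology (subtopology (gtop G) D) (discrete_topology ring_units))
        (subtopology (gtop Sig) (twist_preimage Sig q D))
        (\<lambda>(b, t). gmult Sig (i (rng G b, t)) (P b))" (is "homeomorphic_map ?X ?Y ?h")
    using DT2[of a] \<sigma>(2) by auto
  have De: "D \<subseteq> elems G" using openin_subset[OF D(1)] .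
  have qh: "q (?h p) = fst p" if "p \<in> topspace ?X" for p
  proof -
    obtain b t where p: "p = (b, t)" by (cases p)
    have b: "b \<in> D" "t \<in> ring_units" using that p by auto
    have e: "P b \<in> elems Sig"
      using D(3) b De continuous_map_funspace[OF D(3)] by (auto simp: topspace_subtopology)
    have "q (act t (P b)) = b" using e b D(4) by simp
    then show ?thesis using e b p D(4) by (simp add: act_eq)
  qed
  \<comment> \<open>In the coordinates given by the section, \<open>q\<close> maps \<open>?W\<close> to its first projection.\<close>
  let ?W = "{p \<in> topspace ?X. ?h p \<in> V}"
  have "continuous_map ?X (gtop Sig) ?h"
    using homeomorphic_imp_continuous_map[OF h] by (simp add: continuous_map_in_subtopology)
  from openin_continuous_map_preimage[OF this V] have "openin ?X ?W" .
  then have "openin (subtopology (gtop G) D) (fst ` ?W)"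
    using open_map_fst unfolding open_map_def by blast
  then have "openin (gtop G) (fst ` ?W)" using openin_trans_full D(1) by blast
  moreover have "fst ` ?W \<subseteq> q ` V"
    using qh by (auto simp: image_iff) (metis (no_types, lifting) fst_conv split_conv)
  moreover have "a \<in> fst ` ?W"
  proof -
    have "\<sigma> \<in> topspace ?Y" using \<sigma> \<sigma>e D(2) by (simp add: twist_preimage_def)
    then obtain p where p: "p \<in> topspace ?X" "?h p = \<sigma>"
      using homeomorphic_imp_surjective_map[OF h] by (metis (no_types, lifting) imageE)
    then show ?thesis using qh[OF p(1)] \<sigma> by (intro image_eqI[of _ _ p]) auto
  qed
  ultimately show "\<exists>T. openin (gtop G) T \<and> a \<in> T \<and> T \<subseteq> q ` V" by blast
qed

section \<open>Equivariant functions on the twist\<close>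

text \<open>The algebraic half of membership in \<open>A\<close>, and what is asked of the second factor of a convolution.\<close>

definition equivariant :: "('s \<Rightarrow> 'r) \<Rightarrow> bool" where
  "equivariant f \<longleftrightarrow> (\<forall>\<sigma>. \<sigma> \<notin> elems Sig \<longrightarrow> f \<sigma> = 0) \<and>
     (\<forall>t\<in>ring_units. \<forall>\<sigma>\<in>elems Sig. f (act t \<sigma>) = unit_inv t * f \<sigma>)"

lemma A_iff:
  "f \<in> A \<longleftrightarrow> equivariant f \<and> locally_constant (gtop Sig) f \<and> compactin (gtop G) (gsupp f)"
  unfolding steinberg_functions_def equivariant_def by blast

lemma A_equivariant: "f \<in> A \<Longrightarrow> equivariant f" by (simp add: A_iff)

lemma equivariant_outside: "equivariant f \<Longrightarrow> \<sigma> \<notin> elems Sig \<Longrightarrow> f \<sigma> = 0"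
  by (simp add: equivariant_def)

lemma equivariant_act:
  "equivariant f \<Longrightarrow> t \<in> ring_units \<Longrightarrow> \<sigma> \<in> elems Sig \<Longrightarrow> f (act t \<sigma>) = unit_inv t * f \<sigma>"
  by (simp add: equivariant_def)

text \<open>By equivariance and transitivity on fibres, a function vanishes either everywhere or nowhere on a
  fibre of \<open>q\<close>.\<close>

lemma gsupp_iff:
  assumes "equivariant f" "\<sigma> \<in> elems Sig"
  shows "q \<sigma> \<in> gsupp f \<longleftrightarrow> f \<sigma> \<noteq> 0"
proof
  assume "q \<sigma> \<in> gsupp f"
  then obtain \<tau> where \<tau>: "\<tau> \<in> elems Sig" "f \<tau> \<noteq> 0" "q \<sigma> = q \<tau>" by (auto simp: supp_def)
  then obtain t where "t \<in> ring_units" "\<sigma> = act t \<tau>" using fibre_transitive assms(2) by metis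
  then show "f \<sigma> \<noteq> 0" using \<tau> assms by (simp add: equivariant_act)
qed (use assms in \<open>auto simp: supp_def\<close>)

lemma gsuppE:
  assumes "a \<in> gsupp f"
  obtains \<sigma> where "\<sigma> \<in> elems Sig" "q \<sigma> = a" "f \<sigma> \<noteq> 0"
  using assms by (auto simp: supp_def)

lemma gsupp_elems: "gsupp f \<subseteq> elems G"
  by (auto simp: supp_def)

lemma openin_gsupp:
  assumes "locally_constant (gtop Sig) f"
  shows "openin (gtop G) (gsupp f)"
proof -
  have "supp Sig f = {\<sigma> \<in> elems Sig. f \<sigma> \<in> - {0}}" by (auto simp: supp_def)
  then show ?thesis
    using openin_q_image[OF openin_locally_constant_preimage[OF assms, of "- {0}"]] by simp
qed

text \<open>The complement of the support in \<open>G\<close> is the image of the zero set, which is open as well.\<close>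

lemma closedin_gsupp:
  assumes "locally_constant (gtop Sig) f" "equivariant f"
  shows "closedin (gtop G) (gsupp f)"
proof -
  have "elems G - gsupp f = q ` {\<sigma> \<in> elems Sig. f \<sigma> \<in> {0}}"
  proof (intro equalityI subsetI)
    fix a assume a: "a \<in> elems G - gsupp f"
    then obtain \<sigma> where "\<sigma> \<in> elems Sig" "a = q \<sigma>" using DT1_surj by auto
    then show "a \<in> q ` {\<sigma> \<in> elems Sig. f \<sigma> \<in> {0}}" using a gsupp_iff[OF assms(2)] by blast
  qed (use gsupp_iff[OF assms(2)] in auto)
  then have "openin (gtop G) (elems G - gsupp f)"
    using openin_q_image[OF openin_locally_constant_preimage[OF assms(1), of "{0}"]] by simp
  then show ?thesis using gsupp_elems by (simp add: closedin_def)
qed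

text \<open>Supports of sums and products are controlled only up to inclusion. As supports are closed, an
  inclusion in a compact set is enough.\<close>

lemma A_I:
  assumes "equivariant f" "locally_constant (gtop Sig) f" "gsupp f \<subseteq> K" "compactin (gtop G) K"
  shows "f \<in> A"
  using assms closed_compactin[OF assms(4) assms(3) closedin_gsupp] by (simp add: A_iff)

lemma A_zero [simp]: "(\<lambda>_. 0) \<in> A"
  by (rule A_I[of _ "{}"]) (auto simp: equivariant_def supp_def)

lemma A_combine:
  assumes "f \<in> A" "g \<in> A" and "equivariant (\<lambda>\<sigma>. h (f \<sigma>) (g \<sigma>))" "h 0 0 = 0"
  shows "(\<lambda>\<sigma>. h (f \<sigma>) (g \<sigma>)) \<in> A"
proof (rule A_I)
  show "locally_constant (gtop Sig) (\<lambda>\<sigma>. h (f \<sigma>) (g \<sigma>))"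
    using assms(1,2) by (simp add: A_iff locally_constant_combine[where f = f and g = g and h = h])
  show "gsupp (\<lambda>\<sigma>. h (f \<sigma>) (g \<sigma>)) \<subseteq> gsupp f \<union> gsupp g"
    unfolding image_Un[symmetric] using assms(4) by (intro image_mono) (auto simp: supp_def)
  show "compactin (gtop G) (gsupp f \<union> gsupp g)"
    using assms(1,2) by (intro compactin_Un) (auto simp: A_iff)
qed fact

lemma A_add: "f \<in> A \<Longrightarrow> g \<in> A \<Longrightarrow> (\<lambda>\<sigma>. f \<sigma> + g \<sigma>) \<in> A"
  by (rule A_combine) (auto simp: A_iff equivariant_def distrib_left)

lemma A_smult: "f \<in> A \<Longrightarrow> (\<lambda>\<sigma>. c * f \<sigma>) \<in> A"
  by (rule A_combine[of f f "\<lambda>x _. c * x"]) (auto simp: A_iff equivariant_def mult.left_commute)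

definition restr :: "'g set \<Rightarrow> ('s \<Rightarrow> 'r) \<Rightarrow> 's \<Rightarrow> 'r" where
  "restr W f = (\<lambda>\<sigma>. if q \<sigma> \<in> W then f \<sigma> else 0)"

lemma equivariant_restr: "equivariant f \<Longrightarrow> equivariant (restr W f)"
  by (simp add: equivariant_def restr_def)

lemma gsupp_restr: "gsupp (restr W f) = gsupp f \<inter> W"
  by (auto simp: supp_def restr_def)

lemma A_restr:
  assumes "f \<in> A" "openin (gtop G) W" "closedin (gtop G) W"
  shows "restr W f \<in> A"
proof (rule A_I)
  have "locally_constant (gtop Sig) (\<lambda>\<sigma>. q \<sigma> \<in> W)"
    using locally_constant_compose[OF locally_constant_mem_clopen continuous_q] assms by blast
  then show "locally_constant (gtop Sig) (restr W f)"
    using locally_constant_combine[of _ "\<lambda>\<sigma>. q \<sigma> \<in> W" f "\<lambda>p a. if p then a else 0"] assms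
    by (simp add: A_iff restr_def)
  show "gsupp (restr W f) \<subseteq> gsupp f" by (auto simp: gsupp_restr)
qed (use assms in \<open>auto simp: A_iff intro: equivariant_restr\<close>)

lemma closedin_compact: "compactin (gtop G) K \<Longrightarrow> closedin (gtop G) K"
  using compactin_imp_closedin[OF Hausdorff] .

section \<open>Convolution\<close>

definition lift :: "'g \<Rightarrow> 's" where "lift = inv_into (elems Sig) q"

lemma lift_simps [simp]:
  assumes "a \<in> elems G"
  shows "lift a \<in> elems Sig" "q (lift a) = a"
  using assms DT1_surj unfolding lift_def by (auto intro: inv_into_into f_inv_into_f)

definition conv_term :: "('s \<Rightarrow> 'r) \<Rightarrow> ('s \<Rightarrow> 'r) \<Rightarrow> 's \<Rightarrow> 's \<Rightarrow> 'r" where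
  "conv_term f g \<sigma> \<tau> = f \<tau> * g (gmult Sig (ginv Sig \<tau>) \<sigma>)"

definition fibre :: "'g \<Rightarrow> 'g set" where
  "fibre x = {a \<in> elems G. rng G a = x}"

text \<open>Replacing \<open>\<tau>\<close> by \<open>t \<cdot> \<tau>\<close> multiplies the first factor by \<open>t\<inverse>\<close> and the second by \<open>t\<close>.\<close>

lemma conv_term_cong:
  assumes "equivariant f" "equivariant g" and \<sigma>: "\<sigma> \<in> elems Sig"
    and \<tau>: "\<tau> \<in> elems Sig" "\<tau>' \<in> elems Sig" "q \<tau> = q \<tau>'" "rng Sig \<tau> = rng Sig \<sigma>"
  shows "conv_term f g \<sigma> \<tau>' = conv_term f g \<sigma> \<tau>"
proof -
  obtain t where t: "t \<in> ring_units" "\<tau>' = act t \<tau>"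
    using fibre_transitive[of \<tau>' \<tau>] \<tau> by metis
  have "conv_term f g \<sigma> \<tau>' = (unit_inv t * f \<tau>) * (t * g (gmult Sig (ginv Sig \<tau>) \<sigma>))"
    using assms t by (simp add: conv_term_def equivariant_act inv_act gmult_act)
  also have "\<dots> = (unit_inv t * t) * (f \<tau> * g (gmult Sig (ginv Sig \<tau>) \<sigma>))"
    by (simp only: ac_simps)
  finally show ?thesis using t by (simp add: conv_term_def)
qed

lemma finite_fibre_gsupp: "f \<in> A \<Longrightarrow> finite (fibre x \<inter> gsupp f)"
  using base.finite_rng_fibre_compactin[of "gsupp f" x] unfolding A_iff fibre_def
  by (auto elim: rev_finite_subset)

text \<open>Two changes to the definition: the section of \<open>q\<close> over the support of \<open>f\<close> is replaced by a fixed
  section \<open>lift\<close> of all of \<open>q\<close>, and the index set may be enlarged, so that sums for different first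
  factors can be taken over a common set.\<close>

lemma conv_eq_sum:
  assumes f: "f \<in> A" and g: "equivariant g" and \<sigma>: "\<sigma> \<in> elems Sig"
    and F: "finite F" "F \<subseteq> fibre (rng G (q \<sigma>))" "fibre (rng G (q \<sigma>)) \<inter> gsupp f \<subseteq> F"
  shows "(f \<star> g) \<sigma> = (\<Sum>a\<in>F. conv_term f g \<sigma> (lift a))"
proof -
  let ?S = "inv_into (supp Sig f) q"
  have "(f \<star> g) \<sigma> = (\<Sum>a \<in> fibre (rng G (q \<sigma>)) \<inter> gsupp f. conv_term f g \<sigma> (?S a))"
    using \<sigma> by (simp add: convolution_def fibre_def conv_term_def Let_def)
  also have "\<dots> = (\<Sum>a \<in> fibre (rng G (q \<sigma>)) \<inter> gsupp f. conv_term f g \<sigma> (lift a))"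
  proof (rule sum.cong[OF refl])
    fix a assume a: "a \<in> fibre (rng G (q \<sigma>)) \<inter> gsupp f"
    then have "?S a \<in> supp Sig f" "q (?S a) = a" by (auto intro: inv_into_into f_inv_into_f)
    moreover have "a \<in> elems G" "rng G a = rng G (q \<sigma>)" using a by (auto simp: fibre_def)
    ultimately show "conv_term f g \<sigma> (?S a) = conv_term f g \<sigma> (lift a)"
      using f g \<sigma> by (intro conv_term_cong) (auto simp: A_equivariant supp_def q_unit_iff)
  qed
  also have "\<dots> = (\<Sum>a\<in>F. conv_term f g \<sigma> (lift a))"
  proof (rule sum.mono_neutral_left)
    show "\<forall>a\<in>F - fibre (rng G (q \<sigma>)) \<inter> gsupp f. conv_term f g \<sigma> (lift a) = 0"
    proof
      fix a assume "a \<in> F - fibre (rng G (q \<sigma>)) \<inter> gsupp f"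
      then have "a \<in> elems G" "a \<notin> gsupp f" using F by (auto simp: fibre_def)
      then have "f (lift a) = 0" using gsupp_iff[OF A_equivariant[OF f], of "lift a"] by simp
      then show "conv_term f g \<sigma> (lift a) = 0" by (simp add: conv_term_def)
    qed
  qed (use F in auto)
  finally show ?thesis .
qed

lemma conv_outside [simp]: "\<sigma> \<notin> elems Sig \<Longrightarrow> (f \<star> g) \<sigma> = 0"
  by (simp add: convolution_def)

lemma conv_eq_sum_supp:
  assumes "f \<in> A" "equivariant g" "\<sigma> \<in> elems Sig"
  shows "(f \<star> g) \<sigma> = (\<Sum>a\<in>fibre (rng G (q \<sigma>)) \<inter> gsupp f. conv_term f g \<sigma> (lift a))"
  using assms by (intro conv_eq_sum finite_fibre_gsupp) auto

text \<open>With an index set that depends on the terms only, two convolutions can be compared by matching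
  their nonzero terms.\<close>

lemma conv_eq_sum_nonzero:
  assumes "f \<in> A" "equivariant g" "\<sigma> \<in> elems Sig"
  shows "(f \<star> g) \<sigma> =
    (\<Sum>a\<in>{a \<in> fibre (rng G (q \<sigma>)). conv_term f g \<sigma> (lift a) \<noteq> 0}. conv_term f g \<sigma> (lift a))"
  unfolding conv_eq_sum_supp[OF assms]
proof (rule sum.mono_neutral_right)
  show "{a \<in> fibre (rng G (q \<sigma>)). conv_term f g \<sigma> (lift a) \<noteq> 0} \<subseteq> fibre (rng G (q \<sigma>)) \<inter> gsupp f"
  proof
    fix a assume "a \<in> {a \<in> fibre (rng G (q \<sigma>)). conv_term f g \<sigma> (lift a) \<noteq> 0}"
    then have a: "a \<in> fibre (rng G (q \<sigma>))" "f (lift a) \<noteq> 0" by (auto simp: conv_term_def)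
    then show "a \<in> fibre (rng G (q \<sigma>)) \<inter> gsupp f"
      using gsupp_iff[OF A_equivariant[OF assms(1)], of "lift a"] by (simp add: fibre_def)
  qed
qed (use finite_fibre_gsupp[OF assms(1)] in auto)

lemma conv_nonzeroE:
  assumes "f \<in> A" "equivariant g" "\<sigma> \<in> elems Sig" "(f \<star> g) \<sigma> \<noteq> 0"
  obtains \<tau> where "\<tau> \<in> elems Sig" "rng Sig \<tau> = rng Sig \<sigma>" "f \<tau> \<noteq> 0"
    "g (gmult Sig (ginv Sig \<tau>) \<sigma>) \<noteq> 0"
proof -
  obtain a where "a \<in> fibre (rng G (q \<sigma>))" "conv_term f g \<sigma> (lift a) \<noteq> 0"
    using assms(4) unfolding conv_eq_sum_nonzero[OF assms(1-3)]
    by (metis (mono_tags, lifting) mem_Collect_eq sum.neutral)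
  moreover from this have "f (lift a) \<noteq> 0" "g (gmult Sig (ginv Sig (lift a)) \<sigma>) \<noteq> 0"
    by (auto simp: conv_term_def)
  ultimately show ?thesis using that[of "lift a"] assms(3) by (simp add: fibre_def q_unit_iff)
qed

lemma conv_single:
  assumes f: "f \<in> A" and g: "equivariant g" and \<sigma>: "\<sigma> \<in> elems Sig"
    and \<tau>: "\<tau> \<in> elems Sig" "rng Sig \<tau> = rng Sig \<sigma>"
    and unique: "\<And>\<tau>'. \<tau>' \<in> elems Sig \<Longrightarrow> rng Sig \<tau>' = rng Sig \<sigma> \<Longrightarrow> f \<tau>' \<noteq> 0 \<Longrightarrow>
       g (gmult Sig (ginv Sig \<tau>') \<sigma>) \<noteq> 0 \<Longrightarrow> q \<tau>' = q \<tau>"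
  shows "(f \<star> g) \<sigma> = f \<tau> * g (gmult Sig (ginv Sig \<tau>) \<sigma>)"
proof -
  have "(\<Sum>a\<in>{a \<in> fibre (rng G (q \<sigma>)). conv_term f g \<sigma> (lift a) \<noteq> 0}. conv_term f g \<sigma> (lift a)) =
    (\<Sum>a\<in>{q \<tau>}. conv_term f g \<sigma> (lift a))"
  proof (rule sum.mono_neutral_left)
    show "{a \<in> fibre (rng G (q \<sigma>)). conv_term f g \<sigma> (lift a) \<noteq> 0} \<subseteq> {q \<tau>}"
    proof
      fix a assume "a \<in> {a \<in> fibre (rng G (q \<sigma>)). conv_term f g \<sigma> (lift a) \<noteq> 0}"
      then have "a \<in> elems G" "rng G a = rng G (q \<sigma>)" "conv_term f g \<sigma> (lift a) \<noteq> 0"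
        by (auto simp: fibre_def)
      then have "q (lift a) = q \<tau>"
        using \<sigma> by (intro unique) (auto simp: conv_term_def q_unit_iff)
      then show "a \<in> {q \<tau>}" using \<open>a \<in> elems G\<close> by simp
    qed
    show "\<forall>a\<in>{q \<tau>} - {a \<in> fibre (rng G (q \<sigma>)). conv_term f g \<sigma> (lift a) \<noteq> 0}.
        conv_term f g \<sigma> (lift a) = 0"
      using \<tau> \<sigma> by (auto simp: fibre_def q_unit_iff)
  qed simp
  also have "\<dots> = conv_term f g \<sigma> \<tau>"
    using conv_term_cong[OF A_equivariant[OF f] g \<sigma> \<tau>(1), of "lift (q \<tau>)"] \<tau> by simp
  finally show ?thesis using conv_eq_sum_nonzero[OF f g \<sigma>] by (simp add: conv_term_def)
qed

lemma equivariant_conv: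
  assumes f: "f \<in> A" and g: "equivariant g"
  shows "equivariant (f \<star> g)"
  unfolding equivariant_def
proof (intro conjI ballI allI impI)
  fix t :: 'r and \<sigma> assume t: "t \<in> ring_units" and \<sigma>: "\<sigma> \<in> elems Sig"
  have "conv_term f g (act t \<sigma>) (lift a) = unit_inv t * conv_term f g \<sigma> (lift a)"
    if "a \<in> fibre (rng G (q \<sigma>)) \<inter> gsupp f" for a
  proof -
    have "a \<in> elems G" "rng G a = rng G (q \<sigma>)" using that by (auto simp: fibre_def)
    then show ?thesis using t \<sigma> g
      by (simp add: conv_term_def gmult_act q_unit_iff equivariant_act mult.left_commute)
  qed
  then show "(f \<star> g) (act t \<sigma>) = unit_inv t * (f \<star> g) \<sigma>"
    using t \<sigma> by (simp add: conv_eq_sum_supp[OF f g] sum_distrib_left)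
qed simp

text \<open>If \<open>(f \<star> g) \<sigma>\<close> is nonzero, then \<open>\<sigma> = \<tau> (\<tau>\<inverse> \<sigma>)\<close> for some \<open>\<tau>\<close> with \<open>f \<tau>\<close> and \<open>g (\<tau>\<inverse> \<sigma>)\<close> nonzero.\<close>

lemma gsupp_conv:
  assumes f: "f \<in> A" and g: "equivariant g"
  shows "gsupp (f \<star> g) \<subseteq> (\<lambda>(a, b). gmult G a b) ` ((gsupp f \<times> gsupp g) \<inter> composable G)"
proof
  fix a assume "a \<in> gsupp (f \<star> g)"
  then obtain \<sigma> where \<sigma>: "\<sigma> \<in> elems Sig" "q \<sigma> = a" "(f \<star> g) \<sigma> \<noteq> 0" by (rule gsuppE)
  then obtain \<tau> where \<tau>: "\<tau> \<in> elems Sig" "rng Sig \<tau> = rng Sig \<sigma>" "f \<tau> \<noteq> 0"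
    "g (gmult Sig (ginv Sig \<tau>) \<sigma>) \<noteq> 0" using conv_nonzeroE[OF f g] by metis
  let ?\<rho> = "gmult Sig (ginv Sig \<tau>) \<sigma>"
  have \<rho>: "?\<rho> \<in> elems Sig" "src Sig \<tau> = rng Sig ?\<rho>" "gmult Sig \<tau> ?\<rho> = \<sigma>" using \<tau> \<sigma> by simp_all
  then have "gmult G (q \<tau>) (q ?\<rho>) = a" "src G (q \<tau>) = rng G (q ?\<rho>)"
    using \<tau>(1) \<sigma>(2) q_gmult[of \<tau> ?\<rho>] q_unit_iff(3)[of \<tau> ?\<rho>] by simp_all
  moreover have "q \<tau> \<in> gsupp f" "q ?\<rho> \<in> gsupp g" using \<tau> \<rho> by (auto simp: supp_def)
  ultimately show "a \<in> (\<lambda>(a, b). gmult G a b) ` ((gsupp f \<times> gsupp g) \<inter> composable G)"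
    using \<tau>(1) \<rho>(1) by (intro image_eqI[of _ _ "(q \<tau>, q ?\<rho>)"]) (simp_all add: base.in_composable)
qed

text \<open>In a Hausdorff groupoid the composable pairs form a closed set, the equaliser of source and range.\<close>

lemma compactin_gmult_image:
  assumes "compactin (gtop G) K" "compactin (gtop G) L"
  shows "compactin (gtop G) ((\<lambda>(a, b). gmult G a b) ` ((K \<times> L) \<inter> composable G))"
proof -
  let ?T = "prod_topology (gtop G) (gtop G)"
  have "continuous_map ?T (gtop G) (\<lambda>p. src G (fst p))"
    using continuous_map_compose[OF continuous_map_fst base.continuous_src] by (simp add: o_def)
  moreover have "continuous_map ?T (gtop G) (\<lambda>p. rng G (snd p))"
    using continuous_map_compose[OF continuous_map_snd base.continuous_rng] by (simp add: o_def)
  ultimately have "closedin ?T {p \<in> topspace ?T. src G (fst p) = rng G (snd p)}"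
    using closedin_continuous_maps_eq[OF Hausdorff] by blast
  moreover have "{p \<in> topspace ?T. src G (fst p) = rng G (snd p)} = composable G"
    by (auto simp: composable_def)
  ultimately have "closedin ?T (composable G)" by simp
  moreover have "compactin ?T (K \<times> L)" using assms by (simp add: compactin_Times)
  ultimately have "compactin ?T ((K \<times> L) \<inter> composable G)"
    using compact_Int_closedin by blast
  then have "compactin (subtopology ?T (composable G)) ((K \<times> L) \<inter> composable G)"
    by (simp add: compactin_subtopology)
  then show ?thesis using image_compactin base.continuous_mult by blast
qed

lemma A_conv_if_locally_constant:
  assumes "f \<in> A" "g \<in> A" "locally_constant (gtop Sig) (f \<star> g)"
  shows "f \<star> g \<in> A"
  using assms
  by (intro A_I[OF equivariant_conv _ gsupp_conv compactin_gmult_image]) (auto simp: A_iff)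

lemma conv_add_left:
  assumes "f \<in> A" "g \<in> A" "equivariant h"
  shows "(\<lambda>\<sigma>. f \<sigma> + g \<sigma>) \<star> h = (\<lambda>\<sigma>. (f \<star> h) \<sigma> + (g \<star> h) \<sigma>)"
proof
  fix \<sigma>
  show "((\<lambda>\<sigma>. f \<sigma> + g \<sigma>) \<star> h) \<sigma> = (f \<star> h) \<sigma> + (g \<star> h) \<sigma>"
  proof (cases "\<sigma> \<in> elems Sig")
    case True
    let ?F = "fibre (rng G (q \<sigma>)) \<inter> (gsupp f \<union> gsupp g)"
    have F: "finite ?F" using finite_fibre_gsupp assms(1,2) by (simp add: Int_Un_distrib)
    have "gsupp (\<lambda>\<sigma>. f \<sigma> + g \<sigma>) \<subseteq> gsupp f \<union> gsupp g"
      unfolding image_Un[symmetric] by (intro image_mono) (auto simp: supp_def)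
    then have "((\<lambda>\<sigma>. f \<sigma> + g \<sigma>) \<star> h) \<sigma> = (\<Sum>a\<in>?F. conv_term (\<lambda>\<sigma>. f \<sigma> + g \<sigma>) h \<sigma> (lift a))"
      using assms True F by (intro conv_eq_sum A_add) auto
    moreover have "(f \<star> h) \<sigma> = (\<Sum>a\<in>?F. conv_term f h \<sigma> (lift a))"
      using assms True F by (intro conv_eq_sum) auto
    moreover have "(g \<star> h) \<sigma> = (\<Sum>a\<in>?F. conv_term g h \<sigma> (lift a))"
      using assms True F by (intro conv_eq_sum) auto
    ultimately show ?thesis by (simp add: conv_term_def distrib_right sum.distrib)
  qed simp
qed

lemma equivariant_add:
  "equivariant f \<Longrightarrow> equivariant g \<Longrightarrow> equivariant (\<lambda>\<sigma>. f \<sigma> + g \<sigma>)"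
  by (auto simp: equivariant_def distrib_left)

lemma equivariant_smult: "equivariant f \<Longrightarrow> equivariant (\<lambda>\<sigma>. c * f \<sigma>)"
  by (auto simp: equivariant_def mult.left_commute)

lemma conv_add_right:
  assumes "f \<in> A" "equivariant g" "equivariant h"
  shows "f \<star> (\<lambda>\<sigma>. g \<sigma> + h \<sigma>) = (\<lambda>\<sigma>. (f \<star> g) \<sigma> + (f \<star> h) \<sigma>)"
proof
  fix \<sigma>
  show "(f \<star> (\<lambda>\<sigma>. g \<sigma> + h \<sigma>)) \<sigma> = (f \<star> g) \<sigma> + (f \<star> h) \<sigma>"
    using conv_eq_sum_supp[OF assms(1) equivariant_add[OF assms(2,3)]]
      conv_eq_sum_supp[OF assms(1,2)] conv_eq_sum_supp[OF assms(1,3)]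
    by (cases "\<sigma> \<in> elems Sig") (simp_all add: conv_term_def distrib_left sum.distrib)
qed

lemma conv_smult_right:
  assumes "f \<in> A" "equivariant g"
  shows "f \<star> (\<lambda>\<sigma>. c * g \<sigma>) = (\<lambda>\<sigma>. c * (f \<star> g) \<sigma>)"
proof
  fix \<sigma>
  show "(f \<star> (\<lambda>\<sigma>. c * g \<sigma>)) \<sigma> = c * (f \<star> g) \<sigma>"
    using conv_eq_sum_supp[OF assms(1) equivariant_smult[OF assms(2)]] conv_eq_sum_supp[OF assms]
    by (cases "\<sigma> \<in> elems Sig") (simp_all add: conv_term_def sum_distrib_left mult.left_commute)
qed

lemma conv_smult_left:
  assumes "f \<in> A" "equivariant g"
  shows "(\<lambda>\<sigma>. c * f \<sigma>) \<star> g = (\<lambda>\<sigma>. c * (f \<star> g) \<sigma>)"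
proof
  fix \<sigma>
  show "((\<lambda>\<sigma>. c * f \<sigma>) \<star> g) \<sigma> = c * (f \<star> g) \<sigma>"
  proof (cases "\<sigma> \<in> elems Sig")
    case True
    let ?F = "fibre (rng G (q \<sigma>)) \<inter> gsupp f"
    have "gsupp (\<lambda>\<sigma>. c * f \<sigma>) \<subseteq> gsupp f" by (intro image_mono) (auto simp: supp_def)
    then have "((\<lambda>\<sigma>. c * f \<sigma>) \<star> g) \<sigma> = (\<Sum>a\<in>?F. conv_term (\<lambda>\<sigma>. c * f \<sigma>) g \<sigma> (lift a))"
      using assms True finite_fibre_gsupp by (intro conv_eq_sum A_smult) auto
    then show ?thesis
      using conv_eq_sum_supp[OF assms True]
      by (simp add: conv_term_def sum_distrib_left mult.assoc)
  qed simp
qed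

lemma conv_zero_left [simp]: "(\<lambda>_. 0) \<star> g = (\<lambda>_. 0)"
  by (auto simp: convolution_def supp_def)

section \<open>Monomial functions\<close>

text \<open>Monomials are the elements of \<open>A\<close> that behave like group elements: injectivity of range and source
  leaves one term in convolutions with them, and their unit values can be inverted.\<close>

definition monomial :: "('s \<Rightarrow> 'r) \<Rightarrow> bool" where
  "monomial n \<longleftrightarrow> n \<in> A \<and> (\<forall>\<sigma>. n \<sigma> \<noteq> 0 \<longrightarrow> n \<sigma> \<in> ring_units) \<and>
     inj_on (rng G) (gsupp n) \<and> inj_on (src G) (gsupp n)"

lemma monomial_A: "monomial n \<Longrightarrow> n \<in> A" by (simp add: monomial_def)

lemma monomial_equivariant: "monomial n \<Longrightarrow> equivariant n" by (simp add: monomial_def A_iff)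

lemma monomial_unit: "monomial n \<Longrightarrow> n \<sigma> \<noteq> 0 \<Longrightarrow> n \<sigma> \<in> ring_units" by (simp add: monomial_def)

lemma monomial_supp_inj:
  assumes "monomial n" "\<sigma> \<in> elems Sig" "\<tau> \<in> elems Sig" "n \<sigma> \<noteq> 0" "n \<tau> \<noteq> 0"
  shows "rng Sig \<sigma> = rng Sig \<tau> \<Longrightarrow> q \<sigma> = q \<tau>" "src Sig \<sigma> = src Sig \<tau> \<Longrightarrow> q \<sigma> = q \<tau>"
proof -
  have "q \<sigma> \<in> gsupp n" "q \<tau> \<in> gsupp n" using assms by (auto simp: supp_def)
  then show "rng Sig \<sigma> = rng Sig \<tau> \<Longrightarrow> q \<sigma> = q \<tau>" "src Sig \<sigma> = src Sig \<tau> \<Longrightarrow> q \<sigma> = q \<tau>"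
    using assms(1-3) by (auto simp: monomial_def q_unit_iff dest: inj_onD)
qed

lemma monomial_conv:
  assumes n: "monomial n" and "equivariant g" "\<sigma> \<in> elems Sig" "\<tau> \<in> elems Sig"
    "rng Sig \<tau> = rng Sig \<sigma>" "n \<tau> \<noteq> 0"
  shows "(n \<star> g) \<sigma> = n \<tau> * g (gmult Sig (ginv Sig \<tau>) \<sigma>)"
proof (rule conv_single[OF monomial_A[OF n] assms(2-5)])
  fix \<tau>' assume "\<tau>' \<in> elems Sig" "rng Sig \<tau>' = rng Sig \<sigma>" "n \<tau>' \<noteq> 0"
  then show "q \<tau>' = q \<tau>" using monomial_supp_inj(1)[OF n, of \<tau>' \<tau>] assms(4-6) by simp
qed

text \<open>Near \<open>\<sigma>\<close> the single term \<open>n \<tau> * g (\<tau>\<inverse> \<sigma>)\<close> is constant, because \<open>\<tau>\<close> can be chosen close to a fixed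
  element when \<open>\<sigma>\<close> varies: range is an open map. If no such \<open>\<tau>\<close> exists, this persists near \<open>\<sigma>\<close>, because
  the ranges of the support form a compact and hence closed set.\<close>

lemma locally_constant_monomial_conv:
  assumes n: "monomial n" and g: "g \<in> A"
  shows "locally_constant (gtop Sig) (n \<star> g)"
  unfolding locally_constant_def
proof
  fix \<sigma> assume \<sigma>: "\<sigma> \<in> elems Sig"
  have nA: "n \<in> A" and ge: "equivariant g" and ne: "equivariant n"
    using n g by (simp_all add: monomial_A A_equivariant)
  show "\<exists>U. openin (gtop Sig) U \<and> \<sigma> \<in> U \<and> (\<forall>\<rho>\<in>U. (n \<star> g) \<rho> = (n \<star> g) \<sigma>)"
  proof (cases "rng G (q \<sigma>) \<in> rng G ` gsupp n")
    case True
    then obtain a where a: "a \<in> gsupp n" "rng G (q \<sigma>) = rng G a" by blast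
    from gsuppE[OF a(1)] obtain \<tau> where \<tau>': "\<tau> \<in> elems Sig" "q \<tau> = a" "n \<tau> \<noteq> 0" by metis
    with a have \<tau>: "\<tau> \<in> elems Sig" "n \<tau> \<noteq> 0" "rng G (q \<tau>) = rng G (q \<sigma>)" by simp_all
    then have r: "rng Sig \<tau> = rng Sig \<sigma>" using \<sigma> by (simp add: q_unit_iff)
    let ?c = "g (gmult Sig (ginv Sig \<tau>) \<sigma>)"
    have "openin (gtop Sig) {\<rho> \<in> elems Sig. g \<rho> \<in> {?c}}"
      using openin_locally_constant_preimage[of "gtop Sig" g "{?c}"] g by (simp add: A_iff)
    then obtain V W where VW: "openin (gtop Sig) V" "openin (gtop Sig) W" "\<tau> \<in> V" "\<sigma> \<in> W"
      and VWg: "\<And>c d. c \<in> V \<Longrightarrow> d \<in> W \<Longrightarrow> rng Sig c = rng Sig d \<Longrightarrow>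
        gmult Sig (ginv Sig c) d \<in> {\<rho> \<in> elems Sig. g \<rho> \<in> {?c}}"
      using total.division_nbhd[OF _ \<tau>(1) \<sigma> r, of "{\<rho> \<in> elems Sig. g \<rho> \<in> {?c}}"] \<tau>(1) \<sigma> r
      by (metis (no_types, lifting) mem_Collect_eq singletonI total.gmult_simps(1) total.inv_closed total.src_inv)
    \<comment> \<open>On \<open>?V\<close> also the first factor \<open>n\<close> is constant; \<open>?U\<close> collects the elements of \<open>W\<close> whose
      range is the range of an element of \<open>?V\<close>.\<close>
    let ?V = "V \<inter> {\<rho> \<in> elems Sig. n \<rho> \<in> {n \<tau>}}"
    have V: "openin (gtop Sig) ?V"
      using VW(1) openin_locally_constant_preimage[of "gtop Sig" n "{n \<tau>}"] nA
      by (simp add: A_iff openin_Int)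
    let ?U = "W \<inter> {\<rho> \<in> elems Sig. rng G (q \<rho>) \<in> rng G ` q ` ?V}"
    have "continuous_map (gtop Sig) (gtop G) (\<lambda>\<rho>. rng G (q \<rho>))"
      using continuous_map_compose[OF continuous_q base.continuous_rng] by (simp add: o_def)
    from openin_continuous_map_preimage[OF this base.openin_rng_image[OF openin_q_image[OF V]]]
    have U: "openin (gtop Sig) ?U" using VW(2) by blast
    have val: "(n \<star> g) \<rho> = n \<tau> * ?c" if \<rho>U: "\<rho> \<in> ?U" for \<rho>
    proof -
      obtain \<tau>' where \<tau>': "\<tau>' \<in> ?V" "rng G (q \<rho>) = rng G (q \<tau>')"
        and \<rho>: "\<rho> \<in> W" "\<rho> \<in> elems Sig"
        using \<rho>U by blast
      then have r': "rng Sig \<tau>' = rng Sig \<rho>" by (simp add: q_unit_iff)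
      have "(n \<star> g) \<rho> = n \<tau>' * g (gmult Sig (ginv Sig \<tau>') \<rho>)"
        using \<tau>' \<rho> r' \<tau>(2) by (intro monomial_conv n ge) auto
      then show ?thesis using VWg[of \<tau>' \<rho>] \<tau>' \<rho> r' by simp
    qed
    have \<sigma>U: "\<sigma> \<in> ?U"
    proof -
      have "\<tau> \<in> ?V" using VW(3) \<tau>(1) by simp
      then have "rng G (q \<tau>) \<in> rng G ` q ` ?V" by blast
      then show ?thesis using \<tau>(3) VW(4) \<sigma> by simp
    qed
    have "\<forall>\<rho>\<in>?U. (n \<star> g) \<rho> = (n \<star> g) \<sigma>"
      unfolding val[OF \<sigma>U] by (intro ballI val)
    then show ?thesis using U \<sigma>U by blast
  next
    case False
    let ?U = "{\<rho> \<in> elems Sig. rng G (q \<rho>) \<in> elems G - rng G ` gsupp n}"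
    have "compactin (gtop G) (rng G ` gsupp n)"
      using image_compactin[OF _ base.continuous_rng] nA by (simp add: A_iff)
    then have "openin (gtop G) (elems G - rng G ` gsupp n)"
      using closedin_compact by (simp add: closedin_def)
    moreover have "continuous_map (gtop Sig) (gtop G) (\<lambda>\<rho>. rng G (q \<rho>))"
      using continuous_map_compose[OF continuous_q base.continuous_rng] by (simp add: o_def)
    ultimately have U: "openin (gtop Sig) ?U" using openin_continuous_map_preimage by blast
    have zero: "(n \<star> g) \<rho> = 0" if \<rho>: "\<rho> \<in> ?U" for \<rho>
    proof (rule ccontr)
      assume "(n \<star> g) \<rho> \<noteq> 0"
      moreover have \<rho>e: "\<rho> \<in> elems Sig" using \<rho> by blast
      ultimately obtain \<tau> where "\<tau> \<in> elems Sig" "rng Sig \<tau> = rng Sig \<rho>" "n \<tau> \<noteq> 0"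
        using conv_nonzeroE[OF nA ge, of \<rho>] by blast
      then have "rng G (q \<rho>) = rng G (q \<tau>)" "q \<tau> \<in> gsupp n"
        using \<rho>e by (simp_all add: q_unit_iff supp_def)
      then show False using \<rho> by blast
    qed
    have \<sigma>U: "\<sigma> \<in> ?U" using False \<sigma> by simp
    have "\<forall>\<rho>\<in>?U. (n \<star> g) \<rho> = (n \<star> g) \<sigma>"
      unfolding zero[OF \<sigma>U] by (intro ballI zero)
    then show ?thesis using U \<sigma>U by blast
  qed
qed

lemma act_free:
  assumes "\<sigma> \<in> elems Sig" "t \<in> ring_units" "u \<in> ring_units" "act t \<sigma> = act u \<sigma>"
  shows "t = u"
proof -
  let ?x = "rng G (q \<sigma>)"
  have "i (?x, t) = gmult Sig (act t \<sigma>) (ginv Sig \<sigma>)"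
    using assms(1-3) by (simp add: act_eq)
  also have "\<dots> = gmult Sig (act u \<sigma>) (ginv Sig \<sigma>)" using assms(4) by simp
  also have "\<dots> = i (?x, u)" using assms(1-3) by (simp add: act_eq)
  finally have "(?x, t) = (?x, u)"
    by (rule inj_onD[OF DT1_inj]) (use assms in auto)
  then show ?thesis by simp
qed

text \<open>Given a section \<open>P\<close> of \<open>q\<close> over a compact open bisection \<open>W\<close>, let the value at \<open>t \<cdot> P(b)\<close> be \<open>t\<inverse>\<close>
  for \<open>b\<close> in \<open>W\<close>, and let the function vanish off \<open>W\<close>.\<close>

lemma ex_monomial:
  assumes U: "openin (gtop G) U" "a \<in> U"
  obtains n where "monomial n" "a \<in> gsupp n" "gsupp n \<subseteq> U"
proof -
  have a: "a \<in> elems G" using openin_subset[OF U(1)] U(2) by blast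
  obtain D P where D: "openin (gtop G) D" "a \<in> D" "continuous_map (subtopology (gtop G) D) (gtop Sig) P"
    "\<forall>b\<in>D. q (P b) = b"
    and h: "homeomorphic_map
        (prod_topology (subtopology (gtop G) D) (discrete_topology ring_units))
        (subtopology (gtop Sig) (twist_preimage Sig q D))
        (\<lambda>(b, t). gmult Sig (i (rng G b, t)) (P b))" (is "homeomorphic_map ?X ?Y ?h")
    using DT2[OF a] by auto
  have De: "D \<subseteq> elems G" using openin_subset[OF D(1)] .
  have P: "P b \<in> elems Sig" "q (P b) = b" if "b \<in> D" for b
    using D(3,4) that De continuous_map_funspace[OF D(3)] by (auto simp: topspace_subtopology)
  obtain W where W: "openin (gtop G) W" "compactin (gtop G) W" "bisection G W" "a \<in> W" "W \<subseteq> U \<inter> D"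
    using base.compact_open_bisection_nbhd[of "U \<inter> D" a] U D by blast
  define T where "T \<sigma> = (THE t. t \<in> ring_units \<and> \<sigma> = act t (P (q \<sigma>)))" for \<sigma>
  define n where "n \<sigma> = (if \<sigma> \<in> elems Sig \<and> q \<sigma> \<in> W then unit_inv (T \<sigma>) else 0)" for \<sigma>
  have n_act: "n (act t (P b)) = unit_inv t" if "b \<in> W" "t \<in> ring_units" for b t
  proof -
    have "b \<in> D" using that W by blast
    note P = P[OF this]
    have "T (act t (P b)) = t"
      unfolding T_def using that P by (intro the_equality) (auto dest: act_free)
    then show ?thesis using that P by (simp add: n_def)
  qed
  have n_cases: "\<exists>b\<in>W. \<exists>t\<in>ring_units. \<sigma> = act t (P b) \<and> b = q \<sigma>"
    if \<sigma>: "\<sigma> \<in> elems Sig" "q \<sigma> \<in> W" for \<sigma>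
  proof -
    have "q \<sigma> \<in> D" using \<sigma> W by blast
    note P = P[OF this]
    obtain t where "t \<in> ring_units" "\<sigma> = act t (P (q \<sigma>))"
      using fibre_transitive[OF \<sigma>(1) P(1) P(2)[symmetric]] by blast
    with \<sigma> show ?thesis by blast
  qed
  have gsupp: "gsupp n = W"
  proof (intro equalityI subsetI)
    fix b assume b: "b \<in> W"
    then have "b \<in> D" using W by blast
    note P = P[OF this]
    have "n (act 1 (P b)) = 1" using n_act[OF b] by simp
    then have "P b \<in> supp Sig n" using P nontrivial by (simp add: supp_def)
    then show "b \<in> gsupp n" using P(2) by (metis image_eqI)
  qed (auto simp: supp_def n_def split: if_splits)
  have equi: "equivariant n"
    unfolding equivariant_def
  proof (intro conjI allI impI ballI)
    fix t :: 'r and \<sigma> assume t: "t \<in> ring_units" and \<sigma>: "\<sigma> \<in> elems Sig"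
    show "n (act t \<sigma>) = unit_inv t * n \<sigma>"
    proof (cases "q \<sigma> \<in> W")
      case True
      then obtain b u where b: "b \<in> W" "u \<in> ring_units" "\<sigma> = act u (P b)" using n_cases[OF \<sigma>] by blast
      have "b \<in> D" using b W by blast
      then have "act t \<sigma> = act (t * u) (P b)" using b t P by (simp add: act_act)
      then show ?thesis using n_act b t ring_units_times[OF t b(2)] by simp
    qed (use t \<sigma> in \<open>simp add: n_def\<close>)
  qed (simp add: n_def)
  have lc: "locally_constant (gtop Sig) n"
    unfolding locally_constant_def
  proof
    fix \<sigma> assume \<sigma>: "\<sigma> \<in> elems Sig"
    show "\<exists>U. openin (gtop Sig) U \<and> \<sigma> \<in> U \<and> (\<forall>\<tau>\<in>U. n \<tau> = n \<sigma>)"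
    proof (cases "q \<sigma> \<in> W")
      case True
      then obtain b u where b: "b \<in> W" "u \<in> ring_units" "\<sigma> = act u (P b)" using n_cases[OF \<sigma>] by blast
      have h_act: "?h (c, u) = act u (P c)" if "c \<in> W" for c
        using P[of c] that W by (auto simp: act_eq)
      \<comment> \<open>The set of all \<open>u \<cdot> P(c)\<close> with \<open>c \<in> W\<close> is open because \<open>R\<^sup>\<times>\<close> is discrete.\<close>
      have "openin (subtopology (gtop G) D) W"
        using W D(1) by (simp add: openin_open_subtopology)
      then have "openin ?X (W \<times> {u})" using b by (simp add: openin_prod_Times_iff)
      then have "openin ?Y (?h ` (W \<times> {u}))"
        using homeomorphic_imp_open_map[OF h] unfolding open_map_def by blast
      moreover have "openin (gtop Sig) (twist_preimage Sig q D)"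
        using openin_q_preimage[OF D(1)] by (simp add: twist_preimage_def)
      ultimately have "openin (gtop Sig) (?h ` (W \<times> {u}))" using openin_trans_full by blast
      also have "?h ` (W \<times> {u}) = (\<lambda>c. act u (P c)) ` W"
      proof -
        have "W \<times> {u} = (\<lambda>c. (c, u)) ` W" by auto
        then have "?h ` (W \<times> {u}) = (\<lambda>c. ?h (c, u)) ` W" by (simp only: image_image)
        also have "\<dots> = (\<lambda>c. act u (P c)) ` W" by (rule image_cong[OF refl h_act])
        finally show ?thesis .
      qed
      finally have "openin (gtop Sig) ((\<lambda>c. act u (P c)) ` W)" .
      moreover have "n \<tau> = n \<sigma>" if \<tau>: "\<tau> \<in> (\<lambda>c. act u (P c)) ` W" for \<tau>
      proof -
        obtain c where "c \<in> W" "\<tau> = act u (P c)" using \<tau> by blast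
        then show ?thesis using n_act[OF _ b(2)] b by simp
      qed
      ultimately show ?thesis using b by blast
    next
      case False
      have "openin (gtop G) (elems G - W)" using closedin_compact[OF W(2)] by blast
      from openin_q_preimage[OF this] show ?thesis using False \<sigma>
        by (intro exI[of _ "{\<sigma> \<in> elems Sig. q \<sigma> \<in> elems G - W}"]) (simp add: n_def)
    qed
  qed
  have "n \<sigma> \<in> ring_units" if "n \<sigma> \<noteq> 0" for \<sigma>
  proof -
    have "\<sigma> \<in> elems Sig" "q \<sigma> \<in> W" using that by (auto simp: n_def split: if_splits)
    then obtain b u where "b \<in> W" "u \<in> ring_units" "\<sigma> = act u (P b)" using n_cases by blast
    then show ?thesis using n_act by simp
  qed
  moreover have "n \<in> A" using equi lc W gsupp by (simp add: A_iff)
  ultimately have "monomial n"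
    using bisection_inj_on[OF W(3)] gsupp by (simp add: monomial_def)
  with gsupp W show ?thesis using that by auto
qed

section \<open>Monomials span the algebra\<close>

lemma monomial_restr:
  assumes "monomial n" "openin (gtop G) W" "closedin (gtop G) W"
  shows "monomial (restr W n)"
  using assms A_restr[of n W] unfolding monomial_def gsupp_restr
  by (auto simp: restr_def intro: inj_on_subset)

text \<open>Normalise a monomial \<open>n\<close> to have value \<open>1\<close> at a point over \<open>a\<close>. Near this point \<open>f\<close> and \<open>n\<close> are both
  constant, and equivariance extends \<open>f = c * n\<close> to the full fibres. The conclusion holds for all
  compact open \<open>W\<close> in \<open>V\<close>, so that a cover by such sets can be made disjoint.\<close>

lemma local_monomial_form:
  assumes f: "f \<in> A" and a: "a \<in> elems G"
  obtains V c where "openin (gtop G) V" "a \<in> V"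
    "\<And>W. openin (gtop G) W \<Longrightarrow> compactin (gtop G) W \<Longrightarrow> W \<subseteq> V \<Longrightarrow>
       \<exists>n. monomial n \<and> gsupp n = W \<and> restr W f = (\<lambda>\<sigma>. c * n \<sigma>)"
proof -
  obtain n where n: "monomial n" "a \<in> gsupp n"
    using ex_monomial[of "elems G" a] a by blast
  from gsuppE[OF n(2)] obtain \<sigma> where \<sigma>: "\<sigma> \<in> elems Sig" "q \<sigma> = a" "n \<sigma> \<noteq> 0" by metis
  \<comment> \<open>Acting by \<open>n \<sigma>\<close> multiplies the value of \<open>n\<close> by its inverse, so \<open>n \<sigma>1 = 1\<close>.\<close>
  define \<sigma>1 where "\<sigma>1 = act (n \<sigma>) \<sigma>"
  have u: "n \<sigma> \<in> ring_units" using n \<sigma> monomial_unit by blast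
  have \<sigma>1: "\<sigma>1 \<in> elems Sig" "q \<sigma>1 = a" "n \<sigma>1 = 1"
    using u \<sigma> n by (simp_all add: \<sigma>1_def equivariant_act monomial_equivariant)
  let ?O = "{\<tau> \<in> elems Sig. n \<tau> \<in> {1}} \<inter> {\<tau> \<in> elems Sig. f \<tau> \<in> {f \<sigma>1}}"
  have O: "openin (gtop Sig) ?O"
    using f n(1) monomial_A[OF n(1)]
    by (intro openin_Int openin_locally_constant_preimage) (auto simp: A_iff)
  show ?thesis
  proof (rule that[of "q ` ?O" "f \<sigma>1"])
    show "openin (gtop G) (q ` ?O)" by (rule openin_q_image[OF O])
    show "a \<in> q ` ?O" using \<sigma>1 by blast
    fix W assume W: "openin (gtop G) W" "compactin (gtop G) W" "W \<subseteq> q ` ?O"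
    have "monomial (restr W n)" using monomial_restr[OF n(1) W(1) closedin_compact[OF W(2)]] .
    moreover have "gsupp (restr W n) = W"
    proof -
      have "W \<subseteq> gsupp n" using W(3) nontrivial by (fastforce simp: supp_def)
      then show ?thesis unfolding gsupp_restr by blast
    qed
    moreover have "restr W f = (\<lambda>\<sigma>. f \<sigma>1 * restr W n \<sigma>)"
    proof
      fix \<sigma>
      show "restr W f \<sigma> = f \<sigma>1 * restr W n \<sigma>"
      proof (cases "\<sigma> \<in> elems Sig \<and> q \<sigma> \<in> W")
        case True
        then obtain \<tau> where \<tau>: "\<tau> \<in> elems Sig" "q \<sigma> = q \<tau>" "n \<tau> = 1" "f \<tau> = f \<sigma>1"
          using W(3) by auto
        then obtain t where "t \<in> ring_units" "\<sigma> = act t \<tau>" using fibre_transitive True by metis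
        then show ?thesis using True \<tau> f n(1)
          by (simp add: restr_def equivariant_act monomial_equivariant A_equivariant mult.commute)
      next
        case False
        then show ?thesis
          using equivariant_outside[OF A_equivariant[OF f]]
            equivariant_outside[OF monomial_equivariant[OF n(1)]]
          by (auto simp: restr_def)
      qed
    qed
    ultimately show "\<exists>n. monomial n \<and> gsupp n = W \<and> restr W f = (\<lambda>\<sigma>. f \<sigma>1 * n \<sigma>)" by blast
  qed
qed

abbreviation "Alg \<equiv> twisted_steinberg_algebra G Sig i q"

lemma Alg_simps [simp]:
  "acarrier Alg = A" "azero Alg = (\<lambda>_. 0)" "aadd Alg = (\<lambda>f g \<sigma>. f \<sigma> + g \<sigma>)"
  "asmult Alg = (\<lambda>t f \<sigma>. t * f \<sigma>)" "amult Alg = (\<star>)"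
  by (simp_all add: twisted_steinberg_algebra_def)

text \<open>Cover the compact support by finitely many good sets and split off one of them at a time:
  \<open>f\<close> restricted to \<open>W\<close> is the sum of its restrictions to \<open>W \<inter> D\<close> and \<open>W - D\<close>.\<close>

lemma lin_span_if_local:
  assumes f: "f \<in> A"
    and local: "\<And>a. a \<in> gsupp f \<Longrightarrow> \<exists>V. openin (gtop G) V \<and> a \<in> V \<and>
      (\<forall>W. openin (gtop G) W \<and> compactin (gtop G) W \<and> W \<subseteq> V \<longrightarrow>
         (\<exists>c. \<exists>x\<in>X. restr W f = (\<lambda>\<sigma>. c * x \<sigma>)))"
  shows "f \<in> lin_span Alg X"
proof -
  define \<D> where "\<D> = {D. openin (gtop G) D \<and> compactin (gtop G) D \<and>
      (\<forall>W. openin (gtop G) W \<and> compactin (gtop G) W \<and> W \<subseteq> D \<longrightarrow>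
         (\<exists>c. \<exists>x\<in>X. restr W f = (\<lambda>\<sigma>. c * x \<sigma>)))}"
  have K: "openin (gtop G) (gsupp f)" "compactin (gtop G) (gsupp f)"
    using f openin_gsupp by (auto simp: A_iff)
  have "\<exists>D\<in>\<D>. a \<in> D" if "a \<in> gsupp f" for a
  proof -
    obtain V where V: "openin (gtop G) V" "a \<in> V"
      "\<forall>W. openin (gtop G) W \<and> compactin (gtop G) W \<and> W \<subseteq> V \<longrightarrow>
         (\<exists>c. \<exists>x\<in>X. restr W f = (\<lambda>\<sigma>. c * x \<sigma>))"
      using local[OF \<open>a \<in> gsupp f\<close>] by blast
    obtain D where D: "openin (gtop G) D" "compactin (gtop G) D" "a \<in> D" "D \<subseteq> V"
      using base.compact_open_bisection_nbhd[OF V(1,2)] by metis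
    have "D \<in> \<D>"
      unfolding \<D>_def mem_Collect_eq
    proof (intro conjI allI impI D(1,2))
      fix W assume W: "openin (gtop G) W \<and> compactin (gtop G) W \<and> W \<subseteq> D"
      then have "W \<subseteq> V" using D(4) by blast
      with W V(3) show "\<exists>c. \<exists>x\<in>X. restr W f = (\<lambda>\<sigma>. c * x \<sigma>)" by blast
    qed
    with D show ?thesis by blast
  qed
  then have "gsupp f \<subseteq> \<Union>\<D>" by blast
  then obtain F where F: "finite F" "F \<subseteq> \<D>" "gsupp f \<subseteq> \<Union>F"
    using compactinD[OF K(2), of \<D>] unfolding \<D>_def by auto
  have "\<forall>W. openin (gtop G) W \<and> compactin (gtop G) W \<and> W \<subseteq> \<Union>F \<longrightarrow> restr W f \<in> lin_span Alg X"
    using F(1,2)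
  proof (induction F rule: finite_induct)
    case empty
    have "restr {} f = azero Alg" by (simp add: restr_def)
    then show ?case using lin_span.span_zero[of Alg X] by auto
  next
    case (insert D F)
    show ?case
    proof (intro allI impI)
      fix W assume W: "openin (gtop G) W \<and> compactin (gtop G) W \<and> W \<subseteq> \<Union> (insert D F)"
      have D: "openin (gtop G) D" "closedin (gtop G) D"
        using insert.prems closedin_compact by (auto simp: \<D>_def)
      have "openin (gtop G) (W \<inter> D)" "compactin (gtop G) (W \<inter> D)"
        using W D compact_Int_closedin by auto
      moreover have "D \<in> \<D>" using insert.prems by blast
      ultimately have "\<exists>c. \<exists>x\<in>X. restr (W \<inter> D) f = (\<lambda>\<sigma>. c * x \<sigma>)"
        unfolding \<D>_def mem_Collect_eq by (elim conjE allE[of _ "W \<inter> D"]) simp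
      then obtain c x where x: "x \<in> X" "restr (W \<inter> D) f = (\<lambda>\<sigma>. c * x \<sigma>)" by blast
      have "W - D = W \<inter> (elems G - D)" using W openin_subset by fast
      moreover have "closedin (gtop G) (elems G - D)" "openin (gtop G) (elems G - D)" using D by blast+
      ultimately have "openin (gtop G) (W - D)" "compactin (gtop G) (W - D)"
        using W compact_Int_closedin by auto
      moreover have "W - D \<subseteq> \<Union>F" using W by blast
      ultimately have y: "restr (W - D) f \<in> lin_span Alg X"
        using insert.IH insert.prems by blast
      have "restr W f = aadd Alg (asmult Alg c x) (restr (W - D) f)"
      proof
        fix \<sigma>
        show "restr W f \<sigma> = aadd Alg (asmult Alg c x) (restr (W - D) f) \<sigma>"
          using fun_cong[OF x(2), of \<sigma>] by (cases "q \<sigma> \<in> W"; cases "q \<sigma> \<in> D") (simp_all add: restr_def)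
      qed
      then show "restr W f \<in> lin_span Alg X" using lin_span.span_step[OF x(1) y, of c] by simp
    qed
  qed
  then have "restr (gsupp f) f \<in> lin_span Alg X" using K F(3) by blast
  moreover have "restr (gsupp f) f = f"
    using gsupp_iff[OF A_equivariant[OF f]] equivariant_outside[OF A_equivariant[OF f]]
    by (auto simp: restr_def fun_eq_iff)
  ultimately show ?thesis by simp
qed

lemma lin_span_subset_A: "X \<subseteq> A \<Longrightarrow> lin_span Alg X \<subseteq> A"
proof
  fix f assume X: "X \<subseteq> A" and "f \<in> lin_span Alg X"
  from this(2) show "f \<in> A"
    by (induction rule: lin_span.induct) (use X in \<open>auto intro!: A_add A_smult\<close>)
qed

lemma A_eq_span_monomials: "A = lin_span Alg (Collect monomial)"
proof
  show "A \<subseteq> lin_span Alg (Collect monomial)"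
  proof
    fix f assume f: "f \<in> A"
    show "f \<in> lin_span Alg (Collect monomial)"
    proof (rule lin_span_if_local[OF f])
      fix a assume "a \<in> gsupp f"
      then have "a \<in> elems G" using gsupp_elems by blast
      then obtain V c where V: "openin (gtop G) V" "a \<in> V"
        and loc: "\<And>W. openin (gtop G) W \<Longrightarrow> compactin (gtop G) W \<Longrightarrow> W \<subseteq> V \<Longrightarrow>
          \<exists>n. monomial n \<and> gsupp n = W \<and> restr W f = (\<lambda>\<sigma>. c * n \<sigma>)"
        using local_monomial_form[OF f] by metis
      have "\<exists>c. \<exists>x\<in>Collect monomial. restr W f = (\<lambda>\<sigma>. c * x \<sigma>)"
        if "openin (gtop G) W \<and> compactin (gtop G) W \<and> W \<subseteq> V" for W
        using loc[of W] that by blast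
      with V show "\<exists>V. openin (gtop G) V \<and> a \<in> V \<and>
        (\<forall>W. openin (gtop G) W \<and> compactin (gtop G) W \<and> W \<subseteq> V \<longrightarrow>
           (\<exists>c. \<exists>x\<in>Collect monomial. restr W f = (\<lambda>\<sigma>. c * x \<sigma>)))"
        by blast
    qed
  qed
  show "lin_span Alg (Collect monomial) \<subseteq> A"
    by (intro lin_span_subset_A subsetI) (simp add: monomial_A)
qed

lemma A_induct [consumes 1, case_names zero step]:
  assumes "f \<in> A" and "Q (\<lambda>_. 0)"
    and step: "\<And>n f t. monomial n \<Longrightarrow> f \<in> A \<Longrightarrow> Q f \<Longrightarrow> Q (\<lambda>\<sigma>. t * n \<sigma> + f \<sigma>)"
  shows "Q f"
proof -
  have "f \<in> lin_span Alg (Collect monomial)" using assms(1) A_eq_span_monomials by blast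
  then show ?thesis
  proof induction
    case (span_step n f t)
    then have "f \<in> A" using A_eq_span_monomials by blast
    with span_step show ?case using step[of n f t] by simp
  qed (use assms in simp)
qed

text \<open>The difficulty is local constancy. It is linear in \<open>f\<close>, so it follows from the case of monomials.\<close>

lemma A_conv:
  assumes f: "f \<in> A" and g: "g \<in> A"
  shows "f \<star> g \<in> A"
proof (rule A_conv_if_locally_constant[OF f g])
  have ge: "equivariant g" using g by (rule A_equivariant)
  show "locally_constant (gtop Sig) (f \<star> g)" using f
  proof (induction rule: A_induct)
    case (step n f t)
    have "(\<lambda>\<sigma>. t * n \<sigma> + f \<sigma>) \<star> g = (\<lambda>\<sigma>. t * (n \<star> g) \<sigma> + (f \<star> g) \<sigma>)"
      using step by (simp add: conv_add_left[OF A_smult _ ge] conv_smult_left[OF _ ge] monomial_A)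
    then show ?case
      using locally_constant_combine[OF locally_constant_monomial_conv[OF step(1) g] step(3),
        of "\<lambda>x y. t * x + y"] by simp
  qed simp
qed

text \<open>With \<open>\<tau>\<close> in the support of \<open>n\<close> over the range of \<open>\<sigma>\<close>, both sides are sums over a range fibre of \<open>G\<close>:
  that of \<open>r(\<tau>)\<close> on the left, that of \<open>s(\<tau>)\<close> on the right. Left multiplication by \<open>q(\<tau>)\<close> maps the
  second fibre to the first and matches the terms.\<close>

lemma monomial_conv_assoc:
  assumes n: "monomial n" and g: "g \<in> A" and h: "equivariant h"
  shows "(n \<star> g) \<star> h = n \<star> (g \<star> h)"
proof
  fix \<sigma>
  have nA: "n \<in> A" and ge: "equivariant g" using n g by (simp_all add: monomial_A A_equivariant)
  have ngA: "n \<star> g \<in> A" by (rule A_conv[OF nA g])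
  have gh: "equivariant (g \<star> h)" by (rule equivariant_conv[OF g h])
  show "((n \<star> g) \<star> h) \<sigma> = (n \<star> (g \<star> h)) \<sigma>"
  proof (cases "\<exists>\<tau>\<in>elems Sig. \<sigma> \<in> elems Sig \<and> rng Sig \<tau> = rng Sig \<sigma> \<and> n \<tau> \<noteq> 0")
    case True
    then obtain \<tau> where \<tau>: "\<tau> \<in> elems Sig" "rng Sig \<tau> = rng Sig \<sigma>" "n \<tau> \<noteq> 0" and \<sigma>: "\<sigma> \<in> elems Sig" by blast
    have u: "n \<tau> \<in> ring_units" using monomial_unit n \<tau> by blast
    let ?\<rho> = "gmult Sig (ginv Sig \<tau>) \<sigma>"
    have \<rho>: "?\<rho> \<in> elems Sig" "rng Sig ?\<rho> = src Sig \<tau>" using \<tau> \<sigma> by simp_all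
    have term_eq: "n \<tau> * conv_term g h ?\<rho> c = conv_term (n \<star> g) h \<sigma> (gmult Sig \<tau> c)"
      if c: "c \<in> elems Sig" "src Sig \<tau> = rng Sig c" for c
    proof -
      have "(n \<star> g) (gmult Sig \<tau> c) = n \<tau> * g (gmult Sig (ginv Sig \<tau>) (gmult Sig \<tau> c))"
        using \<tau> c by (intro monomial_conv n ge) simp_all
      moreover have "gmult Sig (ginv Sig (gmult Sig \<tau> c)) \<sigma> = gmult Sig (ginv Sig c) ?\<rho>"
        using \<tau> c \<sigma> by (simp add: total.inv_gmult total.gmult_assoc)
      ultimately show ?thesis using \<tau> c by (simp add: conv_term_def mult.assoc)
    qed
    let ?a = "q \<tau>"
    have ra: "rng G ?a = rng G (q \<sigma>)" using \<tau> \<sigma> by (simp flip: q_unit_iff)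
    have lift_eq: "n \<tau> * conv_term g h ?\<rho> (lift b) = conv_term (n \<star> g) h \<sigma> (lift (gmult G ?a b))"
      if b: "b \<in> fibre (src G ?a)" for b
    proof -
      have b: "b \<in> elems G" "src G ?a = rng G b" using b by (auto simp: fibre_def)
      then have s: "src Sig \<tau> = rng Sig (lift b)" using \<tau> by (simp add: q_unit_iff)
      have "conv_term (n \<star> g) h \<sigma> (lift (gmult G ?a b)) = conv_term (n \<star> g) h \<sigma> (gmult Sig \<tau> (lift b))"
        using ngA h \<sigma> \<tau> b s by (intro conv_term_cong) (simp_all add: A_equivariant)
      then show ?thesis using term_eq[of "lift b"] b s by simp
    qed
    have "((n \<star> g) \<star> h) \<sigma> =
      (\<Sum>a\<in>{a \<in> fibre (rng G (q \<sigma>)). conv_term (n \<star> g) h \<sigma> (lift a) \<noteq> 0}. conv_term (n \<star> g) h \<sigma> (lift a))"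
      by (rule conv_eq_sum_nonzero[OF ngA h \<sigma>])
    also have "\<dots> = (\<Sum>b\<in>{b \<in> fibre (src G ?a). conv_term g h ?\<rho> (lift b) \<noteq> 0}. n \<tau> * conv_term g h ?\<rho> (lift b))"
    proof (rule sum.reindex_bij_witness[where i = "gmult G ?a" and j = "gmult G (ginv G ?a)"])
      fix b assume "b \<in> {b \<in> fibre (src G ?a). conv_term g h ?\<rho> (lift b) \<noteq> 0}"
      then have b: "b \<in> fibre (src G ?a)" "conv_term g h ?\<rho> (lift b) \<noteq> 0" by auto
      then have b': "b \<in> elems G" "rng G b = src G ?a" by (auto simp: fibre_def)
      show "gmult G (ginv G ?a) (gmult G ?a b) = b" using b' \<tau> by simp
      show "gmult G ?a b \<in> {a \<in> fibre (rng G (q \<sigma>)). conv_term (n \<star> g) h \<sigma> (lift a) \<noteq> 0}"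
        using b' b(2) \<tau> ra u lift_eq[OF b(1), symmetric] by (simp add: fibre_def)
    next
      fix a assume "a \<in> {a \<in> fibre (rng G (q \<sigma>)). conv_term (n \<star> g) h \<sigma> (lift a) \<noteq> 0}"
      then have a: "a \<in> elems G" "rng G a = rng G ?a" "conv_term (n \<star> g) h \<sigma> (lift a) \<noteq> 0"
        using ra by (auto simp: fibre_def)
      have b: "gmult G (ginv G ?a) a \<in> fibre (src G ?a)" using a \<tau> by (simp add: fibre_def)
      show aa: "gmult G ?a (gmult G (ginv G ?a) a) = a" using a \<tau> by simp
      show eq: "n \<tau> * conv_term g h ?\<rho> (lift (gmult G (ginv G ?a) a)) = conv_term (n \<star> g) h \<sigma> (lift a)"
        using lift_eq[OF b] aa by simp
      show "gmult G (ginv G ?a) a \<in> {b \<in> fibre (src G ?a). conv_term g h ?\<rho> (lift b) \<noteq> 0}"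
        using b eq a(3) by auto
    qed
    also have "\<dots> = n \<tau> * (g \<star> h) ?\<rho>"
    proof -
      have "rng G (q ?\<rho>) = src G ?a" using \<tau> \<sigma> ra by simp
      then show ?thesis using conv_eq_sum_nonzero[OF g h \<rho>(1)] by (simp add: sum_distrib_left)
    qed
    also have "\<dots> = (n \<star> (g \<star> h)) \<sigma>"
      using monomial_conv[OF n gh \<sigma> \<tau>] by simp
    finally show ?thesis .
  next
    case False
    have "((n \<star> g) \<star> h) \<sigma> = 0"
    proof (rule ccontr)
      assume ne: "((n \<star> g) \<star> h) \<sigma> \<noteq> 0"
      then have \<sigma>: "\<sigma> \<in> elems Sig" using conv_outside by blast
      then obtain \<tau> where "\<tau> \<in> elems Sig" "rng Sig \<tau> = rng Sig \<sigma>" "(n \<star> g) \<tau> \<noteq> 0"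
        using conv_nonzeroE[OF ngA h] ne by metis
      then show False using conv_nonzeroE[OF nA ge] False \<sigma> by metis
    qed
    moreover have "(n \<star> (g \<star> h)) \<sigma> = 0"
      using conv_nonzeroE[OF nA gh] conv_outside False by metis
    ultimately show ?thesis by simp
  qed
qed

lemma conv_assoc:
  assumes "f \<in> A" "g \<in> A" "h \<in> A"
  shows "(f \<star> g) \<star> h = f \<star> (g \<star> h)"
  using assms(1)
proof (induction rule: A_induct)
  case (step n f t)
  have ge: "equivariant g" and he: "equivariant h" using assms by (simp_all add: A_iff)
  have ghe: "equivariant (g \<star> h)" using assms A_conv by (simp add: A_iff)
  have nA: "n \<in> A" using step by (simp add: monomial_A)
  have "(\<lambda>\<sigma>. t * n \<sigma> + f \<sigma>) \<star> g \<star> h = (\<lambda>\<sigma>. t * (n \<star> g) \<sigma> + (f \<star> g) \<sigma>) \<star> h"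
    using step nA by (simp add: conv_add_left[OF A_smult _ ge] conv_smult_left[OF _ ge])
  also have "\<dots> = (\<lambda>\<sigma>. t * (n \<star> g \<star> h) \<sigma> + (f \<star> g \<star> h) \<sigma>)"
    using step nA assms by (simp add: conv_add_left[OF A_smult _ he] conv_smult_left[OF _ he] A_conv)
  also have "\<dots> = (\<lambda>\<sigma>. t * n \<sigma> + f \<sigma>) \<star> (g \<star> h)"
    using step nA assms he
    by (simp add: conv_add_left[OF A_smult _ ghe] conv_smult_left[OF _ ghe] monomial_conv_assoc)
  finally show ?case .
qed simp

lemma nonunital_algebra_Alg: "nonunital_algebra Alg"
proof
  fix f assume "f \<in> acarrier Alg"
  then show "\<exists>y\<in>acarrier Alg. aadd Alg f y = azero Alg"
    using A_smult[of f "-1"] by (intro bexI[of _ "\<lambda>\<sigma>. - 1 * f \<sigma>"]) auto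
qed (auto simp: A_add A_smult A_conv conv_assoc conv_add_left conv_add_right conv_smult_left
  conv_smult_right A_equivariant algebra_simps)

section \<open>The unit subalgebra\<close>

abbreviation "B \<equiv> steinberg_unit_subalgebra G Sig i q"

lemma B_I:
  assumes "f \<in> A" "\<And>\<sigma>. \<sigma> \<in> elems Sig \<Longrightarrow> f \<sigma> \<noteq> 0 \<Longrightarrow> q \<sigma> \<in> units G"
  shows "f \<in> B"
  using assms by (auto simp: steinberg_unit_subalgebra_def supp_def twist_preimage_def)

lemma B_A: "f \<in> B \<Longrightarrow> f \<in> A"
  by (simp add: steinberg_unit_subalgebra_def)

lemma B_equivariant: "f \<in> B \<Longrightarrow> equivariant f"
  by (simp add: B_A A_equivariant)

lemma B_supp: "f \<in> B \<Longrightarrow> \<sigma> \<in> elems Sig \<Longrightarrow> f \<sigma> \<noteq> 0 \<Longrightarrow> q \<sigma> \<in> units G"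
  by (auto simp: steinberg_unit_subalgebra_def supp_def twist_preimage_def)

lemma conv_B_left:
  assumes b: "b \<in> B" and g: "equivariant g" and \<sigma>: "\<sigma> \<in> elems Sig"
  shows "(b \<star> g) \<sigma> = b (rng Sig \<sigma>) * g \<sigma>"
proof -
  have "(b \<star> g) \<sigma> = b (rng Sig \<sigma>) * g (gmult Sig (ginv Sig (rng Sig \<sigma>)) \<sigma>)"
  proof (rule conv_single[OF B_A[OF b] g \<sigma>])
    fix \<tau> assume \<tau>: "\<tau> \<in> elems Sig" "rng Sig \<tau> = rng Sig \<sigma>" "b \<tau> \<noteq> 0"
    then have "rng G (q \<tau>) = q \<tau>" using B_supp[OF b] by simp
    then show "q \<tau> = q (rng Sig \<sigma>)" using \<tau> \<sigma> by (simp add: q_unit_iff)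
  qed (use \<sigma> in simp_all)
  then show ?thesis using \<sigma> by simp
qed

lemma conv_B_right:
  assumes f: "f \<in> A" and b: "b \<in> B" and \<sigma>: "\<sigma> \<in> elems Sig"
  shows "(f \<star> b) \<sigma> = f \<sigma> * b (src Sig \<sigma>)"
proof -
  have "(f \<star> b) \<sigma> = f \<sigma> * b (gmult Sig (ginv Sig \<sigma>) \<sigma>)"
  proof (rule conv_single[OF f B_equivariant[OF b] \<sigma>])
    fix \<tau> assume \<tau>: "\<tau> \<in> elems Sig" "rng Sig \<tau> = rng Sig \<sigma>"
      "b (gmult Sig (ginv Sig \<tau>) \<sigma>) \<noteq> 0"
    have "q (gmult Sig (ginv Sig \<tau>) \<sigma>) \<in> units G"
      by (rule B_supp[OF b _ \<tau>(3)]) (use \<tau> \<sigma> in simp)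
    then have "gmult G (ginv G (q \<tau>)) (q \<sigma>) \<in> units G" using \<tau> \<sigma> by simp
    then show "q \<tau> = q \<sigma>"
      using \<tau> \<sigma> base.gmult_inv_eq_unitD[of "q \<tau>" "q \<sigma>"] by (simp add: q_unit_iff)
  qed (use \<sigma> in simp_all)
  then show ?thesis using \<sigma> by simp
qed

text \<open>The fibre of \<open>q\<close> over a unit contains a unit of the twist, so it is the orbit of that unit.\<close>

lemma unit_fibre:
  assumes "\<sigma> \<in> elems Sig" "q \<sigma> \<in> units G"
  obtains t where "t \<in> ring_units" "\<sigma> = act t (rng Sig \<sigma>)" "src Sig \<sigma> = rng Sig \<sigma>"
    "rng Sig \<sigma> = i (q \<sigma>, 1)"
proof -
  have "q \<sigma> = q (rng Sig \<sigma>)" using assms by simp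
  then obtain t where t: "t \<in> ring_units" "\<sigma> = act t (rng Sig \<sigma>)"
    using fibre_transitive[of \<sigma> "rng Sig \<sigma>"] assms by auto
  have "src Sig \<sigma> = rng Sig \<sigma>" using assms by (simp add: q_unit_iff)
  moreover have "rng Sig \<sigma> = i (q \<sigma>, 1)" using i_rng_one(1)[OF assms(1)] assms(2) by simp
  ultimately show ?thesis using t that by blast
qed

lemma B_eq_act:
  assumes "b \<in> B" "t \<in> ring_units" "\<sigma> \<in> elems Sig" "\<sigma> = act t (rng Sig \<sigma>)"
  shows "b \<sigma> = unit_inv t * b (rng Sig \<sigma>)"
  using equivariant_act[OF B_equivariant[OF assms(1)] assms(2), of "rng Sig \<sigma>"] assms by simp

text \<open>Over a unit, with \<open>\<sigma> = t \<cdot> x\<close>, the product of \<open>b\<close> and \<open>c\<close> has value \<open>b(x) t\<inverse> c(x)\<close>, which is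
  symmetric.\<close>

lemma commutative_subalgebra_B: "commutative_subalgebra Alg B"
proof -
  have closed: "b \<star> c \<in> B" if "b \<in> B" "c \<in> B" for b c
    by (rule B_I) (use that in \<open>auto simp: conv_B_left B_equivariant intro: A_conv B_A B_supp\<close>)
  have comm: "b \<star> c = c \<star> b" if b: "b \<in> B" and c: "c \<in> B" for b c
  proof
    fix \<sigma>
    show "(b \<star> c) \<sigma> = (c \<star> b) \<sigma>"
    proof (cases "\<sigma> \<in> elems Sig \<and> q \<sigma> \<in> units G")
      case True
      then obtain t where t: "t \<in> ring_units" "\<sigma> = act t (rng Sig \<sigma>)" using unit_fibre by metis
      have "b \<sigma> = unit_inv t * b (rng Sig \<sigma>)" "c \<sigma> = unit_inv t * c (rng Sig \<sigma>)"
        using B_eq_act[OF _ t(1) _ t(2)] b c True by blast+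
      then show ?thesis using True b c by (simp add: conv_B_left B_equivariant mult.left_commute mult.commute)
    next
      case False
      then show ?thesis using B_supp[OF closed[OF b c], of \<sigma>] B_supp[OF closed[OF c b], of \<sigma>]
        by (metis conv_outside)
    qed
  qed
  have add: "(\<lambda>\<sigma>. b \<sigma> + c \<sigma>) \<in> B" if b: "b \<in> B" and c: "c \<in> B" for b c
  proof (rule B_I)
    show "(\<lambda>\<sigma>. b \<sigma> + c \<sigma>) \<in> A" using b c by (intro A_add B_A)
    fix \<sigma> assume "\<sigma> \<in> elems Sig" "b \<sigma> + c \<sigma> \<noteq> 0"
    then show "q \<sigma> \<in> units G" using B_supp[OF b] B_supp[OF c] by (cases "b \<sigma> = 0") auto
  qed
  have smult: "(\<lambda>\<sigma>. t * b \<sigma>) \<in> B" if b: "b \<in> B" for b t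
  proof (rule B_I)
    show "(\<lambda>\<sigma>. t * b \<sigma>) \<in> A" using b by (intro A_smult B_A)
    fix \<sigma> assume "\<sigma> \<in> elems Sig" "t * b \<sigma> \<noteq> 0"
    then show "q \<sigma> \<in> units G" using B_supp[OF b] by (cases "b \<sigma> = 0") auto
  qed
  have "(\<lambda>_. 0) \<in> B" by (rule B_I) auto
  with closed comm add smult show ?thesis
    by (simp add: commutative_subalgebra_def subalgebra_def B_A subsetI)
qed

text \<open>The indicator function of \<open>W\<close> on units, extended equivariantly: its value at \<open>t \<cdot> x\<close> is \<open>t\<inverse>\<close>.\<close>

definition unit_idem :: "'g set \<Rightarrow> 's \<Rightarrow> 'r" where
  "unit_idem W \<sigma> = (if \<sigma> \<in> elems Sig \<and> q \<sigma> \<in> W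
     then unit_inv (THE t. t \<in> ring_units \<and> \<sigma> = act t (rng Sig \<sigma>)) else 0)"

lemma unit_idem_act:
  assumes "\<sigma> \<in> elems Sig" "q \<sigma> \<in> W" "t \<in> ring_units" "\<sigma> = act t (rng Sig \<sigma>)"
  shows "unit_idem W \<sigma> = unit_inv t"
proof -
  have "(THE t. t \<in> ring_units \<and> \<sigma> = act t (rng Sig \<sigma>)) = t"
  proof (rule the_equality)
    fix u assume "u \<in> ring_units \<and> \<sigma> = act u (rng Sig \<sigma>)"
    then show "u = t" using assms act_free[of "rng Sig \<sigma>" u t] by simp
  qed (use assms in blast)
  then show ?thesis using assms by (simp add: unit_idem_def)
qed

lemma unit_idem_unit: "x \<in> units Sig \<Longrightarrow> q x \<in> W \<Longrightarrow> unit_idem W x = 1"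
  using unit_idem_act[of x W 1] by simp

text \<open>The scalar \<open>t\<close> with \<open>\<sigma> = t \<cdot> r(\<sigma>)\<close> is chosen pointwise, so local constancy needs an argument: for a
  monomial \<open>n\<close> around \<open>q(\<sigma>)\<close>, the value is \<open>n(\<sigma>) n(r(\<sigma>))\<inverse>\<close>, in which both factors are locally constant.\<close>

lemma unit_idem_B:
  assumes W: "openin (gtop G) W" "compactin (gtop G) W" "W \<subseteq> units G"
  shows "unit_idem W \<in> B"
proof (rule B_I)
  show "unit_idem W \<in> A"
  proof (rule A_I[OF _ _ _ W(2)])
    show "equivariant (unit_idem W)"
      unfolding equivariant_def
    proof (intro conjI allI impI ballI)
      fix t :: 'r and \<sigma> assume t: "t \<in> ring_units" and \<sigma>: "\<sigma> \<in> elems Sig"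
      show "unit_idem W (act t \<sigma>) = unit_inv t * unit_idem W \<sigma>"
      proof (cases "q \<sigma> \<in> W")
        case True
        then have "q \<sigma> \<in> units G" using W by blast
        then obtain u where u: "u \<in> ring_units" "\<sigma> = act u (rng Sig \<sigma>)" using unit_fibre \<sigma> by metis
        have "act t \<sigma> = act (t * u) (rng Sig \<sigma>)"
          using arg_cong[OF u(2), of "act t"] act_act[of "rng Sig \<sigma>" t u] t u(1) \<sigma> by simp
        then have eq: "act t \<sigma> = act (t * u) (rng Sig (act t \<sigma>))"
          unfolding act_simps(2)[OF \<sigma> t] .
        have "unit_idem W (act t \<sigma>) = unit_inv (t * u)"
          by (rule unit_idem_act[OF _ _ ring_units_times(1)[OF t u(1)] eq])
            (use t \<sigma> True in simp_all)
        moreover have "unit_idem W \<sigma> = unit_inv u" by (rule unit_idem_act[OF \<sigma> True u])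
        ultimately show ?thesis using ring_units_times(2)[OF t u(1)] by simp
      qed (use t \<sigma> in \<open>simp add: unit_idem_def\<close>)
    qed (simp add: unit_idem_def)
    show "locally_constant (gtop Sig) (unit_idem W)"
      unfolding locally_constant_def
    proof
      fix \<sigma> assume \<sigma>: "\<sigma> \<in> elems Sig"
      show "\<exists>U. openin (gtop Sig) U \<and> \<sigma> \<in> U \<and> (\<forall>\<tau>\<in>U. unit_idem W \<tau> = unit_idem W \<sigma>)"
      proof (cases "q \<sigma> \<in> W")
        case True
        obtain n where n: "monomial n" "q \<sigma> \<in> gsupp n" "gsupp n \<subseteq> W"
          using ex_monomial[OF W(1) True] by metis
        have nA: "n \<in> A" and ne: "equivariant n" using n by (simp_all add: monomial_A monomial_equivariant)
        let ?h = "\<lambda>\<tau>. n \<tau> * unit_inv (n (rng Sig \<tau>))"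
        have eq: "unit_idem W \<tau> = ?h \<tau>" if \<tau>: "\<tau> \<in> elems Sig" "q \<tau> \<in> gsupp n" for \<tau>
        proof -
          have qW: "q \<tau> \<in> W" using \<tau> n by blast
          then have qu: "q \<tau> \<in> units G" using W by blast
          then obtain t where t: "t \<in> ring_units" "\<tau> = act t (rng Sig \<tau>)" using unit_fibre \<tau>(1) by metis
          have "q (rng Sig \<tau>) \<in> gsupp n" using \<tau> qu by simp
          then have "n (rng Sig \<tau>) \<noteq> 0" using gsupp_iff[OF ne, of "rng Sig \<tau>"] \<tau>(1) by simp
          then have u: "n (rng Sig \<tau>) \<in> ring_units" using monomial_unit n by blast
          have "n \<tau> = unit_inv t * n (rng Sig \<tau>)"
            using equivariant_act[OF ne t(1), of "rng Sig \<tau>"] t(2) \<tau>(1) by simp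
          then show ?thesis using unit_idem_act[OF \<tau>(1) qW t] u by (simp add: mult.assoc)
        qed
        have "locally_constant (gtop Sig) (\<lambda>\<tau>. n (rng Sig \<tau>))"
          using locally_constant_compose[of "gtop Sig" n, OF _ total.continuous_rng] nA by (simp add: A_iff)
        then have "locally_constant (gtop Sig) ?h"
          using nA locally_constant_combine[where f = n and h = "\<lambda>a b. a * unit_inv b"]
          by (simp add: A_iff)
        then have "\<exists>U. openin (gtop Sig) U \<and> \<sigma> \<in> U \<and> (\<forall>\<tau>\<in>U. ?h \<tau> = ?h \<sigma>)"
          using \<sigma> unfolding locally_constant_def by (rule bspec)
        then obtain U where U: "openin (gtop Sig) U" "\<sigma> \<in> U" "\<forall>\<tau>\<in>U. ?h \<tau> = ?h \<sigma>"
          by blast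
        let ?U = "U \<inter> {\<tau> \<in> elems Sig. q \<tau> \<in> gsupp n}"
        have "openin (gtop Sig) ?U"
          using U(1) openin_q_preimage openin_gsupp nA by (simp add: A_iff openin_Int)
        moreover have "unit_idem W \<tau> = unit_idem W \<sigma>" if \<tau>: "\<tau> \<in> ?U" for \<tau>
        proof -
          have "unit_idem W \<tau> = ?h \<tau>" using eq \<tau> by blast
          also have "\<dots> = ?h \<sigma>" using \<tau> by (intro bspec[OF U(3)]) blast
          also have "\<dots> = unit_idem W \<sigma>" using eq \<sigma> n(2) by simp
          finally show ?thesis .
        qed
        moreover have "\<sigma> \<in> ?U" using \<sigma> U(2) n(2) by blast
        ultimately show ?thesis by blast
      next
        case False
        have "openin (gtop G) (elems G - W)" using closedin_compact[OF W(2)] by blast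
        from openin_q_preimage[OF this] show ?thesis using False \<sigma>
          by (intro exI[of _ "{\<sigma> \<in> elems Sig. q \<sigma> \<in> elems G - W}"]) (simp add: unit_idem_def)
      qed
    qed
    show "gsupp (unit_idem W) \<subseteq> W" by (auto simp: supp_def unit_idem_def split: if_splits)
  qed
  fix \<sigma> assume "unit_idem W \<sigma> \<noteq> 0"
  then show "q \<sigma> \<in> units G" using W by (auto simp: unit_idem_def split: if_splits)
qed

lemma unit_idem_conv:
  assumes W: "openin (gtop G) W" "compactin (gtop G) W" "W \<subseteq> units G"
    and f: "f \<in> A" and sub: "rng G ` gsupp f \<subseteq> W"
  shows "unit_idem W \<star> f = f"
proof
  fix \<sigma>
  have fe: "equivariant f" using f by (rule A_equivariant)
  show "(unit_idem W \<star> f) \<sigma> = f \<sigma>"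
  proof (cases "\<sigma> \<in> elems Sig \<and> f \<sigma> \<noteq> 0")
    case True
    then have "q \<sigma> \<in> gsupp f" by (simp add: supp_def)
    then have "rng G (q \<sigma>) \<in> W" using sub by blast
    then have "unit_idem W (rng Sig \<sigma>) = 1" using True by (intro unit_idem_unit) auto
    then show ?thesis using True conv_B_left[OF unit_idem_B[OF W] fe] by simp
  next
    case False
    then show ?thesis using conv_B_left[OF unit_idem_B[OF W] fe] equivariant_outside[OF fe]
      by (cases "\<sigma> \<in> elems Sig") auto
  qed
qed

lemma conv_unit_idem:
  assumes W: "openin (gtop G) W" "compactin (gtop G) W" "W \<subseteq> units G"
    and f: "f \<in> A" and sub: "src G ` gsupp f \<subseteq> W"
  shows "f \<star> unit_idem W = f"
proof
  fix \<sigma>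
  have fe: "equivariant f" using f by (rule A_equivariant)
  show "(f \<star> unit_idem W) \<sigma> = f \<sigma>"
  proof (cases "\<sigma> \<in> elems Sig \<and> f \<sigma> \<noteq> 0")
    case True
    then have "q \<sigma> \<in> gsupp f" by (simp add: supp_def)
    then have "src G (q \<sigma>) \<in> W" using sub by blast
    then have "unit_idem W (src Sig \<sigma>) = 1" using True by (intro unit_idem_unit) auto
    then show ?thesis using True conv_B_right[OF f unit_idem_B[OF W]] by simp
  next
    case False
    then show ?thesis using conv_B_right[OF f unit_idem_B[OF W]] equivariant_outside[OF fe]
      by (cases "\<sigma> \<in> elems Sig") auto
  qed
qed

lemma unit_idem_idempotent:
  assumes W: "openin (gtop G) W" "compactin (gtop G) W" "W \<subseteq> units G"
  shows "unit_idem W \<in> idempotents Alg B"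
proof -
  have "rng G ` gsupp (unit_idem W) \<subseteq> W"
  proof
    fix x assume "x \<in> rng G ` gsupp (unit_idem W)"
    then obtain \<sigma> where "x = rng G (q \<sigma>)" "q \<sigma> \<in> W"
      by (auto simp: supp_def unit_idem_def split: if_splits)
    then show "x \<in> W" using W(3) by (metis base.units_simps(2) subsetD)
  qed
  then have "unit_idem W \<star> unit_idem W = unit_idem W"
    using unit_idem_conv[OF W B_A[OF unit_idem_B[OF W]]] by blast
  then show ?thesis using unit_idem_B[OF W] by (simp add: idempotents_def)
qed

lemma local_units_B: "local_units Alg (idempotents Alg B)"
  unfolding local_units_def
proof (intro allI impI)
  fix F assume F: "finite F \<and> F \<subseteq> acarrier Alg"
  let ?W = "\<Union>f\<in>F. rng G ` gsupp f \<union> src G ` gsupp f"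
  have FA: "f \<in> A" if "f \<in> F" for f using F that by auto
  have o: "openin (gtop G) ?W"
  proof (intro openin_Union ballI, clarify)
    fix f assume "f \<in> F"
    then have "openin (gtop G) (gsupp f)" using FA openin_gsupp by (simp add: A_iff)
    then show "openin (gtop G) (rng G ` gsupp f \<union> src G ` gsupp f)"
      by (intro openin_Un base.openin_rng_image base.openin_src_image)
  qed
  have c: "compactin (gtop G) ?W"
  proof (intro compactin_Union)
    show "finite ((\<lambda>f. rng G ` gsupp f \<union> src G ` gsupp f) ` F)" using F by blast
    fix S assume "S \<in> (\<lambda>f. rng G ` gsupp f \<union> src G ` gsupp f) ` F"
    then obtain f where f: "f \<in> F" "S = rng G ` gsupp f \<union> src G ` gsupp f" by blast
    then have "compactin (gtop G) (gsupp f)" using FA by (simp add: A_iff)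
    then show "compactin (gtop G) S"
      unfolding f(2)
      by (intro compactin_Un image_compactin[OF _ base.continuous_rng] image_compactin[OF _ base.continuous_src])
  qed
  have u: "?W \<subseteq> units G" using gsupp_elems by (auto simp: supp_def)
  have "unit_idem ?W \<star> f = f \<and> f \<star> unit_idem ?W = f" if "f \<in> F" for f
    using unit_idem_conv[OF o c u FA[OF that]] conv_unit_idem[OF o c u FA[OF that]] that by blast
  then show "\<exists>e\<in>idempotents Alg B. \<forall>a\<in>F. amult Alg e a = a \<and> amult Alg a e = a"
    using unit_idem_idempotent[OF o c u] by auto
qed

text \<open>An element of \<open>B\<close> is determined by its values on units, and these are locally constant; where they
  equal \<open>c\<close>, it is \<open>c\<close> times an indicator function.\<close>

lemma B_eq_span_idempotents: "B = lin_span Alg (idempotents Alg B)"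
proof
  show "B \<subseteq> lin_span Alg (idempotents Alg B)"
  proof
    fix b assume b: "b \<in> B"
    show "b \<in> lin_span Alg (idempotents Alg B)"
    proof (rule lin_span_if_local[OF B_A[OF b]])
      fix a assume a: "a \<in> gsupp b"
      from gsuppE[OF this] have au: "a \<in> units G" using B_supp[OF b] by metis
      let ?c = "b (i (a, 1))"
      let ?V = "{x \<in> units G. b (i (x, 1)) \<in> {?c}}"
      \<comment> \<open>The map \<open>x \<mapsto> i(x, 1)\<close> identifies the unit spaces, so \<open>?V\<close> is a level set of a locally
        constant function on the unit space of \<open>G\<close>.\<close>
      have "continuous_map (units_top G) (gtop (trivial_bundle G)) (\<lambda>x. (x, 1::'r))"
        by (simp add: trivial_bundle_def continuous_map_pairwise o_def continuous_map_id[unfolded id_def])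
      from continuous_map_compose[OF this continuous_i]
      have "continuous_map (units_top G) (gtop Sig) (\<lambda>x. i (x, 1))" by (simp add: o_def)
      then have "locally_constant (units_top G) (\<lambda>x. b (i (x, 1)))"
        using locally_constant_compose b B_A by (metis A_iff)
      from openin_locally_constant_preimage[OF this, of "{?c}"]
      have "openin (units_top G) ?V"
        using base.units_elems by (simp add: topspace_subtopology Int_absorb1 subsetI)
      then have V: "openin (gtop G) ?V" using openin_trans_full base.openin_units by blast
      have "\<exists>c. \<exists>x\<in>idempotents Alg B. restr W b = (\<lambda>\<sigma>. c * x \<sigma>)"
        if W: "openin (gtop G) W \<and> compactin (gtop G) W \<and> W \<subseteq> ?V" for W
      proof -
        have W': "openin (gtop G) W" "compactin (gtop G) W" "W \<subseteq> units G" using W by auto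
        have "restr W b \<sigma> = ?c * unit_idem W \<sigma>" for \<sigma>
        proof (cases "\<sigma> \<in> elems Sig \<and> q \<sigma> \<in> W")
          case True
          then obtain t where t: "t \<in> ring_units" "\<sigma> = act t (rng Sig \<sigma>)" "rng Sig \<sigma> = i (q \<sigma>, 1)"
            using unit_fibre W' by (metis subsetD)
          have "b (rng Sig \<sigma>) = ?c" using t(3) True W by auto
          then show ?thesis
            using B_eq_act[OF b t(1) _ t(2)] unit_idem_act[OF _ _ t(1,2)] True
            by (simp add: restr_def mult.commute)
        next
          case False
          then show ?thesis using equivariant_outside[OF B_equivariant[OF b]]
            by (auto simp: restr_def unit_idem_def)
        qed
        then have "restr W b = (\<lambda>\<sigma>. ?c * unit_idem W \<sigma>)" by blast
        then show ?thesis using unit_idem_idempotent[OF W'] by blast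
      qed
      moreover have "a \<in> ?V" using au by simp
      ultimately show "\<exists>V. openin (gtop G) V \<and> a \<in> V \<and>
        (\<forall>W. openin (gtop G) W \<and> compactin (gtop G) W \<and> W \<subseteq> V \<longrightarrow>
           (\<exists>c. \<exists>x\<in>idempotents Alg B. restr W b = (\<lambda>\<sigma>. c * x \<sigma>)))"
        using V by blast
    qed
  qed
  show "lin_span Alg (idempotents Alg B) \<subseteq> B"
  proof
    fix b assume "b \<in> lin_span Alg (idempotents Alg B)"
    then show "b \<in> B"
    proof induction
      case span_zero
      then show ?case using commutative_subalgebra_B by (simp add: commutative_subalgebra_def subalgebra_def)
    next
      case (span_step x y t)
      then have "x \<in> B" by (simp add: idempotents_def)
      then show ?case using span_step.IH commutative_subalgebra_B
        unfolding commutative_subalgebra_def subalgebra_def by blast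
    qed
  qed
qed

text \<open>On units convolution is pointwise, so a nonzero value of \<open>e\<close> at a unit is an idempotent of \<open>R\<close> and
  therefore \<open>1\<close>.\<close>

lemma idempotent_torsion_free:
  assumes ind: "indecomposable_ring TYPE('r)"
    and e: "e \<in> idempotents Alg B" "e \<noteq> (\<lambda>_. 0)" and t: "(\<lambda>\<sigma>. t * e \<sigma>) = (\<lambda>_. 0)"
  shows "t = 0"
proof -
  have eB: "e \<in> B" and ee: "e \<star> e = e" using e by (auto simp: idempotents_def)
  obtain \<sigma> where "e \<sigma> \<noteq> 0" using e(2) by blast
  then have \<sigma>: "\<sigma> \<in> elems Sig" "e \<sigma> \<noteq> 0"
    using equivariant_outside[OF B_equivariant[OF eB]] by blast+
  obtain u where u: "u \<in> ring_units" "\<sigma> = act u (rng Sig \<sigma>)"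
    using unit_fibre[OF \<sigma>(1) B_supp[OF eB \<sigma>]] by metis
  let ?x = "rng Sig \<sigma>"
  have "e ?x \<noteq> 0" using B_eq_act[OF eB u(1) \<sigma>(1) u(2)] \<sigma>(2) by auto
  moreover have "e ?x * e ?x = e ?x"
    using conv_B_left[OF eB B_equivariant[OF eB], of ?x] \<sigma>(1) ee by simp
  ultimately have "e ?x = 1" using ind unfolding indecomposable_ring_def by blast
  then show ?thesis using fun_cong[OF t, of ?x] by simp
qed

section \<open>Monomials are normalisers\<close>

text \<open>This is \<open>n\<^sup>\<dagger>\<close>, the normaliser inverse of a monomial \<open>n\<close>.\<close>

definition dag :: "('s \<Rightarrow> 'r) \<Rightarrow> 's \<Rightarrow> 'r" where
  "dag n \<sigma> = (if \<sigma> \<in> elems Sig \<and> n (ginv Sig \<sigma>) \<noteq> 0 then unit_inv (n (ginv Sig \<sigma>)) else 0)"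

lemma unit_nonzero: "(t::'r) \<in> ring_units \<Longrightarrow> t \<noteq> 0"
  using nontrivial by (auto simp: ring_units_def)

lemma dag_nonzero:
  assumes "monomial n" "\<sigma> \<in> elems Sig"
  shows "dag n \<sigma> \<noteq> 0 \<longleftrightarrow> n (ginv Sig \<sigma>) \<noteq> 0"
  using assms monomial_unit[OF assms(1)] unit_nonzero[OF unit_inv_closed] by (auto simp: dag_def)

lemma monomial_dag:
  assumes n: "monomial n"
  shows "monomial (dag n)"
proof -
  have nA: "n \<in> A" and ne: "equivariant n" using n by (simp_all add: monomial_A monomial_equivariant)
  have eq: "equivariant (dag n)"
    unfolding equivariant_def
  proof (intro conjI allI impI ballI)
    fix t :: 'r and \<sigma> assume t: "t \<in> ring_units" and \<sigma>: "\<sigma> \<in> elems Sig"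
    have "n (ginv Sig (act t \<sigma>)) = t * n (ginv Sig \<sigma>)"
      using t \<sigma> ne by (simp add: inv_act equivariant_act)
    then show "dag n (act t \<sigma>) = unit_inv t * dag n \<sigma>"
      using t \<sigma> monomial_unit[OF n] ring_units_times[OF t] by (simp add: dag_def)
  qed (simp add: dag_def)
  have sub: "gsupp (dag n) \<subseteq> ginv G ` gsupp n"
  proof
    fix a assume "a \<in> gsupp (dag n)"
    then obtain \<sigma> where \<sigma>: "\<sigma> \<in> elems Sig" "q \<sigma> = a" "dag n \<sigma> \<noteq> 0" by (rule gsuppE)
    then have "ginv Sig \<sigma> \<in> supp Sig n" using n by (simp add: dag_nonzero supp_def)
    then have "q (ginv Sig \<sigma>) \<in> gsupp n" by (rule imageI)
    moreover have "a = ginv G (q (ginv Sig \<sigma>))" using \<sigma>(1) by (simp flip: \<sigma>(2))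
    ultimately show "a \<in> ginv G ` gsupp n" by blast
  qed
  have "locally_constant (gtop Sig) (\<lambda>\<sigma>. n (ginv Sig \<sigma>))"
    using locally_constant_compose[of "gtop Sig" n, OF _ total.continuous_inv] nA by (simp add: A_iff)
  then have "locally_constant (gtop Sig) (\<lambda>\<sigma>. if n (ginv Sig \<sigma>) \<noteq> 0 then unit_inv (n (ginv Sig \<sigma>)) else 0)"
    using locally_constant_combine[where f = "\<lambda>\<sigma>. n (ginv Sig \<sigma>)" and g = "\<lambda>_. ()"
        and h = "\<lambda>a _. if a \<noteq> 0 then unit_inv a else 0"] by simp
  then have lc: "locally_constant (gtop Sig) (dag n)"
    by (rule locally_constant_eq) (simp add: dag_def)
  have "compactin (gtop G) (ginv G ` gsupp n)"
    using image_compactin[OF _ base.continuous_inv] nA by (simp add: A_iff)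
  then have "dag n \<in> A" using A_I[OF eq lc sub] by blast
  moreover have "dag n \<sigma> \<in> ring_units" if "dag n \<sigma> \<noteq> 0" for \<sigma>
    using that monomial_unit[OF n] by (auto simp: dag_def split: if_splits)
  moreover have "inj_on (rng G) (gsupp (dag n))" "inj_on (src G) (gsupp (dag n))"
  proof -
    have inj: "inj_on h (ginv G ` gsupp n)"
      if h: "\<And>a. a \<in> gsupp n \<Longrightarrow> h (ginv G a) = k a" and k: "inj_on k (gsupp n)" for h k :: "'g \<Rightarrow> 'g"
    proof (rule inj_onI)
      fix x y assume "x \<in> ginv G ` gsupp n" "y \<in> ginv G ` gsupp n" and "h x = h y"
      then obtain a b where ab: "a \<in> gsupp n" "b \<in> gsupp n" and "x = ginv G a" "y = ginv G b" by blast
      with \<open>h x = h y\<close> have "k a = k b" using h[OF ab(1)] h[OF ab(2)] by simp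
      then show "x = y" using inj_onD[OF k _ ab] \<open>x = ginv G a\<close> \<open>y = ginv G b\<close> by simp
    qed
    have "a \<in> elems G" if "a \<in> gsupp n" for a using gsupp_elems that by blast
    then have "inj_on (rng G) (ginv G ` gsupp n)" "inj_on (src G) (ginv G ` gsupp n)"
      using n unfolding monomial_def by (blast intro: inj base.rng_inv base.src_inv)+
    then show "inj_on (rng G) (gsupp (dag n))" "inj_on (src G) (gsupp (dag n))"
      using sub by (auto intro: inj_on_subset)
  qed
  ultimately show ?thesis by (simp add: monomial_def)
qed

lemma dag_dag:
  assumes n: "monomial n"
  shows "dag (dag n) = n"
proof
  fix \<sigma>
  show "dag (dag n) \<sigma> = n \<sigma>"
  proof (cases "\<sigma> \<in> elems Sig")
    case True
    then show ?thesis
      using monomial_unit[OF n, of \<sigma>] unit_nonzero[OF unit_inv_closed[OF monomial_unit[OF n, of \<sigma>]]]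
      by (auto simp: dag_def)
  qed (use equivariant_outside[OF monomial_equivariant[OF n]] in \<open>simp add: dag_def\<close>)
qed

text \<open>So convolution by \<open>dag n \<star> n\<close> is the identity over the sources of the support of \<open>n\<close>: the factors
  \<open>n(\<tau>)\<inverse>\<close> and \<open>n(\<tau>)\<close> cancel.\<close>

lemma dag_conv_conv:
  assumes n: "monomial n" and g: "g \<in> A" and \<sigma>: "\<sigma> \<in> elems Sig"
    and \<tau>: "\<tau> \<in> elems Sig" "src Sig \<tau> = rng Sig \<sigma>" "n \<tau> \<noteq> 0"
  shows "(dag n \<star> (n \<star> g)) \<sigma> = g \<sigma>"
proof -
  have ge: "equivariant g" and nge: "equivariant (n \<star> g)"
    using g n A_conv by (simp_all add: A_equivariant monomial_A)
  have u: "n \<tau> \<in> ring_units" using monomial_unit[OF n \<tau>(3)] .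
  have "dag n (ginv Sig \<tau>) \<noteq> 0" using n \<tau> by (simp add: dag_nonzero)
  then have "(dag n \<star> (n \<star> g)) \<sigma> = dag n (ginv Sig \<tau>) * (n \<star> g) (gmult Sig (ginv Sig (ginv Sig \<tau>)) \<sigma>)"
    using \<tau> \<sigma> by (intro monomial_conv[OF monomial_dag[OF n] nge]) simp_all
  also have "\<dots> = unit_inv (n \<tau>) * (n \<star> g) (gmult Sig \<tau> \<sigma>)"
    using \<tau> by (simp add: dag_def)
  also have "(n \<star> g) (gmult Sig \<tau> \<sigma>) = n \<tau> * g (gmult Sig (ginv Sig \<tau>) (gmult Sig \<tau> \<sigma>))"
    using \<tau> \<sigma> by (intro monomial_conv[OF n ge]) simp_all
  also have "gmult Sig (ginv Sig \<tau>) (gmult Sig \<tau> \<sigma>) = \<sigma>" using \<tau> \<sigma> by simp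
  finally show ?thesis using u unit_inv_cancel(1)[OF u, of "g \<sigma>"] by simp
qed

lemma dag_conv_dag:
  assumes n: "monomial n"
  shows "(dag n \<star> n) \<star> dag n = dag n"
proof -
  have nA: "n \<in> A" and dA: "dag n \<in> A" using n monomial_dag monomial_A by auto
  have nd: "equivariant (n \<star> dag n)" using nA dA A_conv by (simp add: A_equivariant)
  have "(dag n \<star> (n \<star> dag n)) \<sigma> = dag n \<sigma>" for \<sigma>
  proof (cases "\<exists>\<tau>\<in>elems Sig. \<sigma> \<in> elems Sig \<and> src Sig \<tau> = rng Sig \<sigma> \<and> n \<tau> \<noteq> 0")
    case True
    then show ?thesis using dag_conv_conv[OF n dA] by blast
  next
    case False
    have "(dag n \<star> (n \<star> dag n)) \<sigma> = 0"
    proof (rule ccontr)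
      assume ne: "(dag n \<star> (n \<star> dag n)) \<sigma> \<noteq> 0"
      then have \<sigma>: "\<sigma> \<in> elems Sig" using conv_outside by blast
      obtain \<tau> where \<tau>: "\<tau> \<in> elems Sig" "rng Sig \<tau> = rng Sig \<sigma>" "dag n \<tau> \<noteq> 0"
        using conv_nonzeroE[OF dA nd \<sigma> ne] by metis
      then have "ginv Sig \<tau> \<in> elems Sig \<and> src Sig (ginv Sig \<tau>) = rng Sig \<sigma> \<and> n (ginv Sig \<tau>) \<noteq> 0"
        using n by (simp add: dag_nonzero)
      with False \<sigma> show False by blast
    qed
    moreover have "dag n \<sigma> = 0"
    proof (rule ccontr)
      assume "dag n \<sigma> \<noteq> 0"
      then have "\<sigma> \<in> elems Sig" "n (ginv Sig \<sigma>) \<noteq> 0" by (auto simp: dag_def split: if_splits)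
      with False show False by (metis total.inv_closed total.src_inv)
    qed
    ultimately show ?thesis by simp
  qed
  then show ?thesis using conv_assoc[OF dA nA dA] by auto
qed

text \<open>A nonzero value at \<open>\<sigma>\<close> requires some \<open>\<tau>\<close> with \<open>n(\<tau>\<inverse>)\<close> and \<open>n(\<tau>\<inverse> \<sigma>)\<close> nonzero. Both arguments have the same
  range, so they agree in \<open>G\<close>, and \<open>\<sigma>\<close> lies over a unit.\<close>

lemma dag_conv_B:
  assumes n: "monomial n" and b: "b \<in> B"
  shows "(dag n \<star> b) \<star> n \<in> B"
proof (rule B_I)
  have nA: "n \<in> A" and dA: "dag n \<in> A" and bA: "b \<in> A" and ne: "equivariant n"
    using n b monomial_dag monomial_A monomial_equivariant B_A by auto
  show "(dag n \<star> b) \<star> n \<in> A" using nA dA bA by (intro A_conv)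
  fix \<sigma> assume \<sigma>: "\<sigma> \<in> elems Sig" and "((dag n \<star> b) \<star> n) \<sigma> \<noteq> 0"
  then have "(dag n \<star> (b \<star> n)) \<sigma> \<noteq> 0" using conv_assoc[OF dA bA nA] by simp
  then obtain \<tau> where \<tau>: "\<tau> \<in> elems Sig" "rng Sig \<tau> = rng Sig \<sigma>" "dag n \<tau> \<noteq> 0"
    "(b \<star> n) (gmult Sig (ginv Sig \<tau>) \<sigma>) \<noteq> 0"
    using conv_nonzeroE[OF dA A_equivariant[OF A_conv[OF bA nA]] \<sigma>] by metis
  let ?\<rho> = "gmult Sig (ginv Sig \<tau>) \<sigma>"
  have \<rho>: "?\<rho> \<in> elems Sig" "rng Sig ?\<rho> = rng Sig (ginv Sig \<tau>)" using \<tau> \<sigma> by simp_all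
  have "n ?\<rho> \<noteq> 0" using \<tau>(4) conv_B_left[OF b ne \<rho>(1)] by auto
  moreover have "n (ginv Sig \<tau>) \<noteq> 0" using \<tau> n by (simp add: dag_nonzero)
  ultimately have "q ?\<rho> = q (ginv Sig \<tau>)"
    using monomial_supp_inj(1)[OF n \<rho>(1) _ _ _ \<rho>(2)] \<tau>(1) by simp
  then have "gmult G (ginv G (q \<tau>)) (q \<sigma>) = ginv G (q \<tau>)" using \<tau> \<sigma> by simp
  moreover have "rng G (q \<tau>) = rng G (q \<sigma>)" using \<tau> \<sigma> by (simp flip: q_unit_iff)
  ultimately have "q \<sigma> = src G (ginv G (q \<tau>))"
    using base.unit_if_right_absorbed[of "ginv G (q \<tau>)" "q \<sigma>"] \<tau> \<sigma> by simp
  then show "q \<sigma> \<in> units G" using \<tau>(1) by simp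
qed

lemma normaliser_inverse_dag:
  assumes n: "monomial n"
  shows "normaliser_inverse Alg B n (dag n)"
proof -
  note d = monomial_dag[OF n]
  have "(n \<star> dag n) \<star> n = n" using dag_conv_dag[OF d] dag_dag[OF n] by simp
  moreover have "(n \<star> b) \<star> dag n \<in> B" if "b \<in> B" for b
    using dag_conv_B[OF d that] dag_dag[OF n] by simp
  ultimately show ?thesis
    using dag_conv_dag[OF n] dag_conv_B[OF n] monomial_A[OF d] by (simp add: normaliser_inverse_def)
qed

lemma monomial_normaliser: "monomial n \<Longrightarrow> n \<in> normalisers Alg B"
  using normaliser_inverse_dag monomial_A by (auto simp: normalisers_def)

lemma A_eq_span_normalisers: "acarrier Alg = lin_span Alg (normalisers Alg B)"
proof
  have "Collect monomial \<subseteq> normalisers Alg B" using monomial_normaliser by blast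
  then show "acarrier Alg \<subseteq> lin_span Alg (normalisers Alg B)"
    using lin_span_mono[of "Collect monomial" "normalisers Alg B"] A_eq_span_monomials by auto
  show "lin_span Alg (normalisers Alg B) \<subseteq> acarrier Alg"
    using lin_span_subset_A[of "normalisers Alg B"] by (auto simp: normalisers_def)
qed

section \<open>The conditional expectation\<close>

text \<open>Multiplying by elements of \<open>B\<close> on both sides only scales the values of a function, so it commutes
  with restriction to the unit space.\<close>

lemma conditional_expectation_restr: "conditional_expectation Alg B (restr (units G))"
  unfolding conditional_expectation_def
proof (intro conjI allI ballI subsetI)
  have PA: "restr (units G) f \<in> A" if "f \<in> A" for f
    using A_restr[OF that base.openin_units base.closedin_units[OF Hausdorff]] .
  then have PB: "restr (units G) f \<in> B" if "f \<in> A" for f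
    using that by (intro B_I) (auto simp: restr_def split: if_splits)
  fix f assume "f \<in> restr (units G) ` acarrier Alg"
  then show "f \<in> B" using PB by auto
next
  fix b assume b: "b \<in> B"
  show "restr (units G) b = b"
  proof
    fix \<sigma> show "restr (units G) b \<sigma> = b \<sigma>"
      using B_supp[OF b, of \<sigma>] equivariant_outside[OF B_equivariant[OF b], of \<sigma>]
      by (auto simp: restr_def)
  qed
next
  fix b f c assume b: "b \<in> B" and f: "f \<in> acarrier Alg" and c: "c \<in> B"
  have fA: "f \<in> A" using f by simp
  have PA: "restr (units G) f \<in> A"
    using A_restr[OF fA base.openin_units base.closedin_units[OF Hausdorff]] .
  have val: "((b \<star> g) \<star> c) \<sigma> = b (rng Sig \<sigma>) * g \<sigma> * c (src Sig \<sigma>)"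
    if "g \<in> A" "\<sigma> \<in> elems Sig" for g \<sigma>
    using that b c by (simp add: conv_B_right A_conv B_A conv_B_left A_equivariant)
  have "restr (units G) ((b \<star> f) \<star> c) \<sigma> = ((b \<star> restr (units G) f) \<star> c) \<sigma>" for \<sigma>
    using val[OF fA, of \<sigma>] val[OF PA, of \<sigma>] by (cases "\<sigma> \<in> elems Sig") (auto simp: restr_def)
  then show "restr (units G) (amult Alg (amult Alg b f) c) = amult Alg (amult Alg b (restr (units G) f)) c"
    by auto
qed (auto simp: restr_def fun_eq_iff)

text \<open>If \<open>f(\<sigma>)\<close> is nonzero and \<open>n\<close> is a monomial with \<open>n(\<sigma>\<inverse>)\<close> nonzero, then \<open>n \<star> f\<close> has at the unit \<open>s(\<sigma>)\<close> the
  value \<open>n(\<sigma>\<inverse>) f(\<sigma>)\<close>.\<close>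

lemma faithful_expectation_restr: "faithful_expectation Alg B (restr (units G))"
  unfolding faithful_expectation_def
proof (intro ballI impI)
  fix f assume "f \<in> acarrier Alg" and ne: "f \<noteq> azero Alg"
  then have f: "f \<in> A" by simp
  have fe: "equivariant f" using f by (rule A_equivariant)
  obtain \<sigma> where f\<sigma>: "f \<sigma> \<noteq> 0" using ne by auto
  then have \<sigma>: "\<sigma> \<in> elems Sig" using equivariant_outside[OF fe] by blast
  obtain n where n: "monomial n" "ginv G (q \<sigma>) \<in> gsupp n"
    using ex_monomial[OF openin_topspace, of "ginv G (q \<sigma>)"] \<sigma>
    by (metis base.inv_closed q_simps(1))
  let ?\<tau> = "ginv Sig \<sigma>" and ?x = "src Sig \<sigma>"
  have n\<tau>: "n ?\<tau> \<noteq> 0" using gsupp_iff[OF monomial_equivariant[OF n(1)], of ?\<tau>] n(2) \<sigma> by simp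
  have "(n \<star> f) ?x = n ?\<tau> * f (gmult Sig (ginv Sig ?\<tau>) ?x)"
    using n\<tau> \<sigma> by (intro monomial_conv[OF n(1) fe]) simp_all
  also have "\<dots> = n ?\<tau> * f \<sigma>" using \<sigma> by simp
  finally have "(n \<star> f) ?x \<noteq> 0" using monomial_unit[OF n(1) n\<tau>] f\<sigma> by simp
  moreover have "q ?x \<in> units G" using \<sigma> by simp
  ultimately have "restr (units G) (n \<star> f) ?x \<noteq> 0" by (simp add: restr_def)
  then have "restr (units G) (amult Alg n f) \<noteq> azero Alg" by (auto simp: fun_eq_iff)
  then show "\<exists>n\<in>normalisers Alg B. restr (units G) (amult Alg n f) \<noteq> azero Alg"
    using monomial_normaliser[OF n(1)] by blast
qed

lemma quasi_cartan_conditions_B: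
  assumes "indecomposable_ring TYPE('r)"
  shows "quasi_cartan_conditions Alg B"
  unfolding quasi_cartan_conditions_def
proof (intro conjI)
  show "\<forall>t. \<forall>e\<in>idempotents Alg B - {azero Alg}. asmult Alg t e = azero Alg \<longrightarrow> t = 0"
    using idempotent_torsion_free[OF assms] by auto
  show "\<exists>P. conditional_expectation Alg B P \<and> faithful_expectation Alg B P"
    using conditional_expectation_restr faithful_expectation_restr by blast
qed (fact nonunital_algebra_Alg commutative_subalgebra_B local_units_B B_eq_span_idempotents
  A_eq_span_normalisers)+

section \<open>Effective and principal groupoids\<close>

text \<open>Suppose that \<open>f\<close> commutes with \<open>B\<close>. If range and source of \<open>\<sigma>\<close> differed, the indicator function of a
  set separating them would give \<open>f(\<sigma>) = 0\<close>. So the open set \<open>q(supp f)\<close> is contained in the isotropy.\<close>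

lemma B_maximal_commutative:
  assumes eff: "effective_groupoid G" and C: "commutative_subalgebra Alg C" "B \<subseteq> C"
  shows "C = B"
proof (rule antisym[OF _ C(2)], rule subsetI)
  fix f assume fC: "f \<in> C"
  then have f: "f \<in> A" using C by (auto simp: commutative_subalgebra_def subalgebra_def)
  have fe: "equivariant f" using f by (rule A_equivariant)
  have "gsupp f \<subseteq> Iso G"
  proof
    fix a assume "a \<in> gsupp f"
    then obtain \<sigma> where \<sigma>: "\<sigma> \<in> elems Sig" "q \<sigma> = a" "f \<sigma> \<noteq> 0" by (rule gsuppE)
    have "rng G a = src G a"
    proof (rule ccontr)
      assume ne: "rng G a \<noteq> src G a"
      have ae: "a \<in> elems G" using \<sigma> by auto
      have "openin (gtop G) (elems G - {src G a})"
        using Hausdorff ae closedin_compact[of "{src G a}"] by (simp add: closedin_def)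
      then have "openin (gtop G) (units G \<inter> (elems G - {src G a}))"
        using base.openin_units by blast
      moreover have "rng G a \<in> units G \<inter> (elems G - {src G a})" using ae ne by simp
      ultimately obtain W where W: "openin (gtop G) W" "compactin (gtop G) W" "rng G a \<in> W"
        "W \<subseteq> units G \<inter> (elems G - {src G a})"
        using base.compact_open_bisection_nbhd by metis
      then have Wu: "W \<subseteq> units G" by blast
      note e = unit_idem_B[OF W(1,2) Wu]
      have "unit_idem W \<star> f = f \<star> unit_idem W"
        using C fC e by (auto simp: commutative_subalgebra_def)
      then have "unit_idem W (rng Sig \<sigma>) * f \<sigma> = f \<sigma> * unit_idem W (src Sig \<sigma>)"
        using conv_B_left[OF e fe \<sigma>(1)] conv_B_right[OF f e \<sigma>(1)] by simp
      moreover have "unit_idem W (rng Sig \<sigma>) = 1"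
        using W(3) \<sigma> by (intro unit_idem_unit) auto
      moreover have "unit_idem W (src Sig \<sigma>) = 0"
        using W(4) \<sigma> by (auto simp: unit_idem_def)
      ultimately show False using \<sigma>(3) by simp
    qed
    then show "a \<in> Iso G" using \<sigma> by (auto simp: Iso_def)
  qed
  moreover have "openin (gtop G) (gsupp f)" using f openin_gsupp by (simp add: A_iff)
  ultimately have "gsupp f \<subseteq> units G"
    using eff interior_of_maximal unfolding effective_groupoid_def by metis
  then show "f \<in> B" using f by (intro B_I) (auto simp: supp_def)
qed

text \<open>If \<open>n \<star> n\<close> were nonzero, the source of one element of the support would be the range of another. So
  \<open>n \<star> n = 0\<close>, and this is the middle of \<open>(n\<^sup>\<dagger> n)(n n\<^sup>\<dagger>)\<close>.\<close>

lemma monomial_free: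
  assumes n: "monomial n" and disj: "rng G ` gsupp n \<inter> src G ` gsupp n = {}"
  shows "n \<in> free_normalisers Alg B"
proof -
  have nA: "n \<in> A" and dA: "dag n \<in> A" and ne: "equivariant n"
    using n monomial_dag monomial_A monomial_equivariant by auto
  have "n \<star> n = (\<lambda>_. 0)"
  proof (rule ext, rule ccontr)
    fix \<sigma> assume nz: "(n \<star> n) \<sigma> \<noteq> 0"
    then have \<sigma>: "\<sigma> \<in> elems Sig" using conv_outside by blast
    obtain \<tau> where \<tau>: "\<tau> \<in> elems Sig" "rng Sig \<tau> = rng Sig \<sigma>" "n \<tau> \<noteq> 0"
      "n (gmult Sig (ginv Sig \<tau>) \<sigma>) \<noteq> 0"
      using conv_nonzeroE[OF nA ne \<sigma> nz] by metis
    let ?\<rho> = "gmult Sig (ginv Sig \<tau>) \<sigma>"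
    have \<rho>: "?\<rho> \<in> elems Sig" "src Sig \<tau> = rng Sig ?\<rho>" using \<tau> \<sigma> by simp_all
    then have "q \<tau> \<in> gsupp n" "q ?\<rho> \<in> gsupp n" "src G (q \<tau>) = rng G (q ?\<rho>)"
      using \<tau> by (simp_all add: supp_def flip: q_unit_iff)
    then show False using disj by blast
  qed
  then have "(dag n \<star> n) \<star> (n \<star> dag n) = (\<lambda>_. 0)"
    using conv_assoc[OF dA nA A_conv[OF nA dA]] conv_assoc[OF nA nA dA] conv_assoc[OF dA A_zero dA]
      conv_smult_right[OF dA A_equivariant[OF dA], of 0] by simp
  moreover have "dagger Alg B n = dag n"
    unfolding dagger_def
  proof (rule the_equality)
    show "normaliser_inverse Alg B n (dag n)" by (rule normaliser_inverse_dag[OF n])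
    fix k assume "normaliser_inverse Alg B n k"
    then show "k = dag n"
      using normaliser_inverse_unique[OF nonunital_algebra_Alg commutative_subalgebra_B local_units_B]
        normaliser_inverse_dag[OF n] nA by simp
  qed
  ultimately show ?thesis using monomial_normaliser[OF n] by (simp add: free_normalisers_def)
qed

text \<open>Every \<open>a\<close> has a neighbourhood all of whose monomials are free: the unit space if \<open>a\<close> is a unit, and
  otherwise a set on which range and source stay in disjoint open sets.\<close>

lemma A_eq_span_free_normalisers:
  assumes prin: "principal_groupoid G"
  shows "acarrier Alg = lin_span Alg (free_normalisers Alg B)"
proof
  show "lin_span Alg (free_normalisers Alg B) \<subseteq> acarrier Alg"
    using lin_span_subset_A[of "free_normalisers Alg B"]
    by (auto simp: normalisers_def free_normalisers_def)
  show "acarrier Alg \<subseteq> lin_span Alg (free_normalisers Alg B)"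
  proof
    fix f assume "f \<in> acarrier Alg"
    then have f: "f \<in> A" by simp
    show "f \<in> lin_span Alg (free_normalisers Alg B)"
    proof (rule lin_span_if_local[OF f])
      fix a assume "a \<in> gsupp f"
      then have a: "a \<in> elems G" using gsupp_elems by blast
      obtain V c where V: "openin (gtop G) V" "a \<in> V"
        and loc: "\<And>W. openin (gtop G) W \<Longrightarrow> compactin (gtop G) W \<Longrightarrow> W \<subseteq> V \<Longrightarrow>
          \<exists>n. monomial n \<and> gsupp n = W \<and> restr W f = (\<lambda>\<sigma>. c * n \<sigma>)"
        using local_monomial_form[OF f a] by metis
      obtain O' where O': "openin (gtop G) O'" "a \<in> O'"
        "\<And>n. monomial n \<Longrightarrow> gsupp n \<subseteq> O' \<Longrightarrow> n \<in> free_normalisers Alg B"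
      proof (cases "a \<in> units G")
        case True
        show ?thesis
        proof (rule that[OF base.openin_units True])
          fix n assume n: "monomial n" "gsupp n \<subseteq> units G"
          then have "n \<in> B" by (intro B_I) (auto simp: monomial_A supp_def)
          then show "n \<in> free_normalisers Alg B"
            using monomial_normaliser[OF n(1)] by (simp add: free_normalisers_def)
        qed
      next
        case False
        then have "rng G a \<noteq> src G a" using prin a by (auto simp: principal_groupoid_def Iso_def)
        then obtain O1 O2 where O12: "openin (gtop G) O1" "openin (gtop G) O2"
          "rng G a \<in> O1" "src G a \<in> O2" "disjnt O1 O2"
          using Hausdorff a unfolding Hausdorff_space_def
          by (metis base.rng_closed base.src_closed)
        show ?thesis
        proof (rule that[of "{b \<in> elems G. rng G b \<in> O1} \<inter> {b \<in> elems G. src G b \<in> O2}"])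
          show "openin (gtop G) ({b \<in> elems G. rng G b \<in> O1} \<inter> {b \<in> elems G. src G b \<in> O2})"
            using O12 base.continuous_rng base.continuous_src
            by (intro openin_Int openin_continuous_map_preimage)
          fix n assume n: "monomial n"
            "gsupp n \<subseteq> {b \<in> elems G. rng G b \<in> O1} \<inter> {b \<in> elems G. src G b \<in> O2}"
          then have "rng G ` gsupp n \<subseteq> O1" "src G ` gsupp n \<subseteq> O2" by blast+
          then have "rng G ` gsupp n \<inter> src G ` gsupp n = {}"
            using O12(5) unfolding disjnt_def by blast
          with n(1) show "n \<in> free_normalisers Alg B" by (rule monomial_free)
        qed (use O12 a in auto)
      qed
      have "\<exists>c. \<exists>x\<in>free_normalisers Alg B. restr W f = (\<lambda>\<sigma>. c * x \<sigma>)"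
        if W: "openin (gtop G) W \<and> compactin (gtop G) W \<and> W \<subseteq> V \<inter> O'" for W
        using loc[of W] O'(3) W by blast
      then show "\<exists>V. openin (gtop G) V \<and> a \<in> V \<and>
        (\<forall>W. openin (gtop G) W \<and> compactin (gtop G) W \<and> W \<subseteq> V \<longrightarrow>
           (\<exists>c. \<exists>x\<in>free_normalisers Alg B. restr W f = (\<lambda>\<sigma>. c * x \<sigma>)))"
        using V O' by (intro exI[of _ "V \<inter> O'"]) blast
    qed
  qed
qed

end

section \<open>The zero ring\<close>

text \<open>There is only one function with values in the zero ring.\<close>

lemma zero_ring_pairs:
  fixes i :: "'g \<times> 'r::{comm_ring,comm_monoid_mult} \<Rightarrow> 's"
  assumes "(1::'r) = 0"
  shows "algebraic_cartan_pair (twisted_steinberg_algebra G Sig i q) (steinberg_unit_subalgebra G Sig i q)"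
    "algebraic_diagonal_pair (twisted_steinberg_algebra G Sig i q) (steinberg_unit_subalgebra G Sig i q)"
proof -
  let ?A = "twisted_steinberg_algebra G Sig i q" and ?B = "steinberg_unit_subalgebra G Sig i q"
  have r: "x = y" for x y :: 'r
    using mult_1[of x] mult_1[of y] assms by (metis mult_zero_left)
  have eq: "f = g" for f g :: "'s \<Rightarrow> 'r" using r by blast
  have zA: "(\<lambda>_. 0) \<in> steinberg_functions G Sig i q"
    by (auto simp: steinberg_functions_def locally_constant_def supp_def)
  then have sf: "steinberg_functions G Sig i q = UNIV" using eq by (metis UNIV_eq_I)
  have A: "acarrier ?A = UNIV" by (simp add: twisted_steinberg_algebra_def sf)
  have "(\<lambda>_. 0) \<in> ?B" using zA by (auto simp: steinberg_unit_subalgebra_def supp_def)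
  then have B: "?B = UNIV" using eq by (metis UNIV_eq_I)
  have U: "X = UNIV" if "x \<in> X" for x and X :: "('s \<Rightarrow> 'r) set" using that eq by (metis UNIV_eq_I)
  have span: "lin_span ?A X = UNIV" for X using U lin_span.span_zero by metis
  have norm: "normalisers ?A ?B = UNIV"
    using eq by (auto simp: normalisers_def normaliser_inverse_def A B)
  have nu: "nonunital_algebra ?A"
    by standard (auto simp: A intro: eq)
  have "quasi_cartan_conditions ?A ?B"
    unfolding quasi_cartan_conditions_def
  proof (intro conjI)
    show "commutative_subalgebra ?A ?B"
      by (auto simp: commutative_subalgebra_def subalgebra_def A B intro: eq)
    show "local_units ?A (idempotents ?A ?B)"
      unfolding local_units_def idempotents_def B using eq by blast
    show "\<exists>P. conditional_expectation ?A ?B P \<and> faithful_expectation ?A ?B P"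
      unfolding conditional_expectation_def faithful_expectation_def B using eq by blast
  qed (use nu span A B r in auto)
  then show "algebraic_cartan_pair ?A ?B" "algebraic_diagonal_pair ?A ?B"
    unfolding algebraic_cartan_pair_def algebraic_diagonal_pair_def span A B by auto
qed

section \<open>The pairs of a twist\<close>

theorem proposition4p8:
  fixes G :: "'g groupoid_data"
    and Sig :: "'s groupoid_data"
    and i :: "'g \<times> 'r::{comm_ring,comm_monoid_mult} \<Rightarrow> 's"
    and q :: "'s \<Rightarrow> 'g"
  assumes "indecomposable_ring TYPE('r)"
    and "ample_groupoid G"
    and "Hausdorff_space (gtop G)"
    and "discrete_twist G Sig i q"
  shows "(effective_groupoid G \<longrightarrow>
            algebraic_cartan_pair (twisted_steinberg_algebra G Sig i q)
              (steinberg_unit_subalgebra G Sig i q)) \<and>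
         (principal_groupoid G \<longrightarrow>
            algebraic_diagonal_pair (twisted_steinberg_algebra G Sig i q)
              (steinberg_unit_subalgebra G Sig i q))"
proof (cases "(1::'r) = 0")
  case True
  then show ?thesis using zero_ring_pairs by blast
next
  case False
  interpret ample_groupoid G by fact
  interpret discrete_twist G Sig i q by fact
  interpret ample_twist G Sig i q
    by unfold_locales (use assms(3) False in auto)
  show ?thesis
    using quasi_cartan_conditions_B[OF assms(1)] B_maximal_commutative A_eq_span_free_normalisers
    by (auto simp: algebraic_cartan_pair_def algebraic_diagonal_pair_def)
qed

end
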